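(* Let $n$ be a natural number with $kp\le n\le(k+1)p-1$ for some $k\in\mathbb N$, and let $\mathcal S_n(a)$ be the rank-one $p$-DG module over $\mathrm{Sym}_n$ generated by $v_a$ with $\partial_a(v_a)=a e_1v_a$. (i) The inclusion $\Bbbk[e_p^p,e_{2p}^p,\dots,e_{kp}^p]\to\mathrm{Sym}_n$, where $\Bbbk[e_p^p,\dots,e_{kp}^p]$ is equipped with the trivial differential, is a quasi-isomorphism of $p$-DG algebras. (ii) When $1\le a\le n-kp$, the rank-one $p$-DG module $\mathcal S_n(a)$ is acyclic. (iii) When $n-kp+1\le a\le p-1$, the $p$-DG module $\mathcal S_n(a)$ has its cohomology isomorphic to the $p$-complex $$\Bbbk[e_p^p,\dots,e_{kp}^p]\cdot\Big(\bigoplus_{i_{kp}+i_{kp+1}+\cdots+i_n=p-a}\Bbbk\, e_{kp}^{i_{kp}}e_{kp+1}^{i_{kp+1}}\cdots e_n^{i_n}v_a\Big),$$ where the $\partial$-stable $\Bbbk$-space in the bracket is equipped with the differential inherited from $\partial(e_j)=e_1e_j-(j+1)e_{j+1}$.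
   Context: $\Bbbk$ is a field of characteristic $p>0$. $\mathrm{Sym}_n=\Bbbk[x_1,\dots,x_n]^{S_n}$ with $\deg x_i=2$, equipped with the derivation determined by $\partial(x_i)=x_i^2$; it is a $p$-DG algebra (graded algebra with degree $2$ derivation $\partial$, $\partial^p=0$). $e_j$ is the $j$-th elementary symmetric polynomial in $x_1,\dots,x_n$ ($e_0=1$, $e_j=0$ for $j>n$), and $\partial(e_j)=e_1e_j-(j+1)e_{j+1}$. For an integer $a$ (only its class in $\mathbb F_p$ matters), $\mathcal S_n(a)=\mathrm{Sym}_n\cdot v_a$ is the free rank-one $\mathrm{Sym}_n$-module with generator in degree $n(1-n)/2$ and $\partial_a(fv_a)=\partial(f)v_a+a f e_1v_a$; then $\partial_a^p=0$. A $p$-complex is a graded $\Bbbk$-space with a degree $2$ map $\partial$, $\partial^p=0$, i.e. a graded $\Bbbk[\partial]/(\partial^p)$-module. It is acyclic if it is a projective (equivalently free) graded $\Bbbk[\partial]/(\partial^p)$-module; a map is a quasi-isomorphism if it becomes an isomorphism in the stable category of graded $\Bbbk[\partial]/(\partial^p)$-modules. A $p$-DG module is acyclic if its underlying $p$-complex is, and "has cohomology isomorphic to the $p$-complex $C$" means that its underlying $p$-complex is isomorphic to $C$ in this stable category. For $k=0$ the algebra $\Bbbk[e_p^p,\dots,e_{kp}^p]$ is $\Bbbk$. *)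

theory Defs
  imports
    Complex_Main
    "HOL-Library.Poly_Mapping"
    "HOL-Combinatorics.Permutations"
    "HOL-Computational_Algebra.Primes"
begin

section \<open>p-complexes and their stable category\<close>

text \<open>
  A graded vector space with a degree 2 operator.  The homogeneous components are subspaces of an
  ambient vector space (an additive type together with a scalar multiplication); the underlying
  space of the complex is their span, and need not be the whole ambient type.  Likewise \<^term>\<open>d\<close>
  and morphisms only matter on that span.
\<close>

record ('k, 'v) p_complex =
  scale :: "'k \<Rightarrow> 'v \<Rightarrow> 'v"
  grade :: "int \<Rightarrow> 'v set"
  diff :: "'v \<Rightarrow> 'v"

definition carrier :: "('k::field, 'v::ab_group_add) p_complex \<Rightarrow> 'v set" where
  "carrier M = module.span (scale M) (\<Union>i. grade M i)"

definition linear_on_carrier ::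
  "('k::field, 'v::ab_group_add) p_complex \<Rightarrow> ('k, 'w::ab_group_add) p_complex \<Rightarrow> ('v \<Rightarrow> 'w) \<Rightarrow> bool" where
  "linear_on_carrier M N f \<longleftrightarrow>
     (\<forall>x\<in>carrier M. \<forall>y\<in>carrier M. f (x + y) = f x + f y) \<and>
     (\<forall>c. \<forall>x\<in>carrier M. f (scale M c x) = scale N c (f x))"

definition is_p_complex :: "nat \<Rightarrow> ('k::field, 'v::ab_group_add) p_complex \<Rightarrow> bool" where
  "is_p_complex p M \<longleftrightarrow>
     vector_space (scale M) \<and>
     (\<forall>i. module.subspace (scale M) (grade M i)) \<and>
     (\<forall>I x. finite I \<longrightarrow> (\<forall>i\<in>I. x i \<in> grade M i) \<longrightarrow> (\<Sum>i\<in>I. x i) = 0 \<longrightarrow> (\<forall>i\<in>I. x i = 0)) \<and>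
     linear_on_carrier M M (diff M) \<and>
     (\<forall>i. diff M ` grade M i \<subseteq> grade M (i + 2)) \<and>
     (\<forall>x\<in>carrier M. (diff M ^^ p) x = 0)"

text \<open>
  Freeness as a graded module over $\Bbbk[\partial]/(\partial^p)$: there is a set of homogeneous
  elements \<^term>\<open>b\<close> such that the elements $\partial^i b$ with $0 \le i < p$ are pairwise
  distinct and form a $\Bbbk$-basis.  Over this ring, graded projective and graded free coincide.
\<close>

definition graded_free :: "nat \<Rightarrow> ('k::field, 'v::ab_group_add) p_complex \<Rightarrow> bool" where
  "graded_free p M \<longleftrightarrow>
     (\<exists>B \<subseteq> (\<Union>i. grade M i).
        let E = (\<lambda>(b, i). (diff M ^^ i) b) in
          inj_on E (B \<times> {..<p}) \<and>
          \<not> module.dependent (scale M) (E ` (B \<times> {..<p})) \<and>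
          module.span (scale M) (E ` (B \<times> {..<p})) = carrier M)"

definition p_acyclic :: "nat \<Rightarrow> ('k::field, 'v::ab_group_add) p_complex \<Rightarrow> bool" where
  "p_acyclic p M \<longleftrightarrow> is_p_complex p M \<and> graded_free p M"

definition p_complex_hom ::
  "('k::field, 'v::ab_group_add) p_complex \<Rightarrow> ('k, 'w::ab_group_add) p_complex \<Rightarrow> ('v \<Rightarrow> 'w) \<Rightarrow> bool" where
  "p_complex_hom M N f \<longleftrightarrow>
     linear_on_carrier M N f \<and>
     (\<forall>i. f ` grade M i \<subseteq> grade N i) \<and>
     (\<forall>x\<in>carrier M. f (diff M x) = diff N (f x))"

text \<open>
  A morphism is zero in the stable category if it factors through a projective, i.e. free, object.
  HOL cannot quantify over all types, so the intermediate object \<^term>\<open>P\<close> is sought on the type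
  of finitely supported functions on \<^typ>\<open>'w \<times> nat\<close>.  This is no restriction: that type
  carries the free p-complex with basis the nonzero homogeneous elements of \<^term>\<open>N\<close> (the pair
  \<^term>\<open>(y, i)\<close> standing for $\partial^i y$), which surjects onto \<^term>\<open>N\<close>; hence every
  morphism from any projective object to \<^term>\<open>N\<close> lifts to it.
\<close>

definition stably_zero ::
  "nat \<Rightarrow> ('k::field, 'v::ab_group_add) p_complex \<Rightarrow> ('k, 'w::ab_group_add) p_complex \<Rightarrow> ('v \<Rightarrow> 'w) \<Rightarrow> bool" where
  "stably_zero p M N f \<longleftrightarrow>
     (\<exists>(P :: ('k, ('w \<times> nat) \<Rightarrow>\<^sub>0 'k) p_complex) u w.
        is_p_complex p P \<and> graded_free p P \<and> p_complex_hom M P u \<and> p_complex_hom P N w \<and>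
        (\<forall>x\<in>carrier M. f x = w (u x)))"

definition stably_inverse ::
  "nat \<Rightarrow> ('k::field, 'v::ab_group_add) p_complex \<Rightarrow> ('k, 'w::ab_group_add) p_complex \<Rightarrow>
     ('v \<Rightarrow> 'w) \<Rightarrow> ('w \<Rightarrow> 'v) \<Rightarrow> bool" where
  "stably_inverse p M N f g \<longleftrightarrow>
     stably_zero p M M (\<lambda>x. g (f x) - x) \<and> stably_zero p N N (\<lambda>y. f (g y) - y)"

definition quasi_iso ::
  "nat \<Rightarrow> ('k::field, 'v::ab_group_add) p_complex \<Rightarrow> ('k, 'w::ab_group_add) p_complex \<Rightarrow> ('v \<Rightarrow> 'w) \<Rightarrow> bool" where
  "quasi_iso p M N f \<longleftrightarrow>
     is_p_complex p M \<and> is_p_complex p N \<and> p_complex_hom M N f \<and>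
     (\<exists>g. p_complex_hom N M g \<and> stably_inverse p M N f g)"

text \<open>Every morphism of the stable category is represented by a morphism of p-complexes, so stable
  isomorphism is the existence of a quasi-isomorphism.\<close>

definition stably_isomorphic ::
  "nat \<Rightarrow> ('k::field, 'v::ab_group_add) p_complex \<Rightarrow> ('k, 'w::ab_group_add) p_complex \<Rightarrow> bool" where
  "stably_isomorphic p M N \<longleftrightarrow> (\<exists>f. quasi_iso p M N f)"

section \<open>p-DG algebras\<close>

text \<open>The multiplication is that of the ambient commutative ring type.\<close>

definition p_dg_algebra :: "nat \<Rightarrow> ('k::field, 'r::comm_ring_1) p_complex \<Rightarrow> bool" where
  "p_dg_algebra p A \<longleftrightarrow>
     is_p_complex p A \<and>
     1 \<in> grade A 0 \<and>
     (\<forall>i j. \<forall>x\<in>grade A i. \<forall>y\<in>grade A j. x * y \<in> grade A (i + j)) \<and>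
     (\<forall>c. \<forall>x\<in>carrier A. \<forall>y\<in>carrier A. scale A c (x * y) = scale A c x * y) \<and>
     (\<forall>x\<in>carrier A. \<forall>y\<in>carrier A. diff A (x * y) = diff A x * y + x * diff A y)"

definition p_dg_algebra_hom ::
  "('k::field, 'r::comm_ring_1) p_complex \<Rightarrow> ('k, 's::comm_ring_1) p_complex \<Rightarrow> ('r \<Rightarrow> 's) \<Rightarrow> bool" where
  "p_dg_algebra_hom A B f \<longleftrightarrow>
     p_complex_hom A B f \<and> f 1 = 1 \<and> (\<forall>x\<in>carrier A. \<forall>y\<in>carrier A. f (x * y) = f x * f y)"

definition p_dg_algebra_quasi_iso ::
  "nat \<Rightarrow> ('k::field, 'r::comm_ring_1) p_complex \<Rightarrow> ('k, 's::comm_ring_1) p_complex \<Rightarrow> ('r \<Rightarrow> 's) \<Rightarrow> bool" where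
  "p_dg_algebra_quasi_iso p A B f \<longleftrightarrow>
     p_dg_algebra p A \<and> p_dg_algebra p B \<and> p_dg_algebra_hom A B f \<and> quasi_iso p A B f"

section \<open>Symmetric polynomials with the derivation sending each variable to its square\<close>

text \<open>Polynomials in variables $x_0, x_1, x_2, \dots$; a monomial is its exponent vector.\<close>

type_synonym 'k mpoly = "(nat \<Rightarrow>\<^sub>0 nat) \<Rightarrow>\<^sub>0 'k"

definition Var :: "nat \<Rightarrow> 'k::field mpoly" where
  "Var i = Poly_Mapping.single (Poly_Mapping.single i 1) 1"

definition const_mult :: "'k::field \<Rightarrow> 'k mpoly \<Rightarrow> 'k mpoly" where
  "const_mult c f = Poly_Mapping.single 0 c * f"

definition monom_degree :: "(nat \<Rightarrow>\<^sub>0 nat) \<Rightarrow> nat" where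
  "monom_degree m = (\<Sum>i\<in>Poly_Mapping.keys m. Poly_Mapping.lookup m i)"

text \<open>The monomial $x^m$ is sent to $\sum_i m_i\, x_i\, x^m$; the lemmas below show that this is the
  $\Bbbk$-linear derivation with $x_i \mapsto x_i^2$.\<close>

definition deriv :: "'k::field mpoly \<Rightarrow> 'k mpoly" where
  "deriv f = (\<Sum>m\<in>Poly_Mapping.keys f. \<Sum>i\<in>Poly_Mapping.keys m.
     Poly_Mapping.single (m + Poly_Mapping.single i 1)
       (of_nat (Poly_Mapping.lookup m i) * Poly_Mapping.lookup f m))"

lemma deriv_add: "deriv (f + g) = deriv f + deriv g"
  unfolding deriv_def
  by (rule setsum_keys_plus_distrib)
     (simp_all add: distrib_left single_add sum.distrib)

lemma deriv_single:
  "deriv (Poly_Mapping.single m c) = (\<Sum>i\<in>Poly_Mapping.keys m.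
     Poly_Mapping.single (m + Poly_Mapping.single i 1) (of_nat (Poly_Mapping.lookup m i) * c))"
  by (cases "c = 0") (simp_all add: deriv_def)

lemma deriv_single_superset:
  assumes "finite K" "Poly_Mapping.keys m \<subseteq> K"
  shows "deriv (Poly_Mapping.single m c) = (\<Sum>i\<in>K.
     Poly_Mapping.single (m + Poly_Mapping.single i 1) (of_nat (Poly_Mapping.lookup m i) * c))"
  unfolding deriv_single
  by (rule sum.mono_neutral_left[OF assms]) (auto simp: in_keys_iff)

lemma deriv_Var: "deriv (Var i) = Var i ^ 2"
  by (simp add: Var_def deriv_single mult_single power2_eq_square)

lemma mpoly_induct [case_names single add]:
  fixes f :: "'k::field mpoly"
  assumes single: "\<And>m c. Q (Poly_Mapping.single m c)"
    and add: "\<And>f g. Q f \<Longrightarrow> Q g \<Longrightarrow> Q (f + g)"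
  shows "Q f"
proof (induction f rule: Poly_Mapping.update_induct)
  case const
  show ?case using single[of 0 0] by simp
next
  case (update f m c)
  have "Poly_Mapping.update m c f = f + Poly_Mapping.single m c"
    using update.hyps
    by (intro poly_mapping_eqI) (auto simp: lookup_update lookup_add lookup_single when_def in_keys_iff)
  with add[OF update.IH single] show ?case by simp
qed

lemma deriv_mult: "deriv (f * g) = deriv f * g + f * deriv g"
proof (induction f rule: mpoly_induct)
  case (single m c)
  show ?case
  proof (induction g rule: mpoly_induct)
    case (single m' c')
    let ?K = "Poly_Mapping.keys m \<union> Poly_Mapping.keys m'"
    have "Poly_Mapping.keys (m + m') \<subseteq> ?K" by (rule Poly_Mapping.keys_add)
    then show ?case
      by (simp add: mult_single deriv_single_superset[of ?K] sum_distrib_left sum_distrib_right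
          lookup_add distrib_right single_add sum.distrib algebra_simps)
  qed (simp add: distrib_left deriv_add)
qed (simp add: distrib_right deriv_add)

lemma deriv_const_mult: "deriv (const_mult c f) = const_mult c (deriv f)"
  by (simp add: const_mult_def deriv_mult deriv_single)

definition elem_sym :: "nat \<Rightarrow> nat \<Rightarrow> 'k::field mpoly" where
  "elem_sym n j = (\<Sum>X | X \<subseteq> {1..n} \<and> card X = j. \<Prod>i\<in>X. Var i)"

text \<open>Symmetric polynomials in $x_1, \dots, x_n$: \<^term>\<open>Poly_Mapping.map_key \<pi> m\<close> is the
  exponent vector $m \circ \pi$.\<close>

definition symmetric_polys :: "nat \<Rightarrow> 'k::field mpoly set" where
  "symmetric_polys n = {f.
     (\<forall>m\<in>Poly_Mapping.keys f. Poly_Mapping.keys m \<subseteq> {1..n}) \<and>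
     (\<forall>\<pi>. \<pi> permutes {1..n} \<longrightarrow>
        (\<forall>m. Poly_Mapping.lookup f (Poly_Mapping.map_key \<pi> m) = Poly_Mapping.lookup f m))}"

definition Sym :: "nat \<Rightarrow> ('k::field, 'k mpoly) p_complex" where
  "Sym n = \<lparr> scale = const_mult,
     grade = (\<lambda>d. {f \<in> symmetric_polys n.
       \<forall>m\<in>Poly_Mapping.keys f. 2 * int (monom_degree m) = d}),
     diff = deriv \<rparr>"

text \<open>The underlying p-complex of the rank-one module; the element $f v_a$ is represented
  by \<^term>\<open>f\<close>.\<close>

definition rank_one :: "nat \<Rightarrow> int \<Rightarrow> ('k::field, 'k mpoly) p_complex" where
  "rank_one n a = \<lparr> scale = const_mult,
     grade = (\<lambda>d. grade (Sym n) (d - int n * (1 - int n) div 2)),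
     diff = (\<lambda>f. deriv f + of_int a * f * elem_sym n 1) \<rparr>"

lemma rank_one_Leibniz:
  "diff (rank_one n a) (f * g) = deriv f * g + f * diff (rank_one n a) g"
  by (simp add: rank_one_def deriv_mult algebra_simps)

definition subcomplex :: "('k::field, 'v::ab_group_add) p_complex \<Rightarrow> 'v set \<Rightarrow> ('k, 'v) p_complex" where
  "subcomplex M W = M \<lparr> grade := (\<lambda>i. grade M i \<inter> W) \<rparr>"

inductive_set subalgebra_generated :: "'k::field mpoly set \<Rightarrow> 'k mpoly set"
  for X :: "'k mpoly set" where
  const: "Poly_Mapping.single 0 c \<in> subalgebra_generated X"
| gen: "f \<in> X \<Longrightarrow> f \<in> subalgebra_generated X"
| add: "f \<in> subalgebra_generated X \<Longrightarrow> g \<in> subalgebra_generated X \<Longrightarrow> f + g \<in> subalgebra_generated X"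
| mult: "f \<in> subalgebra_generated X \<Longrightarrow> g \<in> subalgebra_generated X \<Longrightarrow> f * g \<in> subalgebra_generated X"

text \<open>The algebra $\Bbbk[e_p^p, e_{2p}^p, \dots, e_{kp}^p]$ (which is $\Bbbk$ if $k = 0$), first as a
  set, then as a p-DG algebra with zero differential.\<close>

definition elem_power_algebra :: "nat \<Rightarrow> nat \<Rightarrow> nat \<Rightarrow> 'k::field mpoly set" where
  "elem_power_algebra p n k = subalgebra_generated {elem_sym n (j * p) ^ p | j. j \<in> {1..k}}"

definition elem_power_dga :: "nat \<Rightarrow> nat \<Rightarrow> nat \<Rightarrow> ('k::field, 'k mpoly) p_complex" where
  "elem_power_dga p n k = (subcomplex (Sym n) (elem_power_algebra p n k)) \<lparr> diff := (\<lambda>_. 0) \<rparr>"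

text \<open>The span of the monomials $e_{kp}^{i_{kp}} \cdots e_n^{i_n}$ of total exponent $p - a$ (for
  $k = 0$ the factor $e_0 = 1$ occurs among them).\<close>

definition bracket_space :: "nat \<Rightarrow> nat \<Rightarrow> nat \<Rightarrow> int \<Rightarrow> 'k::field mpoly set" where
  "bracket_space p n k a = module.span const_mult
     {\<Prod>j=k*p..n. elem_sym n j ^ i j | i :: nat \<Rightarrow> nat. int (\<Sum>j=k*p..n. i j) = int p - a}"

definition cohomology_complex :: "nat \<Rightarrow> nat \<Rightarrow> nat \<Rightarrow> int \<Rightarrow> ('k::field, 'k mpoly) p_complex" where
  "cohomology_complex p n k a = subcomplex (rank_one n a)
     (module.span const_mult {f * g | f g. f \<in> elem_power_algebra p n k \<and> g \<in> bracket_space p n k a})"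

end

(* A module is acyclic iff every cycle is a (p-1)-fold boundary, so acyclicity becomes exactness of
   ker d = im d^(p-1), which obeys the two-out-of-three rule for short exact sequences. Setting
   x_n = 0 gives a short exact sequence  S_n(a+1) --e_n--> S_n(a) --> S_(n-1)(a).
   For n = (k+1)p - 1 the derivation e_j |-> e_(j-1) has commutator -a with the differential, whence
   S_n(a) is acyclic for p not dividing a; the sequence then yields (ii) by descending induction on n.
   For (i) and (iii), which is one statement when (i) is read as a = p, one shows by induction on n
   that S_n(a) modulo the proposed cohomology W is acyclic: if n > kp the sequence restricts to W, and
   if n = kp the exponent of e_n is preserved by the differential, so S_n(a) is the direct sum of the
   e_n^s S_(n-1)(a+s). Finally the acyclic quotient S_n(a)/W is free and hence splits off. *)

theory Submission
  imports Defs
begin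

section \<open>Polynomials, evaluation and derivations\<close>

text \<open>The proposed cohomology W is spanned by monomials in the e_j. The work is therefore done
  in a polynomial ring whose j-th variable is e_j: there W is \<open>supported T\<close> for a set T
  of exponents, membership is decided monomial by monomial, and e_n can be split off as a variable.
  Algebraic independence of the e_j carries the results back. Quotients M/W are never formed;
  \<open>exact_modulo\<close> asks instead that x with D x in W be a value of D^(p-1) up to W. The
  shape of W is explained by d = p - a. On a product of d factors e_j the Leibniz rule yields a term
  e_1 e_j for each factor, and the twist a, which is -d in the field, cancels all of them, leaving
  only the shifts of e_j to e_(j+1); p-th powers are constants. Hence W is stable. Multiplication by
  e_n raises a by one and lowers d by one, so the reduction ends at d = 0 with e_n S_n(1), which is
  acyclic by (ii) when n > kp. The bound a > n - kp becomes d + n < (k+1)p.\<close>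

definition supported :: "(nat \<Rightarrow>\<^sub>0 nat) set \<Rightarrow> 'k::field mpoly set" where
  "supported S = {f. Poly_Mapping.keys f \<subseteq> S}"

definition exponents :: "nat \<Rightarrow> (nat \<Rightarrow>\<^sub>0 nat) set" where
  "exponents n = {m. Poly_Mapping.keys m \<subseteq> {1..n}}"

abbreviation polys :: "nat \<Rightarrow> 'k::field mpoly set" where
  "polys n \<equiv> supported (exponents n)"

lemma sum_singles: "f = (\<Sum>m\<in>Poly_Mapping.keys f. Poly_Mapping.single m (Poly_Mapping.lookup f m))"
proof (rule poly_mapping_eqI)
  fix m
  show "Poly_Mapping.lookup f m = Poly_Mapping.lookup
      (\<Sum>m\<in>Poly_Mapping.keys f. Poly_Mapping.single m (Poly_Mapping.lookup f m)) m"
    by (auto simp: lookup_sum lookup_single when_def in_keys_iff)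
qed

lemma supported_zero [simp]: "0 \<in> supported S"
  by (simp add: supported_def)

lemma supported_single: "m \<in> S \<Longrightarrow> Poly_Mapping.single m c \<in> supported S"
  by (simp add: supported_def)

lemma supported_add: "f \<in> supported S \<Longrightarrow> g \<in> supported S \<Longrightarrow> f + g \<in> supported S"
  using Poly_Mapping.keys_add[of f g] by (auto simp: supported_def)

lemma supported_uminus: "f \<in> supported S \<Longrightarrow> - f \<in> supported S"
  by (auto simp: supported_def in_keys_iff)

lemma supported_diff: "f \<in> supported S \<Longrightarrow> g \<in> supported S \<Longrightarrow> f - g \<in> supported S"
  using supported_add[OF _ supported_uminus] by fastforce

lemma supported_mono: "S \<subseteq> T \<Longrightarrow> supported S \<subseteq> supported T"
  by (auto simp: supported_def)

lemma supported_induct [consumes 1, case_names zero single add]: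
  assumes "f \<in> supported S" "Q 0" "\<And>m c. m \<in> S \<Longrightarrow> Q (Poly_Mapping.single m c)"
    and "\<And>f g. Q f \<Longrightarrow> Q g \<Longrightarrow> Q (f + g)"
  shows "Q f"
proof -
  have "Q (\<Sum>m\<in>K. Poly_Mapping.single m (Poly_Mapping.lookup f m))"
    if "finite K" "K \<subseteq> Poly_Mapping.keys f" for K
    using that
  proof (induction K rule: finite_induct)
    case (insert m K)
    then show ?case using assms by (auto simp: supported_def)
  qed (simp add: assms)
  then show ?thesis using sum_singles[of f] by (metis finite_keys order_refl)
qed

lemma prod_single_one:
  "(\<Prod>i\<in>I. Poly_Mapping.single (e i) 1 :: 'k::field mpoly) = Poly_Mapping.single (\<Sum>i\<in>I. e i) 1"
  by (induction I rule: infinite_finite_induct) (simp_all add: mult_single)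

lemma Var_power: "Var i ^ k = Poly_Mapping.single (Poly_Mapping.single i k) 1"
  by (induction k) (simp_all add: Var_def mult_single single_add[symmetric])

lemma monomial_eq:
  fixes c :: "'k::field"
  assumes "finite K" "Poly_Mapping.keys m \<subseteq> K"
  shows "Poly_Mapping.single m c
    = Poly_Mapping.single 0 c * (\<Prod>i\<in>K. Var i ^ Poly_Mapping.lookup m i)"
proof -
  have "m = (\<Sum>i\<in>K. Poly_Mapping.single i (Poly_Mapping.lookup m i))"
    using assms by (intro poly_mapping_eqI) (auto simp: lookup_sum lookup_single when_def in_keys_iff)
  then show ?thesis by (simp add: Var_power prod_single_one mult_single)
qed

lemma supported_const [simp]: "Poly_Mapping.single 0 c \<in> polys n"
  by (simp add: supported_def exponents_def)

lemma exponents_add: "m \<in> exponents n \<Longrightarrow> m' \<in> exponents n \<Longrightarrow> m + m' \<in> exponents n"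
  using Poly_Mapping.keys_add[of m m'] by (auto simp: exponents_def)

lemma supported_mult:
  assumes "\<And>m m'. m \<in> S \<Longrightarrow> m' \<in> S' \<Longrightarrow> m + m' \<in> T" "f \<in> supported S" "g \<in> supported S'"
  shows "f * g \<in> supported T"
  using Poly_Mapping.keys_mult[of f g] assms by (fastforce simp: supported_def)

lemma polys_mult: "f \<in> polys n \<Longrightarrow> g \<in> polys n \<Longrightarrow> f * g \<in> polys n"
  by (rule supported_mult[OF exponents_add])

lemma polys_Var: "i \<in> {1..n} \<Longrightarrow> Var i \<in> polys n"
  by (simp add: Var_def supported_def exponents_def)

lemma polys_mono: "polys n \<subseteq> polys (Suc n)"
  by (rule supported_mono) (auto simp: exponents_def)

lemma polys_of_int: "of_int a \<in> polys n"
  using supported_const[of "of_int a" n] by simp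

lemma polys_of_nat: "of_nat a \<in> polys n"
  using supported_const[of "of_nat a" n] by simp

text \<open>Induction along ring generators: algebra homomorphisms and derivations respect sums and
  products, so identities between them reduce to the variables.\<close>

lemma polys_induct [consumes 1, case_names const Var add mult]:
  fixes f :: "'k::field mpoly"
  assumes "f \<in> polys n"
    and const: "\<And>c. Q (Poly_Mapping.single 0 c)" and Var: "\<And>i. i \<in> {1..n} \<Longrightarrow> Q (Var i)"
    and add: "\<And>f g. f \<in> polys n \<Longrightarrow> g \<in> polys n \<Longrightarrow> Q f \<Longrightarrow> Q g \<Longrightarrow> Q (f + g)"
    and mult: "\<And>f g. f \<in> polys n \<Longrightarrow> g \<in> polys n \<Longrightarrow> Q f \<Longrightarrow> Q g \<Longrightarrow> Q (f * g)"
  shows "Q f"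
proof -
  have one: "(1 :: 'k mpoly) \<in> polys n \<and> Q 1" using const[of 1] supported_const[of 1 n] by simp
  have pow: "(Var i ^ e :: 'k mpoly) \<in> polys n \<and> Q (Var i ^ e)" if "i \<in> {1..n}" for i e
  proof (induction e)
    case (Suc e)
    have "(Var i :: 'k mpoly) \<in> polys n" using that by (rule polys_Var)
    with Suc Var[OF that] show ?case by (simp add: polys_mult mult)
  qed (use one in simp)
  have prod: "(\<Prod>i\<in>I. Var i ^ e i :: 'k mpoly) \<in> polys n \<and> Q (\<Prod>i\<in>I. Var i ^ e i)"
    if "I \<subseteq> {1..n}" for I e
    using that
  proof (induction I rule: infinite_finite_induct)
    case (insert i I)
    then have "i \<in> {1..n}" by blast
    from pow[OF this, of "e i"] insert show ?case by (simp add: polys_mult mult)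
  qed (use one in simp_all)
  have "f \<in> polys n \<and> Q f"
    using assms(1)
  proof (induction f rule: supported_induct)
    case (single m c)
    then have "Poly_Mapping.keys m \<subseteq> {1..n}" by (simp add: exponents_def)
    from prod[OF this, of "Poly_Mapping.lookup m"] show ?case
      unfolding monomial_eq[OF finite_keys subset_refl, of m c] by (blast intro: polys_mult supported_const mult const)
  qed (use const[of 0] in \<open>simp_all add: supported_add add\<close>)
  then show ?thesis by simp
qed

lemma mpoly_ring_induct [case_names const Var add mult]:
  fixes f :: "'k::field mpoly"
  assumes const: "\<And>c. Q (Poly_Mapping.single 0 c)" and Var: "\<And>i. Q (Var i)"
    and add: "\<And>f g. Q f \<Longrightarrow> Q g \<Longrightarrow> Q (f + g)" and mult: "\<And>f g. Q f \<Longrightarrow> Q g \<Longrightarrow> Q (f * g)"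
  shows "Q f"
proof (induction f rule: mpoly_induct)
  case (single m c)
  have one: "Q 1" using const[of 1] by simp
  have "Q (Var i ^ e)" for i e
    by (induction e) (use one in \<open>simp_all add: mult Var\<close>)
  then have "Q (\<Prod>i\<in>I. Var i ^ e i)" for I e
    by (induction I rule: infinite_finite_induct) (use one in \<open>simp_all add: mult\<close>)
  then show ?case
    unfolding monomial_eq[OF finite_keys subset_refl, of m c] by (blast intro: mult const)
qed (rule add)

text \<open>The algebra homomorphism determined by the images \<open>e i\<close> of the variables.
  Three choices of \<open>e\<close> matter: \<open>elem_sym n\<close>, which interprets a polynomial
  in the e_j; the variables permuted; the variables with one of them replaced by 0.\<close>

definition subst :: "(nat \<Rightarrow> 'k::field mpoly) \<Rightarrow> 'k mpoly \<Rightarrow> 'k mpoly" where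
  "subst e f = (\<Sum>m\<in>Poly_Mapping.keys f.
     Poly_Mapping.single 0 (Poly_Mapping.lookup f m) * (\<Prod>i\<in>Poly_Mapping.keys m. e i ^ Poly_Mapping.lookup m i))"

lemma subst_add: "subst e (f + g) = subst e f + subst e g"
  unfolding subst_def by (rule setsum_keys_plus_distrib) (simp_all add: single_add distrib_right)

lemma subst_zero [simp]: "subst e 0 = 0"
  by (simp add: subst_def)

lemma subst_uminus: "subst e (- f) = - subst e f"
  using subst_add[of e f "- f"] by (simp add: eq_neg_iff_add_eq_0 add.commute)

lemma subst_diff: "subst e (f - g) = subst e f - subst e g"
  using subst_add[of e f "- g"] by (simp add: subst_uminus)

lemma subst_sum: "subst e (sum f I) = (\<Sum>i\<in>I. subst e (f i))"
  by (induction I rule: infinite_finite_induct) (simp_all add: subst_add)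

lemma subst_single:
  assumes "finite K" "Poly_Mapping.keys m \<subseteq> K"
  shows "subst e (Poly_Mapping.single m c)
    = Poly_Mapping.single 0 c * (\<Prod>i\<in>K. e i ^ Poly_Mapping.lookup m i)"
proof -
  have "subst e (Poly_Mapping.single m c)
      = Poly_Mapping.single 0 c * (\<Prod>i\<in>Poly_Mapping.keys m. e i ^ Poly_Mapping.lookup m i)"
    by (cases "c = 0") (simp_all add: subst_def)
  also have "(\<Prod>i\<in>Poly_Mapping.keys m. e i ^ Poly_Mapping.lookup m i) = (\<Prod>i\<in>K. e i ^ Poly_Mapping.lookup m i)"
    by (rule prod.mono_neutral_left[OF assms]) (auto simp: in_keys_iff)
  finally show ?thesis .
qed

lemma subst_const [simp]: "subst e (Poly_Mapping.single 0 c) = Poly_Mapping.single 0 c"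
  by (simp add: subst_single[of "{}"])

lemma subst_one [simp]: "subst e 1 = 1"
  using subst_const[of e 1] by (simp del: subst_const)

lemma subst_of_nat [simp]: "subst e (of_nat c) = of_nat c"
  using subst_const[of e "of_nat c"] by (simp del: subst_const)

lemma subst_of_int [simp]: "subst e (of_int c) = of_int c"
  using subst_const[of e "of_int c"] by (simp del: subst_const)

lemma subst_Var [simp]: "subst e (Var i) = e i"
  unfolding Var_def by (subst subst_single[of "{i}"]) auto

lemma subst_mult: "subst e (f * g) = subst e f * subst e g"
proof (induction f rule: mpoly_induct)
  case (single m c)
  show ?case
  proof (induction g rule: mpoly_induct)
    case (single m' c')
    let ?K = "Poly_Mapping.keys m \<union> Poly_Mapping.keys m'"
    have "Poly_Mapping.keys (m + m') \<subseteq> ?K" by (rule Poly_Mapping.keys_add)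
    then have "subst e (Poly_Mapping.single m c * Poly_Mapping.single m' c')
        = Poly_Mapping.single 0 (c * c') * (\<Prod>i\<in>?K. e i ^ Poly_Mapping.lookup (m + m') i)"
      unfolding mult_single by (intro subst_single) auto
    also have "\<dots> = (Poly_Mapping.single 0 c * (\<Prod>i\<in>?K. e i ^ Poly_Mapping.lookup m i))
        * (Poly_Mapping.single 0 c' * (\<Prod>i\<in>?K. e i ^ Poly_Mapping.lookup m' i))"
      unfolding mult_single[of 0 c 0 c', simplified, symmetric]
      by (simp add: lookup_add power_add prod.distrib mult_ac)
    also have "\<dots> = subst e (Poly_Mapping.single m c) * subst e (Poly_Mapping.single m' c')"
      by (simp add: subst_single[of ?K m] subst_single[of ?K m'])
    finally show ?case .
  qed (simp add: distrib_left subst_add)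
qed (simp add: distrib_right subst_add)

lemma subst_power: "subst e (f ^ k) = subst e f ^ k"
  by (induction k) (simp_all add: subst_mult)

lemma subst_prod: "subst e (prod f I) = (\<Prod>i\<in>I. subst e (f i))"
  by (induction I rule: infinite_finite_induct) (simp_all add: subst_mult)

section \<open>Division by a monomial and restriction to x_n = 0\<close>

lemma lookup_single_mult:
  fixes f :: "'k::field mpoly"
  shows "Poly_Mapping.lookup (Poly_Mapping.single u c * f) (u + m) = c * Poly_Mapping.lookup f m"
  by (induction f rule: mpoly_induct)
    (simp_all add: mult_single lookup_single lookup_add distrib_left when_def)

lemma keys_monomial_mult:
  fixes f :: "'k::field mpoly"
  shows "Poly_Mapping.keys (Poly_Mapping.single u 1 * f) = (+) u ` Poly_Mapping.keys f"
proof
  show "Poly_Mapping.keys (Poly_Mapping.single u 1 * f) \<subseteq> (+) u ` Poly_Mapping.keys f"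
    using Poly_Mapping.keys_mult[of "Poly_Mapping.single u 1" f] by auto
  show "(+) u ` Poly_Mapping.keys f \<subseteq> Poly_Mapping.keys (Poly_Mapping.single u 1 * f)"
    by (auto simp: in_keys_iff lookup_single_mult)
qed

text \<open>Shifting exponents by \<open>u\<close> is injective, so \<open>map_key\<close> along the
  shift divides by the monomial; the assumption ensures that no term is lost.\<close>

lemma monomial_dividesE:
  fixes f :: "'k::field mpoly"
  assumes "\<And>m. m \<in> Poly_Mapping.keys f \<Longrightarrow> \<exists>m'. m = u + m'"
  obtains g where "f = Poly_Mapping.single u 1 * g" "Poly_Mapping.keys g = {m. u + m \<in> Poly_Mapping.keys f}"
    "\<And>m. Poly_Mapping.lookup g m = Poly_Mapping.lookup f (u + m)"
proof
  have inj: "inj ((+) u)" by simp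
  let ?g = "Poly_Mapping.map_key ((+) u) f"
  show lk: "Poly_Mapping.lookup ?g m = Poly_Mapping.lookup f (u + m)" for m
    by (simp add: map_key.rep_eq[OF inj])
  show "Poly_Mapping.keys ?g = {m. u + m \<in> Poly_Mapping.keys f}"
    by (auto simp: in_keys_iff lk)
  show "f = Poly_Mapping.single u 1 * ?g"
  proof (rule poly_mapping_eqI)
    fix m
    show "Poly_Mapping.lookup f m = Poly_Mapping.lookup (Poly_Mapping.single u 1 * ?g) m"
    proof (cases "\<exists>m'. m = u + m'")
      case True
      then show ?thesis by (auto simp: lookup_single_mult lk)
    next
      case False
      then have "m \<notin> Poly_Mapping.keys f" "m \<notin> Poly_Mapping.keys (Poly_Mapping.single u 1 * ?g)"
        using assms by (auto simp: keys_monomial_mult)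
      then show ?thesis by (simp add: in_keys_iff)
    qed
  qed
qed

text \<open>Restriction to x_n = 0. It acts on polynomials in the x_i and equally on polynomials in
  the e_j, where the n-th variable is e_n; \<open>drop_var_subst_elem_sym\<close> reconciles the
  two, because e_n vanishes at x_n = 0 and the other e_j restrict to their analogues in fewer
  variables.\<close>

definition drop_var :: "nat \<Rightarrow> 'k::field mpoly \<Rightarrow> 'k mpoly" where
  "drop_var n = subst (\<lambda>i. if i = n then 0 else Var i)"

lemma lookup_drop_var:
  "Poly_Mapping.lookup (drop_var n f) m = (if Poly_Mapping.lookup m n = 0 then Poly_Mapping.lookup f m else 0)"
proof (induction f rule: mpoly_induct)
  case (single m' c)
  show ?case
  proof (cases "Poly_Mapping.lookup m' n = 0")
    case True
    then have "n \<notin> Poly_Mapping.keys m'" by (simp add: in_keys_iff)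
    then have "(\<Prod>i\<in>Poly_Mapping.keys m'. (if i = n then 0 else Var i :: 'a mpoly) ^ Poly_Mapping.lookup m' i)
        = (\<Prod>i\<in>Poly_Mapping.keys m'. Var i ^ Poly_Mapping.lookup m' i)"
      by (intro prod.cong) auto
    then have "drop_var n (Poly_Mapping.single m' c) = Poly_Mapping.single m' c"
      unfolding drop_var_def subst_single[OF finite_keys subset_refl, of _ m' c]
      by (simp only: monomial_eq[OF finite_keys subset_refl, of m' c, symmetric])
    with True show ?thesis by (auto simp: lookup_single when_def)
  next
    case False
    then have "drop_var n (Poly_Mapping.single m' c) = 0"
      unfolding drop_var_def subst_single[OF finite_keys subset_refl, of _ m' c]
      by (auto simp: in_keys_iff intro!: prod_zero bexI[of _ n])
    with False show ?thesis by (auto simp: lookup_single when_def)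
  qed
qed (simp_all add: drop_var_def subst_add lookup_add)

lemma keys_drop_var: "Poly_Mapping.keys (drop_var n f) = {m \<in> Poly_Mapping.keys f. Poly_Mapping.lookup m n = 0}"
  by (auto simp: in_keys_iff lookup_drop_var split: if_splits)

lemmas drop_var_simps =
  subst_add[of "\<lambda>i. if i = n then 0 else Var i" for n, folded drop_var_def]
  subst_diff[of "\<lambda>i. if i = n then 0 else Var i" for n, folded drop_var_def]
  subst_mult[of "\<lambda>i. if i = n then 0 else Var i" for n, folded drop_var_def]
  subst_const[of "\<lambda>i. if i = n then 0 else Var i" for n, folded drop_var_def]
  subst_of_int[of "\<lambda>i. if i = n then 0 else Var i" for n, folded drop_var_def]
  subst_of_nat[of "\<lambda>i. if i = n then 0 else Var i" for n, folded drop_var_def]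
  subst_one[of "\<lambda>i. if i = n then 0 else Var i" for n, folded drop_var_def]
  subst_zero[of "\<lambda>i. if i = n then 0 else Var i" for n, folded drop_var_def]

lemma drop_var_Var: "drop_var n (Var i) = (if i = n then 0 else Var i)"
  by (simp add: drop_var_def)

lemma drop_var_polys:
  assumes f: "f \<in> polys (Suc n)"
  shows "drop_var (Suc n) f \<in> polys n"
proof -
  have "Poly_Mapping.keys (drop_var (Suc n) f) \<subseteq> exponents n"
  proof
    fix m assume "m \<in> Poly_Mapping.keys (drop_var (Suc n) f)"
    then have "Poly_Mapping.keys m \<subseteq> {1..Suc n}" "Suc n \<notin> Poly_Mapping.keys m"
      using f by (auto simp: supported_def keys_drop_var exponents_def in_keys_iff)
    then have "Poly_Mapping.keys m \<subseteq> {1..n}" by (auto simp: subset_iff le_Suc_eq)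
    then show "m \<in> exponents n" by (simp add: exponents_def)
  qed
  then show ?thesis by (simp add: supported_def)
qed

lemma drop_var_id: "f \<in> polys n \<Longrightarrow> drop_var (Suc n) f = f"
  by (induction f rule: polys_induct) (auto simp: drop_var_simps drop_var_Var)

lemma single_le_decomp:
  assumes "Poly_Mapping.lookup m i \<noteq> (0::nat)"
  shows "m = Poly_Mapping.single i 1 + (m - Poly_Mapping.single i 1)"
  using assms by (intro poly_mapping_eqI) (auto simp: lookup_add lookup_minus lookup_single when_def)

lemma drop_var_eq_0E:
  fixes f :: "'k::field mpoly"
  assumes "drop_var n f = 0" "f \<in> polys N"
  obtains g where "f = Var n * g" "g \<in> polys N"
proof -
  have "\<exists>m'. m = Poly_Mapping.single n 1 + m'" if "m \<in> Poly_Mapping.keys f" for m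
  proof -
    have "Poly_Mapping.lookup m n \<noteq> 0"
      using that assms(1) keys_drop_var[of n f] by auto
    then show ?thesis by (intro exI) (rule single_le_decomp)
  qed
  from monomial_dividesE[OF this] obtain g where g: "f = Poly_Mapping.single (Poly_Mapping.single n 1) 1 * g"
    "Poly_Mapping.keys g = {m. Poly_Mapping.single n 1 + m \<in> Poly_Mapping.keys f}" by metis
  have "m \<in> exponents N" if "Poly_Mapping.single n 1 + m \<in> exponents N" for m
    using that by (auto simp: exponents_def lookup_add in_keys_iff subset_iff)
  then have "g \<in> polys N" using g(2) assms(2) by (auto simp: supported_def)
  with g(1) show ?thesis by (intro that) (simp_all only: Var_def)
qed

lemma polys_decompE:
  fixes f :: "'k::field mpoly"
  assumes "f \<in> polys (Suc n)"
  obtains f0 f1 where "f0 \<in> polys n" "f1 \<in> polys (Suc n)" "f = f0 + Var (Suc n) * f1"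
    "drop_var (Suc n) f = f0"
proof -
  let ?f0 = "drop_var (Suc n) f"
  have f0: "?f0 \<in> polys n" using assms by (rule drop_var_polys)
  then have "f - ?f0 \<in> polys (Suc n)" using assms polys_mono by (auto intro: supported_diff)
  moreover have "drop_var (Suc n) (f - ?f0) = 0" by (simp add: drop_var_simps drop_var_id[OF f0])
  ultimately obtain f1 where "f - ?f0 = Var (Suc n) * f1" "f1 \<in> polys (Suc n)"
    using drop_var_eq_0E by metis
  with f0 show ?thesis by (intro that) (auto simp: algebra_simps)
qed

lemma Var_nonzero: "(Var i :: 'k::field mpoly) \<noteq> 0"
proof
  assume "(Var i :: 'k mpoly) = 0"
  then have "Poly_Mapping.keys (Var i :: 'k mpoly) = {}" by simp
  then show False by (simp add: Var_def)
qed

text \<open>The vector field that sums \<open>g i\<close> times the i-th partial derivative, written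
  out on monomials. Truncated subtraction of exponents is harmless: where it would truncate, the
  coefficient \<open>lookup m i\<close> is zero.\<close>

definition der :: "(nat \<Rightarrow> 'k::field mpoly) \<Rightarrow> 'k mpoly \<Rightarrow> 'k mpoly" where
  "der g f = (\<Sum>m\<in>Poly_Mapping.keys f. \<Sum>i\<in>Poly_Mapping.keys m.
     Poly_Mapping.single (m - Poly_Mapping.single i 1)
       (of_nat (Poly_Mapping.lookup m i) * Poly_Mapping.lookup f m) * g i)"

lemma der_add: "der g (f + f') = der g f + der g f'"
  unfolding der_def
  by (rule setsum_keys_plus_distrib) (simp_all add: distrib_left distrib_right single_add sum.distrib)

lemma der_single:
  assumes "finite K" "Poly_Mapping.keys m \<subseteq> K"
  shows "der g (Poly_Mapping.single m c) = (\<Sum>i\<in>K.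
     Poly_Mapping.single (m - Poly_Mapping.single i 1) (of_nat (Poly_Mapping.lookup m i) * c) * g i)"
proof -
  have "der g (Poly_Mapping.single m c) = (\<Sum>i\<in>Poly_Mapping.keys m.
     Poly_Mapping.single (m - Poly_Mapping.single i 1) (of_nat (Poly_Mapping.lookup m i) * c) * g i)"
    by (cases "c = 0") (simp_all add: der_def)
  also have "\<dots> = (\<Sum>i\<in>K. Poly_Mapping.single (m - Poly_Mapping.single i 1)
      (of_nat (Poly_Mapping.lookup m i) * c) * g i)"
    by (rule sum.mono_neutral_left[OF assms]) (auto simp: in_keys_iff)
  finally show ?thesis .
qed

lemma der_const [simp]: "der g (Poly_Mapping.single 0 c) = 0"
  by (simp add: der_single[of "{}"])

lemma der_one [simp]: "der g 1 = 0"
  using der_const[of g 1] by (simp del: der_const)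

lemma der_zero [simp]: "der g 0 = 0"
  by (simp add: der_def)

lemma der_of_nat [simp]: "der g (of_nat c) = 0"
  using der_const[of g "of_nat c"] by (simp del: der_const)

lemma der_of_int [simp]: "der g (of_int c) = 0"
  using der_const[of g "of_int c"] by (simp del: der_const)

lemma der_uminus: "der g (- f) = - der g f"
  using der_add[of g f "- f"] by (simp add: eq_neg_iff_add_eq_0 add.commute)

lemma der_diff: "der g (f - f') = der g f - der g f'"
  using der_add[of g f "- f'"] by (simp add: der_uminus)

lemma der_Var [simp]: "der g (Var i) = g i"
  unfolding Var_def by (subst der_single[of "{i}"]) auto

lemma der_mult: "der g (f * f') = der g f * f' + f * der g f'"
proof (induction f rule: mpoly_induct)
  case (single m c)
  show ?case
  proof (induction f' rule: mpoly_induct)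
    case (single m' c')
    let ?K = "Poly_Mapping.keys m \<union> Poly_Mapping.keys m'"
    let ?e = "\<lambda>i. Poly_Mapping.single i (1::nat)"
    have K: "Poly_Mapping.keys (m + m') \<subseteq> ?K" by (rule Poly_Mapping.keys_add)
    \<comment> \<open>Truncated subtraction can be moved past the other exponent only where the
      entry is positive; elsewhere the coefficient vanishes.\<close>
    have shift: "m + m' - ?e i = (m - ?e i) + m'" if "Poly_Mapping.lookup m i \<noteq> 0" for i m m'
      by (subst single_le_decomp[OF that]) (simp add: add.assoc)
    have split: "Poly_Mapping.single (m + m' - ?e i) (of_nat (Poly_Mapping.lookup (m + m') i) * (c * c'))
        = Poly_Mapping.single (m - ?e i) (of_nat (Poly_Mapping.lookup m i) * c) * Poly_Mapping.single m' c'
        + Poly_Mapping.single m c * Poly_Mapping.single (m' - ?e i) (of_nat (Poly_Mapping.lookup m' i) * c')" for i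
    proof -
      have "Poly_Mapping.single (m - ?e i) (of_nat (Poly_Mapping.lookup m i) * c) * Poly_Mapping.single m' c'
          = Poly_Mapping.single (m + m' - ?e i) (of_nat (Poly_Mapping.lookup m i) * (c * c'))"
        by (cases "Poly_Mapping.lookup m i = 0") (simp_all add: mult_single shift mult.assoc del: One_nat_def)
      moreover have "Poly_Mapping.single m c * Poly_Mapping.single (m' - ?e i) (of_nat (Poly_Mapping.lookup m' i) * c')
          = Poly_Mapping.single (m + m' - ?e i) (of_nat (Poly_Mapping.lookup m' i) * (c * c'))"
        using shift[of m' i m]
        by (cases "Poly_Mapping.lookup m' i = 0") (simp_all add: mult_single add.commute mult.left_commute del: One_nat_def)
      ultimately show ?thesis
        by (simp add: single_add[symmetric] lookup_add distrib_right)
    qed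
    have "der g (Poly_Mapping.single m c * Poly_Mapping.single m' c') = (\<Sum>i\<in>?K.
        Poly_Mapping.single (m + m' - ?e i) (of_nat (Poly_Mapping.lookup (m + m') i) * (c * c')) * g i)"
      unfolding mult_single by (rule der_single[OF _ K]) simp
    also have "\<dots> = (\<Sum>i\<in>?K. Poly_Mapping.single (m - ?e i) (of_nat (Poly_Mapping.lookup m i) * c) * g i)
          * Poly_Mapping.single m' c'
        + Poly_Mapping.single m c * (\<Sum>i\<in>?K. Poly_Mapping.single (m' - ?e i) (of_nat (Poly_Mapping.lookup m' i) * c') * g i)"
      unfolding split sum_distrib_left sum_distrib_right sum.distrib[symmetric]
      by (intro sum.cong refl) (simp only: distrib_right distrib_left mult_ac)
    also have "\<dots> = der g (Poly_Mapping.single m c) * Poly_Mapping.single m' c'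
        + Poly_Mapping.single m c * der g (Poly_Mapping.single m' c')"
      by (simp only: der_single[of ?K] finite_keys finite_Un Un_upper1 Un_upper2)
    finally show ?case .
  qed (simp add: distrib_left der_add)
qed (simp add: distrib_right der_add)

lemma der_polys:
  assumes "f \<in> polys n" "\<And>i. i \<in> {1..n} \<Longrightarrow> g i \<in> polys n"
  shows "der g f \<in> polys n"
  using assms(1)
proof (induction f rule: polys_induct)
  case (Var i)
  then show ?case using assms(2) by simp
qed (simp_all add: der_add der_mult supported_add polys_mult)

section \<open>Symmetric polynomials\<close>

lemma elem_sym_0 [simp]: "elem_sym n 0 = 1"
proof -
  have "X = {}" if "X \<subseteq> {1..n}" "card X = 0" for X
    using that finite_subset[OF that(1)] by simp
  then have "{X. X \<subseteq> {1..n} \<and> card X = 0} = {{}}" by auto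
  then show ?thesis unfolding elem_sym_def by simp
qed

lemma elem_sym_eq_0: "n < j \<Longrightarrow> elem_sym n j = 0"
proof -
  assume "n < j"
  have "card X \<le> n" if "X \<subseteq> {1..n}" for X
    using card_mono[OF _ that] by simp
  then have "\<not> (X \<subseteq> {1..n} \<and> card X = j)" for X using \<open>n < j\<close> by (metis leD)
  then have "{X. X \<subseteq> {1..n} \<and> card X = j} = {}" by blast
  then show ?thesis unfolding elem_sym_def by (simp only: sum.empty)
qed

text \<open>The subsets are sorted by whether they contain \<open>Suc n\<close>. This recursion,
  rather than the sum over subsets, gives the restriction to x_(n+1) = 0 and the
  derivatives.\<close>

lemma elem_sym_Suc:
  "(elem_sym (Suc n) (Suc j) :: 'a::field mpoly) = elem_sym n (Suc j) + Var (Suc n) * elem_sym n j"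
proof -
  let ?A = "{X. X \<subseteq> {1..n} \<and> card X = Suc j}" and ?B = "{X. X \<subseteq> {1..n} \<and> card X = j}"
  have fin: "finite X" if "X \<subseteq> {1..n}" for X
    using that by (rule finite_subset) simp
  let ?P = "\<lambda>X. \<Prod>i\<in>X. Var i :: 'a mpoly"
  have sets: "{X. X \<subseteq> {1..Suc n} \<and> card X = Suc j} = ?A \<union> insert (Suc n) ` ?B"
  proof (intro equalityI subsetI)
    fix X assume X: "X \<in> {X. X \<subseteq> {1..Suc n} \<and> card X = Suc j}"
    show "X \<in> ?A \<union> insert (Suc n) ` ?B"
    proof (cases "Suc n \<in> X")
      case True
      then have "X = insert (Suc n) (X - {Suc n})" by blast
      moreover have "X - {Suc n} \<subseteq> {1..n}" using X by (auto simp: subset_iff le_Suc_eq)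
      moreover have "card (X - {Suc n}) = j" using X True by simp
      ultimately show ?thesis by blast
    next
      case False
      then have "X \<subseteq> {1..n}" using X by (auto simp: subset_iff le_Suc_eq)
      with X show ?thesis by simp
    qed
  next
    fix X assume "X \<in> ?A \<union> insert (Suc n) ` ?B"
    then show "X \<in> {X. X \<subseteq> {1..Suc n} \<and> card X = Suc j}"
    proof
      assume "X \<in> insert (Suc n) ` ?B"
      then obtain Y where Y: "X = insert (Suc n) Y" "Y \<subseteq> {1..n}" "card Y = j" by blast
      then have "Suc n \<notin> Y" by auto
      with Y fin[OF Y(2)] show ?thesis by auto
    qed (auto simp: subset_iff)
  qed
  have disj: "?A \<inter> insert (Suc n) ` ?B = {}" by auto
  have finite: "finite ?A" "finite ?B"
    by (auto intro: finite_subset[of _ "Pow {1..n}"])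
  have inj: "inj_on (insert (Suc n)) ?B"
  proof (rule inj_onI)
    fix X Y assume "X \<in> ?B" "Y \<in> ?B" and eq: "insert (Suc n) X = insert (Suc n) Y"
    then have "Suc n \<notin> X" "Suc n \<notin> Y" by auto
    with eq show "X = Y" by (metis insert_ident)
  qed
  have "elem_sym (Suc n) (Suc j) = sum ?P ?A + sum ?P (insert (Suc n) ` ?B)"
    unfolding elem_sym_def sets using finite disj by (intro sum.union_disjoint) simp_all
  also have "sum ?P (insert (Suc n) ` ?B) = (\<Sum>X\<in>?B. ?P (insert (Suc n) X))"
    unfolding sum.reindex[OF inj] comp_def ..
  also have "\<dots> = (\<Sum>X\<in>?B. Var (Suc n) * ?P X)"
  proof (rule sum.cong[OF refl])
    fix X assume "X \<in> ?B"
    then have "finite X" "Suc n \<notin> X" using fin by auto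
    then show "?P (insert (Suc n) X) = Var (Suc n) * ?P X" by simp
  qed
  finally show ?thesis unfolding elem_sym_def sum_distrib_left .
qed

lemma elem_sym_top: "elem_sym n n = Poly_Mapping.single (\<Sum>i\<in>{1..n}. Poly_Mapping.single i 1) 1"
proof -
  have "X = {1..n}" if "X \<subseteq> {1..n}" "card X = n" for X
    using that card_subset_eq[of "{1..n}" X] by simp
  then have "{X. X \<subseteq> {1..n} \<and> card X = n} = {{1..n}}" by auto
  then show ?thesis unfolding elem_sym_def by (simp add: Var_def prod_single_one)
qed

lemma elem_sym_top_nonzero: "(elem_sym n n :: 'k::field mpoly) \<noteq> 0"
proof
  assume "(elem_sym n n :: 'k mpoly) = 0"
  then have "Poly_Mapping.keys (elem_sym n n :: 'k mpoly) = {}" by simp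
  then show False by (simp add: elem_sym_top)
qed

lemma polys_one: "1 \<in> polys n"
  using supported_const[of 1 n] by simp

lemma elem_sym_polys: "(elem_sym n j :: 'k::field mpoly) \<in> polys n"
proof (induction n arbitrary: j)
  case 0
  then show ?case by (cases j) (simp_all add: elem_sym_eq_0 polys_one)
next
  case (Suc n)
  have "(elem_sym n i :: 'k mpoly) \<in> polys (Suc n)" for i using Suc polys_mono by blast
  moreover have "(Var (Suc n) :: 'k mpoly) \<in> polys (Suc n)" by (rule polys_Var) simp
  ultimately show ?case
    by (cases j) (simp_all add: elem_sym_Suc polys_one supported_add polys_mult)
qed

lemma drop_var_elem_sym: "drop_var (Suc n) (elem_sym (Suc n) j) = elem_sym n j"
  by (cases j) (simp_all add: elem_sym_Suc drop_var_simps drop_var_Var drop_var_id[OF elem_sym_polys])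

lemma deriv_const [simp]: "deriv (Poly_Mapping.single 0 c) = 0"
  by (simp add: deriv_single)

lemma deriv_one [simp]: "deriv 1 = 0"
  using deriv_const[of 1] by (simp del: deriv_const)

lemma deriv_zero [simp]: "deriv 0 = 0"
  by (simp add: deriv_def)

text \<open>Induction on the number of variables through \<open>elem_sym_Suc\<close>. For
  \<open>j = n\<close> the last term is zero, so the derivative of e_n is e_1 e_n; this is what
  makes multiplication by e_n shift the twist by one.\<close>

lemma deriv_elem_sym:
  "deriv (elem_sym n j) = elem_sym n 1 * elem_sym n j - of_nat (Suc j) * elem_sym n (Suc j)"
proof (induction n arbitrary: j)
  case 0
  then show ?case by (cases j) (simp_all add: elem_sym_eq_0)
next
  case (Suc n)
  show ?case
  proof (cases j)
    case (Suc i)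
    show ?thesis
      unfolding Suc by (simp add: elem_sym_Suc deriv_add deriv_mult deriv_Var Suc.IH power2_eq_square algebra_simps)
  qed simp
qed

section \<open>Degrees in the x_i and weights in the e_j\<close>

definition homogeneous :: "nat \<Rightarrow> 'k::field mpoly \<Rightarrow> bool" where
  "homogeneous d f \<longleftrightarrow> (\<forall>m\<in>Poly_Mapping.keys f. monom_degree m = d)"

lemma monom_degree_superset:
  assumes "finite K" "Poly_Mapping.keys m \<subseteq> K"
  shows "monom_degree m = (\<Sum>i\<in>K. Poly_Mapping.lookup m i)"
  unfolding monom_degree_def by (rule sum.mono_neutral_left[OF assms]) (auto simp: in_keys_iff)

lemma monom_degree_add: "monom_degree (m + m') = monom_degree m + monom_degree m'"
proof -
  let ?K = "Poly_Mapping.keys m \<union> Poly_Mapping.keys m'"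
  show ?thesis using Poly_Mapping.keys_add[of m m']
    by (simp add: monom_degree_superset[of ?K] lookup_add sum.distrib)
qed

lemma monom_degree_single [simp]: "monom_degree (Poly_Mapping.single i e) = e"
  by (simp add: monom_degree_def)

lemma homogeneous_zero [simp]: "homogeneous d 0"
  by (simp add: homogeneous_def)

lemma homogeneous_const [simp]: "homogeneous 0 (Poly_Mapping.single 0 c)"
  by (simp add: homogeneous_def monom_degree_def)

lemma homogeneous_Var: "homogeneous 1 (Var i)"
  by (simp add: homogeneous_def Var_def)

lemma homogeneous_add: "homogeneous d f \<Longrightarrow> homogeneous d g \<Longrightarrow> homogeneous d (f + g)"
  using Poly_Mapping.keys_add[of f g] by (auto simp: homogeneous_def)

lemma homogeneous_uminus: "homogeneous d f \<Longrightarrow> homogeneous d (- f)"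
  by (simp add: homogeneous_def in_keys_iff)

lemma homogeneous_diff: "homogeneous d f \<Longrightarrow> homogeneous d g \<Longrightarrow> homogeneous d (f - g)"
  using homogeneous_add[of d f "- g"] homogeneous_uminus[of d g] by simp

lemma homogeneous_sum: "(\<And>i. i \<in> I \<Longrightarrow> homogeneous d (f i)) \<Longrightarrow> homogeneous d (sum f I)"
  by (induction I rule: infinite_finite_induct) (simp_all add: homogeneous_add)

lemma homogeneous_mult: "homogeneous d f \<Longrightarrow> homogeneous d' g \<Longrightarrow> homogeneous (d + d') (f * g)"
  using Poly_Mapping.keys_mult[of f g] by (fastforce simp: homogeneous_def monom_degree_add)

lemma homogeneous_power: "homogeneous d f \<Longrightarrow> homogeneous (k * d) (f ^ k)"
proof (induction k)
  case 0
  then show ?case using homogeneous_const[of 1] by simp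
next
  case (Suc k)
  then show ?case using homogeneous_mult[of d f "k * d" "f ^ k"] by simp
qed

lemma homogeneous_prod:
  assumes "\<And>i. i \<in> I \<Longrightarrow> homogeneous (d i) (f i)" "finite I"
  shows "homogeneous (\<Sum>i\<in>I. d i) (\<Prod>i\<in>I. f i)"
  using assms(2,1)
proof (induction I rule: finite_induct)
  case empty
  then show ?case using homogeneous_const[of 1] by simp
qed (simp add: homogeneous_mult)

lemma homogeneous_elem_sym: "homogeneous j (elem_sym n j :: 'a::field mpoly)"
proof -
  have "homogeneous j (\<Prod>i\<in>X. Var i :: 'a mpoly)" if "X \<subseteq> {1..n}" "card X = j" for X
  proof -
    have "homogeneous (\<Sum>i\<in>X. 1) (\<Prod>i\<in>X. Var i :: 'a mpoly)"
      using finite_subset[OF that(1)] by (intro homogeneous_prod homogeneous_Var) simp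
    with that(2) show ?thesis by simp
  qed
  then show ?thesis unfolding elem_sym_def by (intro homogeneous_sum) blast
qed

lemma homogeneous_deriv:
  assumes "homogeneous d f"
  shows "homogeneous (Suc d) (deriv f)"
  unfolding deriv_def
proof (intro homogeneous_sum)
  fix m i assume "m \<in> Poly_Mapping.keys f"
  then have "monom_degree m = d" using assms by (simp add: homogeneous_def)
  then show "homogeneous (Suc d) (Poly_Mapping.single (m + Poly_Mapping.single i 1)
      (of_nat (Poly_Mapping.lookup m i) * Poly_Mapping.lookup f m))"
    by (simp add: homogeneous_def monom_degree_add)
qed

text \<open>The degree of the monomial $\prod_j e_j^{m_j}$.\<close>

definition weight :: "(nat \<Rightarrow>\<^sub>0 nat) \<Rightarrow> nat" where
  "weight m = (\<Sum>j\<in>Poly_Mapping.keys m. j * Poly_Mapping.lookup m j)"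

lemma weight_add: "weight (m + m') = weight m + weight m'"
proof -
  let ?K = "Poly_Mapping.keys m \<union> Poly_Mapping.keys m'"
  have weight: "weight m = (\<Sum>j\<in>?K. j * Poly_Mapping.lookup m j)" if "Poly_Mapping.keys m \<subseteq> ?K" for m
    unfolding weight_def by (rule sum.mono_neutral_left[OF _ that]) (auto simp: in_keys_iff)
  show ?thesis using Poly_Mapping.keys_add[of m m']
    by (simp add: weight lookup_add sum.distrib distrib_left)
qed

lemma homogeneous_subst:
  fixes F :: "'k::field mpoly"
  assumes "\<And>m. m \<in> Poly_Mapping.keys F \<Longrightarrow> weight m = d"
  shows "homogeneous d (subst (elem_sym n) F)"
  unfolding subst_def
proof (rule homogeneous_sum)
  fix m assume "m \<in> Poly_Mapping.keys F"
  then have d: "d = 0 + (\<Sum>j\<in>Poly_Mapping.keys m. Poly_Mapping.lookup m j * j)"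
    using assms by (simp add: weight_def mult.commute)
  show "homogeneous d (Poly_Mapping.single 0 (Poly_Mapping.lookup F m) *
      (\<Prod>i\<in>Poly_Mapping.keys m. elem_sym n i ^ Poly_Mapping.lookup m i))"
    unfolding d by (intro homogeneous_mult homogeneous_const homogeneous_prod homogeneous_power
        homogeneous_elem_sym finite_keys)
qed

section \<open>Symmetry as invariance under substitutions\<close>

lemma subst_subst: "subst e (subst e' f) = subst (\<lambda>i. subst e (e' i)) f"
  by (induction f rule: mpoly_ring_induct) (simp_all add: subst_add subst_mult)

abbreviation permute_vars :: "(nat \<Rightarrow> nat) \<Rightarrow> 'k::field mpoly \<Rightarrow> 'k mpoly" where
  "permute_vars \<pi> \<equiv> subst (\<lambda>i. Var (\<pi> i))"

lemma lookup_permute_vars: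
  assumes "bij \<pi>"
  shows "Poly_Mapping.lookup (permute_vars \<pi> f) m = Poly_Mapping.lookup f (Poly_Mapping.map_key \<pi> m)"
proof (induction f rule: mpoly_induct)
  case (single m' c)
  have inj: "inj \<pi>" using assms by (simp add: bij_is_inj)
  define u where "u = (\<Sum>i\<in>Poly_Mapping.keys m'. Poly_Mapping.single (\<pi> i) (Poly_Mapping.lookup m' i))"
  have "Poly_Mapping.lookup u (\<pi> i) = Poly_Mapping.lookup m' i" for i
    unfolding u_def by (auto simp: lookup_sum lookup_single when_def inj_eq[OF inj] in_keys_iff)
  then have "u = m \<longleftrightarrow> m' = Poly_Mapping.map_key \<pi> m"
    using assms by (auto simp: poly_mapping_eq_iff map_key.rep_eq[OF inj] fun_eq_iff)
      (metis bij_pointE)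
  moreover have "permute_vars \<pi> (Poly_Mapping.single m' c) = Poly_Mapping.single u c"
    unfolding u_def subst_single[OF finite_keys subset_refl, of _ m' c]
    by (simp add: Var_power prod_single_one mult_single)
  ultimately show ?case by (auto simp: lookup_single when_def)
qed (simp add: subst_add lookup_add)

text \<open>In this form closure under products and under the derivation is immediate. The defining
  condition on exponents remains the convenient one for restriction and divisibility.\<close>

lemma symmetric_polys_iff:
  "f \<in> symmetric_polys n \<longleftrightarrow> f \<in> polys n \<and> (\<forall>\<pi>. \<pi> permutes {1..n} \<longrightarrow> permute_vars \<pi> f = f)"
proof -
  have "permute_vars \<pi> f = f \<longleftrightarrow> (\<forall>m. Poly_Mapping.lookup f (Poly_Mapping.map_key \<pi> m) = Poly_Mapping.lookup f m)"
    if "\<pi> permutes {1..n}" for \<pi>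
    unfolding poly_mapping_eq_iff fun_eq_iff lookup_permute_vars[OF permutes_bij[OF that]] ..
  moreover have "f \<in> polys n \<longleftrightarrow> (\<forall>m\<in>Poly_Mapping.keys f. Poly_Mapping.keys m \<subseteq> {1..n})"
    unfolding supported_def exponents_def by blast
  ultimately show ?thesis unfolding symmetric_polys_def by blast
qed

lemma symmetric_polys_const: "Poly_Mapping.single 0 c \<in> symmetric_polys n"
  by (simp add: symmetric_polys_iff)

lemma symmetric_polys_add: "f \<in> symmetric_polys n \<Longrightarrow> g \<in> symmetric_polys n \<Longrightarrow> f + g \<in> symmetric_polys n"
  by (simp add: symmetric_polys_iff supported_add subst_add)

lemma symmetric_polys_diff: "f \<in> symmetric_polys n \<Longrightarrow> g \<in> symmetric_polys n \<Longrightarrow> f - g \<in> symmetric_polys n"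
  by (simp add: symmetric_polys_iff supported_diff subst_diff)

lemma symmetric_polys_mult: "f \<in> symmetric_polys n \<Longrightarrow> g \<in> symmetric_polys n \<Longrightarrow> f * g \<in> symmetric_polys n"
  by (simp add: symmetric_polys_iff polys_mult subst_mult)

lemma deriv_polys:
  assumes "f \<in> polys n"
  shows "deriv f \<in> polys n"
  using assms
proof (induction f rule: polys_induct)
  case (Var i)
  then show ?case by (simp add: deriv_Var power2_eq_square polys_mult polys_Var)
qed (simp_all add: deriv_add deriv_mult supported_add polys_mult)

lemma deriv_permute_vars: "deriv (permute_vars \<pi> f) = permute_vars \<pi> (deriv f)"
  by (induction f rule: mpoly_ring_induct)
    (simp_all add: deriv_Var subst_power subst_add subst_mult deriv_add deriv_mult)

lemma symmetric_polys_deriv: "f \<in> symmetric_polys n \<Longrightarrow> deriv f \<in> symmetric_polys n"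
  by (simp add: symmetric_polys_iff deriv_polys deriv_permute_vars[symmetric])

lemma symmetric_polys_elem_sym: "(elem_sym n j :: 'a::field mpoly) \<in> symmetric_polys n"
proof -
  have "permute_vars \<pi> (elem_sym n j :: 'a mpoly) = elem_sym n j" if \<pi>: "\<pi> permutes {1..n}" for \<pi>
  proof -
    have inj: "inj_on \<pi> X" for X using permutes_inj[OF \<pi>] by (rule inj_on_subset) simp
    have inj': "inj_on (inv \<pi>) X" for X using permutes_inj[OF permutes_inv[OF \<pi>]] by (rule inj_on_subset) simp
    have sub: "\<pi> ` X \<subseteq> {1..n}" "inv \<pi> ` X \<subseteq> {1..n}" if "X \<subseteq> {1..n}" for X
      using that permutes_in_image[OF \<pi>] permutes_in_image[OF permutes_inv[OF \<pi>]] by blast+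
    have "(\<Sum>X | X \<subseteq> {1..n} \<and> card X = j. \<Prod>i\<in>X. Var (\<pi> i) :: 'a mpoly)
        = (\<Sum>X | X \<subseteq> {1..n} \<and> card X = j. \<Prod>i\<in>X. Var i)"
      by (rule sum.reindex_bij_witness[of _ "(`) (inv \<pi>)" "(`) \<pi>"])
         (use sub in \<open>auto simp: image_image permutes_inverses[OF \<pi>] card_image inj inj' prod.reindex\<close>)
    then show ?thesis unfolding elem_sym_def by (simp add: subst_sum subst_prod)
  qed
  then show ?thesis by (simp add: symmetric_polys_iff elem_sym_polys)
qed

lemma symmetric_polys_subst: "F \<in> polys n \<Longrightarrow> subst (elem_sym n') F \<in> symmetric_polys n'"
  by (induction F rule: polys_induct)
    (simp_all add: subst_add subst_mult symmetric_polys_const symmetric_polys_add symmetric_polys_mult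
      symmetric_polys_elem_sym)

lemma symmetric_polys_drop_var:
  assumes "f \<in> symmetric_polys (Suc n)"
  shows "drop_var (Suc n) f \<in> symmetric_polys n"
proof -
  have "Poly_Mapping.lookup (drop_var (Suc n) f) (Poly_Mapping.map_key \<pi> m)
      = Poly_Mapping.lookup (drop_var (Suc n) f) m" if \<pi>: "\<pi> permutes {1..n}" for \<pi> m
  proof -
    have "\<pi> permutes {1..Suc n}" using \<pi> by (rule permutes_subset) auto
    moreover have "\<pi> (Suc n) = Suc n" using \<pi> by (auto simp: permutes_def)
    ultimately show ?thesis using assms
      by (simp add: lookup_drop_var map_key.rep_eq[OF permutes_inj[OF \<pi>]] symmetric_polys_def)
  qed
  moreover have "drop_var (Suc n) f \<in> polys n"
    using assms by (intro drop_var_polys) (simp add: symmetric_polys_iff)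
  ultimately show ?thesis unfolding symmetric_polys_def supported_def exponents_def by blast
qed

text \<open>Every monomial of \<open>f\<close> contains x_(n+1) by the vanishing, hence every
  variable, since transpositions move each one to the last place. So the product of all variables
  divides \<open>f\<close>, and the quotient is symmetric because the exponent \<open>u\<close> of
  that product is fixed by permutations.\<close>

lemma elem_sym_top_dividesE:
  fixes f :: "'k::field mpoly"
  assumes "f \<in> symmetric_polys (Suc n)" "drop_var (Suc n) f = 0"
  obtains g where "g \<in> symmetric_polys (Suc n)" "f = elem_sym (Suc n) (Suc n) * g"
proof -
  define u where "u = (\<Sum>i\<in>{1..Suc n}. Poly_Mapping.single i (1::nat))"
  have lookup_u: "Poly_Mapping.lookup u i = (if i \<in> {1..Suc n} then 1 else 0)" for i
    by (simp add: u_def lookup_sum lookup_single when_def del: sum.cl_ivl_Suc)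
  have "\<exists>m'. m = u + m'" if m: "m \<in> Poly_Mapping.keys f" for m
  proof -
    have "Poly_Mapping.lookup m i \<noteq> 0" if i: "i \<in> {1..Suc n}" for i
    proof -
      let ?t = "Transposition.transpose i (Suc n)"
      have t: "?t permutes {1..Suc n}" using i by (intro permutes_swap_id) auto
      have "Poly_Mapping.map_key ?t m \<in> Poly_Mapping.keys f"
        using m t assms(1) by (simp add: symmetric_polys_def in_keys_iff)
      moreover have "Poly_Mapping.lookup m' (Suc n) \<noteq> 0" if "m' \<in> Poly_Mapping.keys f" for m'
        using that assms(2) keys_drop_var[of "Suc n" f] by auto
      ultimately have "Poly_Mapping.lookup (Poly_Mapping.map_key ?t m) (Suc n) \<noteq> 0" by blast
      then show ?thesis by (simp add: map_key.rep_eq[OF permutes_inj[OF t]])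
    qed
    then have "m = u + (m - u)"
      by (intro poly_mapping_eqI) (simp add: lookup_add lookup_minus lookup_u Suc_leI)
    then show ?thesis ..
  qed
  from monomial_dividesE[OF this] obtain g where g: "f = Poly_Mapping.single u 1 * g"
    "Poly_Mapping.keys g = {m. u + m \<in> Poly_Mapping.keys f}"
    "\<And>m. Poly_Mapping.lookup g m = Poly_Mapping.lookup f (u + m)" by metis
  have "Poly_Mapping.keys m \<subseteq> {1..Suc n}" if "m \<in> Poly_Mapping.keys g" for m
  proof -
    have "u + m \<in> Poly_Mapping.keys f" using that g(2) by simp
    then have "Poly_Mapping.keys (u + m) \<subseteq> {1..Suc n}" using assms(1) unfolding symmetric_polys_def by blast
    moreover have "Poly_Mapping.keys m \<subseteq> Poly_Mapping.keys (u + m)"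
      by (auto simp: in_keys_iff lookup_add)
    ultimately show ?thesis by blast
  qed
  moreover have "Poly_Mapping.lookup g (Poly_Mapping.map_key \<pi> m) = Poly_Mapping.lookup g m"
    if \<pi>: "\<pi> permutes {1..Suc n}" for \<pi> m
  proof -
    have "Poly_Mapping.map_key \<pi> u = u"
      using permutes_in_image[OF \<pi>]
      by (intro poly_mapping_eqI) (simp only: map_key.rep_eq[OF permutes_inj[OF \<pi>]] lookup_u comp_def)
    then have "u + Poly_Mapping.map_key \<pi> m = Poly_Mapping.map_key \<pi> (u + m)"
      by (simp only: map_key_plus[OF permutes_inj[OF \<pi>]])
    then show ?thesis unfolding g(3) using \<pi> assms(1) by (simp only: symmetric_polys_def mem_Collect_eq)
  qed
  ultimately have "g \<in> symmetric_polys (Suc n)" unfolding symmetric_polys_def by blast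
  moreover have "f = elem_sym (Suc n) (Suc n) * g" unfolding elem_sym_top u_def[symmetric] by (rule g(1))
  ultimately show ?thesis by (rule that)
qed

section \<open>The fundamental theorem on symmetric polynomials\<close>

lemma polys_0E:
  assumes "F \<in> polys 0"
  obtains c where "F = Poly_Mapping.single 0 c"
proof -
  have "\<exists>c. F = Poly_Mapping.single 0 c"
    using assms by (induction F rule: polys_induct) (auto simp: mult_single single_add[symmetric])
  with that show ?thesis by blast
qed

lemma drop_var_subst_elem_sym:
  "drop_var (Suc n) (subst (elem_sym (Suc n)) F) = subst (elem_sym n) F"
  unfolding drop_var_def subst_subst drop_var_elem_sym[unfolded drop_var_def] ..

text \<open>Restricting the relation to x_n = 0 kills the part divisible by the n-th variable, so
  the remaining part is zero by induction on n. Then e_n, a nonzero element of a domain, is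
  cancelled, which lowers the exponents of that variable; the inner induction is on a bound for
  them.\<close>

theorem elem_sym_algebraically_independent:
  fixes F :: "'k::field mpoly"
  assumes "F \<in> polys n" "subst (elem_sym n) F = 0"
  shows "F = 0"
  using assms
proof (induction n arbitrary: F)
  case 0
  then show ?case by (elim polys_0E) simp
next
  case (Suc n)
  note IH_n = Suc.IH
  have "F = 0" if "F \<in> polys (Suc n)" "subst (elem_sym (Suc n)) F = 0"
    "\<forall>m\<in>Poly_Mapping.keys F. Poly_Mapping.lookup m (Suc n) < s" for s and F :: "'k mpoly"
    using that
  proof (induction s arbitrary: F)
    case 0
    then have "Poly_Mapping.keys F = {}" by auto
    then show ?case by (simp add: poly_mapping_eq_iff fun_eq_iff in_keys_iff set_eq_iff)
  next
    case (Suc s)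
    obtain F0 F1 where F: "F0 \<in> polys n" "F1 \<in> polys (Suc n)" "F = F0 + Var (Suc n) * F1"
      using polys_decompE[OF Suc.prems(1)] by metis
    have "subst (elem_sym n) F0 = drop_var (Suc n) (subst (elem_sym (Suc n)) F)"
      by (simp add: F(3) subst_add subst_mult drop_var_simps drop_var_subst_elem_sym drop_var_elem_sym elem_sym_eq_0)
    then have "F0 = 0" using IH_n[OF F(1)] Suc.prems(2) by (simp add: drop_var_simps)
    then have F': "F = Var (Suc n) * F1" using F by simp
    then have "subst (elem_sym (Suc n)) F1 = 0"
      using Suc.prems(2) elem_sym_top_nonzero[of "Suc n"] by (auto simp: subst_mult)
    moreover have "Poly_Mapping.lookup m (Suc n) < s" if "m \<in> Poly_Mapping.keys F1" for m
    proof -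
      have "Poly_Mapping.single (Suc n) 1 + m \<in> Poly_Mapping.keys F"
        unfolding F' Var_def keys_monomial_mult using that by simp
      then show ?thesis using Suc.prems(3) by (auto simp: lookup_add)
    qed
    ultimately have "F1 = 0" using Suc.IH F(2) by blast
    then show ?case using F' by simp
  qed
  note bounded = this
  \<comment> \<open>One more than the sum of all these exponents is a strict bound for each of
    them.\<close>
  show ?case
  proof (rule bounded[OF Suc.prems, of "Suc (\<Sum>m\<in>Poly_Mapping.keys F. Poly_Mapping.lookup m (Suc n))"])
    show "\<forall>m\<in>Poly_Mapping.keys F. Poly_Mapping.lookup m (Suc n)
        < Suc (\<Sum>m\<in>Poly_Mapping.keys F. Poly_Mapping.lookup m (Suc n))"
      using member_le_sum[of _ "Poly_Mapping.keys F" "\<lambda>m. Poly_Mapping.lookup m (Suc n)"]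
      by (simp add: less_Suc_eq_le)
  qed
qed

text \<open>Induction on n and, inside, on the degree: the restriction of \<open>f\<close> to x_n =
  0 is lifted by the outer hypothesis, and the difference is e_n times a symmetric polynomial of
  smaller degree. The weight condition keeps the difference homogeneous, so that the inner
  hypothesis applies to the quotient.\<close>

theorem symmetric_polys_generated:
  fixes f :: "'k::field mpoly"
  assumes "f \<in> symmetric_polys n" "homogeneous d f"
  obtains F where "F \<in> polys n" "\<And>m. m \<in> Poly_Mapping.keys F \<Longrightarrow> weight m = d" "subst (elem_sym n) F = f"
proof -
  have "\<exists>F\<in>polys n. (\<forall>m\<in>Poly_Mapping.keys F. weight m = d) \<and> subst (elem_sym n) F = f"
    using assms
  proof (induction n arbitrary: f d)
    case 0
    then have "f \<in> polys 0" by (simp add: symmetric_polys_iff)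
    then obtain c where c: "f = Poly_Mapping.single 0 c" by (rule polys_0E)
    with 0 have "\<forall>m\<in>Poly_Mapping.keys f. weight m = d"
      by (auto simp: homogeneous_def weight_def monom_degree_def split: if_splits)
    with c \<open>f \<in> polys 0\<close> show ?case by (intro bexI[of _ f]) auto
  next
    case (Suc n)
    note IH_n = Suc.IH
    show ?case using Suc.prems
    proof (induction d arbitrary: f rule: less_induct)
      case (less d)
      have "homogeneous d (drop_var (Suc n) f)"
        using less.prems(2) by (auto simp: homogeneous_def keys_drop_var)
      then obtain F0 where F0: "F0 \<in> polys n" "\<forall>m\<in>Poly_Mapping.keys F0. weight m = d"
        "subst (elem_sym n) F0 = drop_var (Suc n) f"
        using IH_n symmetric_polys_drop_var[OF less.prems(1)] by blast
      then have F0': "F0 \<in> polys (Suc n)" using polys_mono by blast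
      let ?f = "f - subst (elem_sym (Suc n)) F0"
      have "?f \<in> symmetric_polys (Suc n)" "drop_var (Suc n) ?f = 0"
        using less.prems(1) F0 by (simp_all add: symmetric_polys_diff symmetric_polys_subst
            drop_var_simps drop_var_subst_elem_sym)
      then obtain g where g: "g \<in> symmetric_polys (Suc n)" "?f = elem_sym (Suc n) (Suc n) * g"
        by (rule elem_sym_top_dividesE)
      have hom: "homogeneous d ?f"
        using less.prems(2) F0(2) by (intro homogeneous_diff homogeneous_subst) auto
      have g_degree: "Suc n + monom_degree m = d" if "m \<in> Poly_Mapping.keys g" for m
      proof -
        let ?u = "\<Sum>i\<in>{1..Suc n}. Poly_Mapping.single i (1::nat)"
        have "?u + m \<in> Poly_Mapping.keys ?f"
          unfolding g(2) elem_sym_top keys_monomial_mult using that by blast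
        then have "monom_degree (?u + m) = d" using hom unfolding homogeneous_def by blast
        moreover have "monom_degree (\<Sum>i\<in>I. Poly_Mapping.single i (1::nat)) = card I" if "finite I" for I
          using that by (induction I rule: finite_induct) (simp_all add: monom_degree_add, simp add: monom_degree_def)
        ultimately show ?thesis by (simp add: monom_degree_add del: sum.cl_ivl_Suc)
      qed
      show ?case
      proof (cases "g = 0")
        case True
        then show ?thesis using g(2) F0' F0(2) by (intro bexI[of _ F0]) auto
      next
        case False
        then obtain m where "m \<in> Poly_Mapping.keys g"
          by (metis poly_mapping_eqI lookup_zero in_keys_iff)
        then have d: "Suc n \<le> d" using g_degree[of m] by linarith
        have "homogeneous (d - Suc n) g" unfolding homogeneous_def using g_degree by fastforce
        moreover have "d - Suc n < d" using d by simp
        ultimately obtain F1 where F1: "F1 \<in> polys (Suc n)" "\<forall>m\<in>Poly_Mapping.keys F1. weight m = d - Suc n"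
          "subst (elem_sym (Suc n)) F1 = g" using less.IH g(1) by blast
        let ?F = "F0 + Var (Suc n) * F1"
        have "weight m = d" if "m \<in> Poly_Mapping.keys ?F" for m
          using that Poly_Mapping.keys_add[of F0 "Var (Suc n) * F1"] F0(2) F1(2) d
          by (auto simp: Var_def keys_monomial_mult weight_add weight_def[of "Poly_Mapping.single _ _"])
        moreover have "?F \<in> polys (Suc n)" using F0' F1(1) by (intro supported_add polys_mult polys_Var) auto
        moreover have "subst (elem_sym (Suc n)) ?F = f"
          using g(2) by (simp add: subst_add subst_mult F1(3) algebra_simps)
        ultimately show ?thesis by blast
      qed
    qed
  qed
  with that show ?thesis by blast
qed

section \<open>The differentials and their \<open>p\<close>-th powers\<close>

locale additive_operator =
  fixes D :: "'v::ab_group_add \<Rightarrow> 'v" and M :: "'v set"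
  assumes D_add: "D (x + y) = D x + D y"
    and M_zero: "0 \<in> M" and M_diff: "x \<in> M \<Longrightarrow> y \<in> M \<Longrightarrow> x - y \<in> M"
    and D_in: "x \<in> M \<Longrightarrow> D x \<in> M"
begin

lemma M_add: "x \<in> M \<Longrightarrow> y \<in> M \<Longrightarrow> x + y \<in> M"
  using M_diff[of x "0 - y"] M_diff[OF M_zero, of y] by simp

lemma D_zero [simp]: "D 0 = 0"
  using D_add[of 0 0] by simp

lemma D_diff: "D (x - y) = D x - D y"
  using D_add[of "x - y" y] by (simp add: eq_diff_eq)

lemma pow_add: "(D ^^ m) (x + y) = (D ^^ m) x + (D ^^ m) y"
  by (induction m) (simp_all add: D_add)

lemma pow_zero [simp]: "(D ^^ m) 0 = 0"
  by (induction m) simp_all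

lemma pow_diff: "(D ^^ m) (x - y) = (D ^^ m) x - (D ^^ m) y"
  by (induction m) (simp_all add: D_diff)

lemma pow_sum: "(D ^^ m) (sum f I) = (\<Sum>i\<in>I. (D ^^ m) (f i))"
  by (induction I rule: infinite_finite_induct) (simp_all add: pow_add)

lemma pow_in: "x \<in> M \<Longrightarrow> (D ^^ m) x \<in> M"
  by (induction m) (simp_all add: D_in)

end

text \<open>For a D-stable subspace W of M this says that every cycle of M/W is a (p-1)-fold
  boundary, expressed without quotients. With W = 0 it is the exactness criterion for M
  itself.\<close>

definition exact_modulo :: "nat \<Rightarrow> ('v::ab_group_add \<Rightarrow> 'v) \<Rightarrow> 'v set \<Rightarrow> 'v set \<Rightarrow> bool" where
  "exact_modulo p D M W \<longleftrightarrow> (\<forall>x\<in>M. D x \<in> W \<longrightarrow> (\<exists>y\<in>M. x - (D ^^ (p - 1)) y \<in> W))"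

lemma exact_moduloE:
  assumes "exact_modulo p D M W" "x \<in> M" "D x \<in> W"
  obtains y where "y \<in> M" "x - (D ^^ (p - 1)) y \<in> W"
  using assms unfolding exact_modulo_def by blast

text \<open>Descent on the power that kills x: if D^(m+1) x = 0, then D^m x is a cycle, hence equal
  to some D^(p-1) z = D^m (D z'), and x - D z' is already killed by D^m. This other half of
  exactness is what \<open>exact_restriction\<close> needs.\<close>

lemma (in additive_operator) exact_kernel_in_image:
  assumes exact: "exact_modulo p D M {0}" and x: "x \<in> M" "(D ^^ (p - 1)) x = 0"
  shows "\<exists>y\<in>M. x = D y"
proof -
  have "\<exists>y\<in>M. x = D y" if "m \<le> p - 1" "x \<in> M" "(D ^^ m) x = 0" for m x
    using that
  proof (induction m arbitrary: x)
    case 0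
    then show ?case using M_zero by (auto intro!: bexI[of _ 0])
  next
    case (Suc m)
    have "(D ^^ m) x \<in> M" "D ((D ^^ m) x) \<in> {0}" using Suc.prems by (simp_all add: pow_in)
    then obtain z where z: "z \<in> M" "(D ^^ m) x - (D ^^ (p - 1)) z \<in> {0}"
      by (rule exact_moduloE[OF exact])
    let ?z = "(D ^^ (p - 1 - Suc m)) z"
    have split: "p - 1 = m + Suc (p - 1 - Suc m)" using Suc.prems(1) by simp
    have "(D ^^ (p - 1)) z = (D ^^ m) (D ?z)" by (subst split) (simp only: funpow_add funpow.simps comp_def)
    then have "(D ^^ m) (x - D ?z) = 0" using z(2) by (simp add: pow_diff)
    moreover have "?z \<in> M" "x - D ?z \<in> M" using z(1) Suc.prems(2) by (simp_all add: pow_in D_in M_diff)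
    ultimately obtain y where y: "y \<in> M" "x - D ?z = D y" using Suc.IH Suc.prems(1) by (meson Suc_leD)
    then have "x = D (y + ?z)" by (simp add: D_add algebra_simps)
    with y(1) \<open>?z \<in> M\<close> show ?case by (intro bexI[of _ "y + ?z"]) (simp_all add: M_add)
  qed
  from this[OF order_refl x] show ?thesis .
qed

section \<open>The Leibniz formula and p-nilpotency\<close>

lemma pascal_sum:
  fixes a :: "nat \<Rightarrow> 'a::comm_ring_1"
  shows "(\<Sum>i\<le>k. of_nat (k choose i) * a (Suc i)) + (\<Sum>i\<le>k. of_nat (k choose i) * a i)
    = (\<Sum>i\<le>Suc k. of_nat (Suc k choose i) * a i)"
proof -
  have "(\<Sum>i\<le>k. of_nat (k choose i) * a i) = (\<Sum>i\<le>Suc k. of_nat (k choose i) * a i)"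
    by (simp add: binomial_eq_0)
  also have "\<dots> = a 0 + (\<Sum>i\<le>k. of_nat (k choose Suc i) * a (Suc i))"
    by (simp add: sum.atMost_Suc_shift del: sum.atMost_Suc)
  finally show ?thesis
    by (simp add: sum.atMost_Suc_shift sum.distrib[symmetric] distrib_right algebra_simps del: sum.atMost_Suc)
qed

lemma deriv_sum: "deriv (sum f I) = (\<Sum>i\<in>I. deriv (f i))"
  by (induction I rule: infinite_finite_induct) (simp_all add: deriv_add)

lemma deriv_of_nat [simp]: "deriv (of_nat c) = 0"
  using deriv_const[of "of_nat c"] by (simp del: deriv_const)

lemma deriv_power_mult:
  "(deriv ^^ k) (f * g) = (\<Sum>i\<le>k. of_nat (k choose i) * ((deriv ^^ i) f * (deriv ^^ (k - i)) g))"
proof (induction k)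
  case (Suc k)
  have "(deriv ^^ Suc k) (f * g)
      = (\<Sum>i\<le>k. of_nat (k choose i) * ((deriv ^^ Suc i) f * (deriv ^^ (Suc k - Suc i)) g))
      + (\<Sum>i\<le>k. of_nat (k choose i) * ((deriv ^^ i) f * (deriv ^^ (Suc k - i)) g))"
    by (simp add: Suc.IH deriv_sum deriv_mult sum.distrib[symmetric] Suc_diff_le distrib_left cong: sum.cong_simp)
  then show ?case using pascal_sum[of k "\<lambda>i. (deriv ^^ i) f * (deriv ^^ (Suc k - i)) g"] by (simp only:)
qed simp

lemma of_nat_mpoly_eq_0_iff: "(of_nat c :: 'k::field mpoly) = 0 \<longleftrightarrow> CHAR('k) dvd c"
proof -
  have "(of_nat c :: 'k mpoly) = 0 \<longleftrightarrow> (of_nat c :: 'k) = 0"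
    unfolding single_of_nat[symmetric] by (metis single_zero lookup_single_eq lookup_zero)
  then show ?thesis by (simp add: of_nat_eq_0_iff_char_dvd)
qed

lemma prime_CHAR:
  assumes "CHAR('k::field) = p" "p > 0"
  shows "prime p"
  using prime_CHAR_semidom[where 'a = 'k] assms by simp

text \<open>The middle binomial coefficients vanish modulo p, so the p-th power of a derivation is
  again a derivation. It is zero because on a variable x the m-th power gives m! x^(m+1).\<close>

lemma deriv_power_char:
  fixes f :: "'k::field mpoly"
  assumes "CHAR('k) = p" "p > 0"
  shows "(deriv ^^ p) f = 0"
proof (induction f rule: mpoly_ring_induct)
  case (const c)
  have "(deriv ^^ Suc m) (Poly_Mapping.single 0 c) = 0" for m by (induction m) simp_all
  from this[of "p - 1"] show ?case using assms(2) by simp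
next
  case (Var i)
  have pow: "deriv (Var i ^ Suc m) = of_nat (Suc m) * (Var i :: 'k mpoly) ^ Suc (Suc m)" for m
    by (induction m) (simp_all add: deriv_mult deriv_Var power2_eq_square algebra_simps)
  have "(deriv ^^ m) (Var i) = of_nat (fact m) * (Var i :: 'k mpoly) ^ Suc m" for m
  proof (induction m)
    case (Suc m)
    have "(deriv ^^ Suc m) (Var i) = deriv (of_nat (fact m) * (Var i :: 'k mpoly) ^ Suc m)"
      by (simp only: funpow.simps comp_def Suc.IH)
    also have "\<dots> = of_nat (fact m) * (of_nat (Suc m) * Var i ^ Suc (Suc m))"
      by (simp only: deriv_mult pow deriv_of_nat mult_zero_left add_0_left)
    also have "\<dots> = of_nat (fact (Suc m)) * Var i ^ Suc (Suc m)"
      by (simp only: fact_Suc of_nat_mult mult_ac of_nat_id)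
    finally show ?case .
  qed simp
  moreover have "(of_nat (fact p) :: 'k mpoly) = 0"
    unfolding of_nat_mpoly_eq_0_iff assms(1) using assms(2) by (simp add: dvd_fact)
  ultimately show ?case by (simp only: mult_zero_left)
next
  case (add f g)
  have "(deriv ^^ m) (f + g) = (deriv ^^ m) f + (deriv ^^ m) g" for m
    by (induction m) (simp_all add: deriv_add)
  then show ?case using add by simp
next
  case (mult f g)
  have "of_nat (p choose i) * ((deriv ^^ i) f * (deriv ^^ (p - i)) g) = 0" if "i \<le> p" for i
  proof (cases "i = 0 \<or> i = p")
    case True
    then show ?thesis using mult by auto
  next
    case False
    then have "p dvd (p choose i)"
      using that prime_CHAR[OF assms] by (intro dvd_choose_prime) auto
    then have "(of_nat (p choose i) :: 'k mpoly) = 0" by (simp add: of_nat_mpoly_eq_0_iff assms(1))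
    then show ?thesis by simp
  qed
  then show ?case unfolding deriv_power_mult by (intro sum.neutral) simp
qed

section \<open>The twisted differential and its model on polynomials in the e_j\<close>

definition twisted_deriv :: "nat \<Rightarrow> int \<Rightarrow> 'k::field mpoly \<Rightarrow> 'k mpoly" where
  "twisted_deriv n a f = deriv f + of_int a * f * elem_sym n 1"

lemma of_int_mpoly_cong:
  assumes "(of_int a :: 'k::field) = of_int b"
  shows "(of_int a :: 'k mpoly) = of_int b"
  unfolding single_of_int[symmetric] assms ..

lemma of_int_CHAR_mod:
  assumes "CHAR('k::field) = p"
  shows "(of_int (a mod int p) :: 'k) = of_int a"
proof -
  have "(of_int a :: 'k) = of_int (int p * (a div int p) + a mod int p)" by simp
  also have "\<dots> = of_nat p * of_int (a div int p) + of_int (a mod int p)"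
    unfolding of_int_add of_int_mult of_int_of_nat_eq ..
  also have "(of_nat p :: 'k) = 0" using assms of_nat_CHAR by metis
  finally show ?thesis by simp
qed

text \<open>Multiplication by \<open>e\<^sub>n ^ b\<close> with \<open>b \<equiv> a\<close> intertwines the twisted differential with
  \<^const>\<open>deriv\<close>.\<close>

lemma twisted_deriv_power_char:
  fixes f :: "'k::field mpoly"
  assumes "CHAR('k) = p" "p > 0"
  shows "(twisted_deriv n a ^^ p) f = 0"
proof -
  \<comment> \<open>The least nonnegative residue of \<open>a\<close>, so that e_n^b is a
    polynomial; being nonzero, it is cancelled at the end.\<close>
  define b where "b = nat (a mod int p)"
  have "int b = a mod int p" using assms(2) by (simp add: b_def)
  then have "(of_int a :: 'k) = of_nat b" using of_int_CHAR_mod[OF assms(1), of a] by (metis of_int_of_nat_eq)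
  then have ab: "(of_int a :: 'k mpoly) = of_nat b" using of_int_mpoly_cong[of a "int b"] by simp
  let ?e = "elem_sym n n :: 'k mpoly"
  have e: "deriv ?e = elem_sym n 1 * ?e" by (simp add: deriv_elem_sym elem_sym_eq_0)
  have pow: "deriv (?e ^ m) = of_nat m * elem_sym n 1 * ?e ^ m" for m
    by (induction m) (simp_all add: deriv_mult e algebra_simps)
  have "?e ^ b * twisted_deriv n a f = deriv (?e ^ b * f)" for f
    unfolding twisted_deriv_def by (simp add: deriv_mult pow ab algebra_simps)
  then have "?e ^ b * (twisted_deriv n a ^^ m) f = (deriv ^^ m) (?e ^ b * f)" for m
    by (induction m) simp_all
  from this[of p] have "?e ^ b * (twisted_deriv n a ^^ p) f = 0"
    by (simp add: deriv_power_char[OF assms])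
  then show ?thesis using elem_sym_top_nonzero[of n, where 'k = 'k] by auto
qed

text \<open>\<open>Y n j\<close> stands for the elementary symmetric polynomial \<open>e\<^sub>j\<close> in \<open>n\<close> variables.\<close>

definition Y :: "nat \<Rightarrow> nat \<Rightarrow> 'k::field mpoly" where
  "Y n j = (if j = 0 then 1 else if j \<le> n then Var j else 0)"

definition dY :: "nat \<Rightarrow> nat \<Rightarrow> 'k::field mpoly" where
  "dY n j = Y n 1 * Y n j - of_nat (Suc j) * Y n (Suc j)"

text \<open>\<open>twisted_deriv\<close> transported to the polynomial ring in the e_j, as
  \<open>subst_diffop\<close> confirms. The twist is an integer, but only its image in the field
  matters (\<open>diffop_cong\<close>).\<close>

definition diffop :: "nat \<Rightarrow> int \<Rightarrow> 'k::field mpoly \<Rightarrow> 'k mpoly" where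
  "diffop n a f = der (dY n) f + of_int a * f * Y n 1"

lemma subst_Y: "subst (elem_sym n) (Y n j) = elem_sym n j"
  by (simp add: Y_def elem_sym_eq_0)

lemma subst_der: "subst (elem_sym n) (der (dY n) f) = deriv (subst (elem_sym n) f)"
proof (induction f rule: mpoly_ring_induct)
  case (Var i)
  show ?case by (simp add: dY_def subst_diff subst_mult subst_Y deriv_elem_sym del: of_nat_Suc)
qed (simp_all add: der_add der_mult subst_add subst_mult deriv_add deriv_mult)

lemma subst_diffop: "subst (elem_sym n) (diffop n a f) = twisted_deriv n a (subst (elem_sym n) f)"
  by (simp add: diffop_def twisted_deriv_def subst_add subst_mult subst_der subst_Y)

lemma subst_diffop_power:
  "subst (elem_sym n) ((diffop n a ^^ m) f) = (twisted_deriv n a ^^ m) (subst (elem_sym n) f)"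
  by (induction m) (simp_all add: subst_diffop)

lemma Y_polys: "Y n j \<in> polys n"
  by (simp add: Y_def polys_one polys_Var)

lemma dY_polys: "dY n j \<in> polys n"
  unfolding dY_def by (intro supported_diff polys_mult Y_polys polys_of_nat)

lemma diffop_polys: "f \<in> polys n \<Longrightarrow> diffop n a f \<in> polys n"
  unfolding diffop_def
  by (intro supported_add polys_mult der_polys polys_of_int dY_polys Y_polys)

lemma diffop_add: "diffop n a (f + g) = diffop n a f + diffop n a g"
  by (simp add: diffop_def der_add algebra_simps)

interpretation diffop: additive_operator "diffop n a" "polys n" for n a
  by unfold_locales (simp_all add: diffop_add supported_diff diffop_polys)

text \<open>Nilpotency is known on symmetric polynomials and pulls back because evaluation at the
  e_j is injective on \<open>polys n\<close>.\<close>

lemma diffop_power_char: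
  fixes f :: "'k::field mpoly"
  assumes "CHAR('k) = p" "p > 0" "f \<in> polys n"
  shows "(diffop n a ^^ p) f = 0"
proof (rule elem_sym_algebraically_independent)
  show "(diffop n a ^^ p) f \<in> polys n" using assms(3) by (rule diffop.pow_in)
  show "subst (elem_sym n) ((diffop n a ^^ p) f) = 0"
    by (simp add: subst_diffop_power twisted_deriv_power_char[OF assms(1,2)])
qed

lemma diffop_cong:
  assumes "(of_int a :: 'k::field) = of_int b"
  shows "(diffop n a :: 'k mpoly \<Rightarrow> _) = diffop n b"
  by (rule ext) (simp add: diffop_def of_int_mpoly_cong[OF assms])

lemma diffop_const_mult:
  "diffop n a (Poly_Mapping.single 0 c * f) = Poly_Mapping.single 0 c * diffop n a f"
  by (simp add: diffop_def der_mult algebra_simps)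

lemma diffop_power_const_mult:
  "(diffop n a ^^ m) (Poly_Mapping.single 0 c * f) = Poly_Mapping.single 0 c * (diffop n a ^^ m) f"
  by (induction m) (simp_all add: diffop_const_mult)

text \<open>As the derivative of e_n is e_1 e_n, the factor e_n absorbs one unit of twist: the
  submodule e_n S_n(a) is a copy of S_n(a+1).\<close>

lemma diffop_Var_mult:
  fixes f :: "'k::field mpoly"
  assumes "n > 0"
  shows "diffop n a (Var n * f) = Var n * diffop n (a + 1) f"
proof -
  have "(dY n n :: 'k mpoly) = Var n * Y n 1" using assms by (simp add: dY_def Y_def)
  then show ?thesis by (simp add: diffop_def der_mult algebra_simps)
qed

lemma diffop_power_Var_mult:
  assumes "n > 0"
  shows "(diffop n a ^^ m) (Var n * f) = Var n * (diffop n (a + 1) ^^ m) f"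
  by (induction m) (simp_all add: diffop_Var_mult[OF assms])

lemma drop_var_Y: "drop_var (Suc n) (Y (Suc n) j) = Y n j"
  by (auto simp: Y_def drop_var_simps drop_var_Var)

lemma drop_var_dY: "drop_var (Suc n) (dY (Suc n) j) = dY n j"
  by (simp add: dY_def drop_var_simps drop_var_Y del: of_nat_Suc)

lemma dY_Suc: "dY n (Suc n) = 0"
  by (simp add: dY_def Y_def)

text \<open>The derivatives of e_j in n+1 and in n variables differ only by terms in e_(n+1), which
  the restriction kills. Thus the quotient map of the short exact sequence is a chain map.\<close>

lemma drop_var_diffop: "drop_var (Suc n) (diffop (Suc n) a f) = diffop n a (drop_var (Suc n) f)"
proof -
  have "drop_var (Suc n) (der (dY (Suc n)) f) = der (dY n) (drop_var (Suc n) f)"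
  proof (induction f rule: mpoly_ring_induct)
    case (Var i)
    show ?case by (simp add: drop_var_Var drop_var_dY dY_Suc)
  qed (simp_all add: der_add der_mult drop_var_simps)
  then show ?thesis by (simp add: diffop_def drop_var_simps drop_var_Y)
qed

lemma drop_var_diffop_power:
  "drop_var (Suc n) ((diffop (Suc n) a ^^ m) f) = (diffop n a ^^ m) (drop_var (Suc n) f)"
  by (induction m) (simp_all add: drop_var_diffop)

section \<open>Exactness of the rank-one modules\<close>

definition lowering :: "nat \<Rightarrow> 'k::field mpoly \<Rightarrow> 'k mpoly" where
  "lowering n = der (\<lambda>i. if i = 0 then 0 else Y n (i - 1))"

text \<open>If \<open>n + 1 = 0\<close> in the field, then \<open>e\<^sub>j \<mapsto> e\<^sub>j\<^sub>-\<^sub>1\<close> extends to a derivation whose commutator with the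
  differential is the scalar \<open>-a\<close>.\<close>

lemma diffop_lowering:
  fixes f :: "'k::field mpoly"
  assumes n: "(of_nat (Suc n) :: 'k) = 0" and f: "f \<in> polys n"
  shows "diffop n a (lowering n f) = lowering n (diffop n a f) - of_int a * f"
proof -
  have "n > 0" using n by (cases n) auto
  have n': "(of_nat (Suc n) :: 'k mpoly) = 0" using n unfolding single_of_nat[symmetric] by simp
  have dY: "der (dY n) (Y n j) = (dY n j :: 'k mpoly)" for j
    by (auto simp: Y_def dY_def)
  \<comment> \<open>Here \<open>n + 1 = 0\<close> enters: for \<open>j = n\<close> the left side
    vanishes because e_(n+1) = 0, although e_n does not.\<close>
  have low: "of_nat (Suc j) * lowering n (Y n (Suc j)) = of_nat (Suc j) * (Y n j :: 'k mpoly)" if "j \<le> n" for j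
    using that n' by (cases "j = n") (simp_all add: lowering_def Y_def del: of_nat_Suc)
  have low': "lowering n (Y n j) = (Y n (j - 1) :: 'k mpoly)" if "j \<in> {1..n}" for j
    using that by (simp add: lowering_def Y_def)
  have lowering_rules: "lowering n (f + g) = lowering n f + lowering n g"
    "lowering n (f - g) = lowering n f - lowering n g"
    "lowering n (f * g) = lowering n f * g + f * lowering n g"
    "lowering n (of_nat c) = 0" "lowering n (of_int e) = 0" for f g :: "'k mpoly" and c e
    by (simp_all add: lowering_def der_add der_diff der_mult)
  \<comment> \<open>The untwisted differential commutes with the lowering; the scalar in the
    commutator comes from the twist alone, since e_1 is lowered to 1.\<close>
  have "der (dY n) (lowering n f) = lowering n (der (dY n) f)"
    using f
  proof (induction f rule: polys_induct)
    case (const c)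
    then show ?case by (simp add: lowering_def)
  next
    case (Var i)
    then obtain j where i: "i = Suc j" "j \<le> n" by (cases i) auto
    have "der (dY n) (lowering n (Var i)) = (dY n j :: 'k mpoly)"
      using i dY by (simp add: lowering_def)
    also have "\<dots> = lowering n (dY n i)"
    proof (cases "j = n")
      case True
      then show ?thesis using Var i by simp
    next
      case False
      then have "lowering n (dY n i) = Y n (Suc j) + Y n 1 * Y n j - of_nat (Suc (Suc j)) * (Y n (Suc j) :: 'k mpoly)"
        using i low[of "Suc j"] low'[of "Suc j"] low'[of 1] \<open>n > 0\<close>
        by (simp add: dY_def lowering_rules Y_def[of n 0] del: of_nat_Suc)
      then show ?thesis by (simp add: dY_def algebra_simps)
    qed
    finally show ?case by (simp add: lowering_def)
  qed (simp_all add: lowering_rules der_add der_mult)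
  moreover have "lowering n (Y n 1) = (1 :: 'k mpoly)" using low'[of 1] \<open>n > 0\<close> by (simp add: Y_def)
  ultimately show ?thesis by (simp add: diffop_def lowering_rules algebra_simps)
qed

text \<open>With L the lowering, a cycle f satisfies D^j L^j f = (-a)^j j! f, as in the Weyl
  algebra. For j = p - 1 the scalar is a unit, because p divides neither a nor (p-1)!, and so f is a
  value of D^(p-1).\<close>

lemma exact_top:
  assumes char: "CHAR('k::field) = p" "p > 0" and n: "p dvd Suc n" and a: "\<not> int p dvd a"
  shows "exact_modulo p (diffop n a :: 'k mpoly \<Rightarrow> _) (polys n) {0}"
  unfolding exact_modulo_def
proof (intro ballI impI)
  fix f :: "'k mpoly"
  assume f: "f \<in> polys n" and "diffop n a f \<in> {0}"
  then have D0: "diffop n a f = 0" by simp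
  have n0: "(of_nat (Suc n) :: 'k) = 0" using n char(1) of_nat_eq_0_iff_char_dvd by blast
  have a0: "(of_int a :: 'k) \<noteq> 0"
  proof
    assume "(of_int a :: 'k) = 0"
    then have "(of_nat (nat (a mod int p)) :: 'k) = 0"
      using of_int_CHAR_mod[OF char(1), of a] char(2) by (metis of_int_of_nat_eq int_nat_eq pos_mod_sign of_nat_0_less_iff)
    then have "p dvd nat (a mod int p)" using char(1) of_nat_eq_0_iff_char_dvd by blast
    moreover have "nat (a mod int p) < p" using char(2) by (simp add: nat_less_iff)
    ultimately have "nat (a mod int p) = 0" using nat_dvd_not_less by blast
    then have "a mod int p = 0" using char(2) by (simp add: order_antisym)
    with a show False by auto
  qed
  let ?L = "\<lambda>j. (lowering n ^^ j) f"
  have L_polys: "?L j \<in> polys n" for j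
    by (induction j) (use f in \<open>auto simp: lowering_def intro!: der_polys Y_polys\<close>)
  have step: "diffop n a (?L (Suc j)) = Poly_Mapping.single 0 (- of_nat (Suc j) * of_int a) * ?L j" for j
  proof (induction j)
    case 0
    have "diffop n a (lowering n f) = - (of_int a * f)"
      using diffop_lowering[OF n0 f, of a] by (simp add: D0 lowering_def)
    then show ?case by (simp add: single_uminus)
  next
    case (Suc j)
    have "lowering n (Poly_Mapping.single 0 c * g) = Poly_Mapping.single 0 c * lowering n g" for c and g :: "'k mpoly"
      by (simp add: lowering_def der_mult)
    moreover have "diffop n a (?L (Suc (Suc j))) = lowering n (diffop n a (?L (Suc j))) - of_int a * ?L (Suc j)"
      using diffop_lowering[OF n0 L_polys, of a "Suc j"] by simp
    ultimately have "diffop n a (?L (Suc (Suc j)))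
        = Poly_Mapping.single 0 (- of_nat (Suc j) * of_int a) * ?L (Suc j) - Poly_Mapping.single 0 (of_int a) * ?L (Suc j)"
      unfolding Suc.IH by simp
    also have "\<dots> = Poly_Mapping.single 0 (- of_nat (Suc j) * of_int a - of_int a) * ?L (Suc j)"
      by (simp only: single_diff left_diff_distrib)
    also have "- of_nat (Suc j) * of_int a - of_int a = (- of_nat (Suc (Suc j)) * of_int a :: 'k)"
      by (simp add: algebra_simps)
    finally show ?case .
  qed
  have pow: "(diffop n a ^^ j) (?L j) = Poly_Mapping.single 0 ((- of_int a) ^ j * of_nat (fact j)) * f" for j
  proof (induction j)
    case (Suc j)
    have "(diffop n a ^^ Suc j) (?L (Suc j)) = (diffop n a ^^ j) (diffop n a (?L (Suc j)))"
      by (simp only: funpow_Suc_right comp_def)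
    also have "\<dots> = Poly_Mapping.single 0 (- of_nat (Suc j) * of_int a)
        * (Poly_Mapping.single 0 ((- of_int a) ^ j * of_nat (fact j)) * f)"
      by (simp only: step diffop_power_const_mult Suc.IH)
    also have "\<dots> = Poly_Mapping.single 0 ((- of_nat (Suc j) * of_int a) * ((- of_int a) ^ j * of_nat (fact j))) * f"
      by (subst mult.assoc[symmetric], subst mult_single) (simp only: add_0)
    also have "(- of_nat (Suc j) * of_int a) * ((- of_int a) ^ j * of_nat (fact j))
        = ((- of_int a) ^ Suc j * of_nat (fact (Suc j)) :: 'k)"
      by (simp only: fact_Suc of_nat_mult of_nat_id power_Suc mult_minus_left mult_minus_right mult_ac)
    finally show ?case .
  qed simp
  let ?c = "(- of_int a) ^ (p - 1) * of_nat (fact (p - 1)) :: 'k"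
  have "\<not> p dvd fact (p - 1)" using prime_CHAR[OF char] char(2) by (simp add: prime_dvd_fact_iff)
  then have "(of_nat (fact (p - 1)) :: 'k) \<noteq> 0" using char(1) of_nat_eq_0_iff_char_dvd by blast
  then have c: "?c \<noteq> 0" using a0 by (simp del: of_nat_fact)
  have "(diffop n a ^^ (p - 1)) (Poly_Mapping.single 0 (inverse ?c) * ?L (p - 1))
      = Poly_Mapping.single 0 (inverse ?c * ?c) * f"
    by (simp only: diffop_power_const_mult pow mult.assoc[symmetric] mult_single add_0)
  also have "\<dots> = f" unfolding left_inverse[OF c] by simp
  finally show "\<exists>g\<in>polys n. f - (diffop n a ^^ (p - 1)) g \<in> {0}"
    using L_polys by (intro bexI[of _ "Poly_Mapping.single 0 (inverse ?c) * ?L (p - 1)"])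
      (auto intro: polys_mult)
qed

lemma Var_mult_supported_iff:
  fixes f :: "'k::field mpoly"
  assumes "\<And>m. Poly_Mapping.single i 1 + m \<in> W \<longleftrightarrow> m \<in> W'"
  shows "Var i * f \<in> supported W \<longleftrightarrow> f \<in> supported W'"
  unfolding supported_def Var_def mem_Collect_eq keys_monomial_mult using assms by blast

text \<open>The short exact sequence \<open>S\<^sub>n\<^sub>+\<^sub>1(a+1) \<rightarrow> S\<^sub>n\<^sub>+\<^sub>1(a) \<rightarrow> S\<^sub>n(a)\<close> given by multiplication by \<open>e\<^sub>n\<^sub>+\<^sub>1\<close> and
  by \<open>x\<^sub>n\<^sub>+\<^sub>1 = 0\<close>.\<close>

lemma exact_extension:
  assumes char: "CHAR('k::field) = p" "p > 0"
    and exact1: "exact_modulo p (diffop (Suc n) (a + 1) :: 'k mpoly \<Rightarrow> _) (polys (Suc n)) (supported W1)"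
    and exact0: "exact_modulo p (diffop n a :: 'k mpoly \<Rightarrow> _) (polys n) (supported W0)"
    and W0: "W0 \<subseteq> W" "W0 \<subseteq> exponents n"
    and stable: "\<And>w. w \<in> supported W0 \<Longrightarrow> diffop (Suc n) a w \<in> (supported W :: 'k mpoly set)"
    and drop: "\<And>m. m \<in> W \<Longrightarrow> Poly_Mapping.lookup m (Suc n) = 0 \<Longrightarrow> m \<in> W0"
    and shift: "\<And>m. Poly_Mapping.single (Suc n) 1 + m \<in> W \<longleftrightarrow> m \<in> W1"
  shows "exact_modulo p (diffop (Suc n) a :: 'k mpoly \<Rightarrow> _) (polys (Suc n)) (supported W)"
  unfolding exact_modulo_def
proof (intro ballI impI)
  fix f :: "'k mpoly"
  assume f: "f \<in> polys (Suc n)" and Df: "diffop (Suc n) a f \<in> supported W"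
  let ?f0 = "drop_var (Suc n) f"
  have drop_W: "drop_var (Suc n) w \<in> supported W0" if "w \<in> supported W" for w :: "'k mpoly"
    using that drop by (auto simp: supported_def keys_drop_var)
  have "?f0 \<in> polys n" using f by (rule drop_var_polys)
  moreover have "diffop n a ?f0 \<in> supported W0"
    using drop_W[OF Df] by (simp add: drop_var_diffop)
  ultimately obtain g0 where g0: "g0 \<in> polys n" "?f0 - (diffop n a ^^ (p - 1)) g0 \<in> supported W0"
    by (rule exact_moduloE[OF exact0])
  define w0 where "w0 = ?f0 - (diffop n a ^^ (p - 1)) g0"
  \<comment> \<open>\<open>g0\<close> and \<open>w0\<close> lift themselves, being polynomials
    without e_(n+1). The remainder \<open>f'\<close> restricts to zero, and its differential still
    lies in W since D^p = 0 and \<open>w0\<close> is covered by \<open>stable\<close>.\<close>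
  define f' where "f' = f - (diffop (Suc n) a ^^ (p - 1)) g0 - w0"
  have w0: "w0 \<in> supported W0" "w0 \<in> polys n" "w0 \<in> supported W" "w0 \<in> polys (Suc n)" "g0 \<in> polys (Suc n)"
    using g0 W0 supported_mono[of W0 W, where 'a = 'k] supported_mono[of W0 "exponents n", where 'a = 'k]
      polys_mono[of n, where 'a = 'k] by (auto simp: w0_def)
  have "diffop (Suc n) a ((diffop (Suc n) a ^^ (p - 1)) g0) = (diffop (Suc n) a ^^ p) g0"
    using char(2) by (metis Suc_pred' comp_apply funpow.simps(2))
  then have D_pow: "diffop (Suc n) a ((diffop (Suc n) a ^^ (p - 1)) g0) = 0"
    by (simp only: diffop_power_char[OF char w0(5)])
  have "drop_var (Suc n) f' = 0"
    using w0(2) g0(1) by (simp add: f'_def drop_var_simps drop_var_diffop_power drop_var_id w0_def[symmetric])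
      (simp add: w0_def)
  moreover have "f' \<in> polys (Suc n)"
    unfolding f'_def using f w0 by (intro supported_diff diffop.pow_in)
  ultimately obtain f1 where f1: "f' = Var (Suc n) * f1" "f1 \<in> polys (Suc n)"
    by (rule drop_var_eq_0E)
  have "Var (Suc n) * diffop (Suc n) (a + 1) f1 = diffop (Suc n) a f - diffop (Suc n) a w0"
    unfolding diffop_Var_mult[OF zero_less_Suc, symmetric] f1(1)[symmetric]
    by (simp add: f'_def diffop.D_diff D_pow[simplified])
  also have "\<dots> \<in> supported W" using Df stable[OF w0(1)] by (rule supported_diff)
  finally have "diffop (Suc n) (a + 1) f1 \<in> supported W1" by (simp only: Var_mult_supported_iff[OF shift])
  with f1(2) obtain g1 where g1: "g1 \<in> polys (Suc n)" "f1 - (diffop (Suc n) (a + 1) ^^ (p - 1)) g1 \<in> supported W1"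
    by (rule exact_moduloE[OF exact1])
  let ?g = "g0 + Var (Suc n) * g1"
  have "f - (diffop (Suc n) a ^^ (p - 1)) ?g = f' + w0 - Var (Suc n) * (diffop (Suc n) (a + 1) ^^ (p - 1)) g1"
    by (simp add: f'_def diffop.pow_add diffop_power_Var_mult)
  also have "\<dots> = Var (Suc n) * (f1 - (diffop (Suc n) (a + 1) ^^ (p - 1)) g1) + w0"
    unfolding f1(1) by (simp add: algebra_simps)
  also have "\<dots> \<in> supported W"
    using g1(2) w0(3) by (intro supported_add) (simp_all only: Var_mult_supported_iff[OF shift])
  finally show "\<exists>g\<in>polys (Suc n). f - (diffop (Suc n) a ^^ (p - 1)) g \<in> supported W"
    using w0(5) g1(1) by (intro bexI[of _ ?g]) (auto intro!: supported_add polys_mult polys_Var)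
qed

lemma supported_empty: "supported {} = {0}"
  by (auto simp: supported_def poly_mapping_eq_iff fun_eq_iff in_keys_iff)

text \<open>The first two terms of the sequence are exact, and a cycle f of the third is lifted to
  itself. Then D f = e_(n+1) g with D^(p-1) g = 0, so g = D h by
  \<open>exact_kernel_in_image\<close>. Correcting the lift by e_(n+1) h makes it a cycle, hence a
  value of D^(p-1), and restriction gives the claim.\<close>

lemma exact_restriction:
  assumes char: "CHAR('k::field) = p" "p > 0"
    and exact1: "exact_modulo p (diffop (Suc n) (a + 1) :: 'k mpoly \<Rightarrow> _) (polys (Suc n)) {0}"
    and exact0: "exact_modulo p (diffop (Suc n) a :: 'k mpoly \<Rightarrow> _) (polys (Suc n)) {0}"
  shows "exact_modulo p (diffop n a :: 'k mpoly \<Rightarrow> _) (polys n) {0}"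
  unfolding exact_modulo_def
proof (intro ballI impI)
  fix f :: "'k mpoly"
  assume f: "f \<in> polys n" and "diffop n a f \<in> {0}"
  then have D0: "diffop n a f = 0" by simp
  have f': "f \<in> polys (Suc n)" using f polys_mono by blast
  have "drop_var (Suc n) (diffop (Suc n) a f) = 0" by (simp add: drop_var_diffop drop_var_id[OF f] D0)
  then obtain g where g: "diffop (Suc n) a f = Var (Suc n) * g" "g \<in> polys (Suc n)"
    using diffop_polys[OF f'] by (rule drop_var_eq_0E)
  have "Var (Suc n) * (diffop (Suc n) (a + 1) ^^ (p - 1)) g = (diffop (Suc n) a ^^ (p - 1)) (diffop (Suc n) a f)"
    by (simp add: g(1) diffop_power_Var_mult)
  also have "\<dots> = (diffop (Suc n) a ^^ p) f"
    using char(2) by (metis Suc_pred' comp_apply funpow_Suc_right)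
  also have "\<dots> = 0" by (rule diffop_power_char[OF char f'])
  finally have "(diffop (Suc n) (a + 1) ^^ (p - 1)) g = 0" using Var_nonzero[of "Suc n", where 'k = 'k] by simp
  then obtain h where h: "h \<in> polys (Suc n)" "g = diffop (Suc n) (a + 1) h"
    using diffop.exact_kernel_in_image[OF exact1 g(2)] by blast
  let ?f = "f - Var (Suc n) * h"
  have "diffop (Suc n) a ?f \<in> {0}"
    using g(1) h(2) by (simp add: diffop.D_diff diffop_Var_mult)
  moreover have "?f \<in> polys (Suc n)"
    using f' h(1) by (auto intro!: supported_diff polys_mult polys_Var)
  ultimately obtain s where s: "s \<in> polys (Suc n)" "?f - (diffop (Suc n) a ^^ (p - 1)) s \<in> {0}"
    using exact_moduloE[OF exact0] by metis
  from s(2) have "drop_var (Suc n) ?f = drop_var (Suc n) ((diffop (Suc n) a ^^ (p - 1)) s)" by simp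
  then have "f = (diffop n a ^^ (p - 1)) (drop_var (Suc n) s)"
    by (simp add: drop_var_simps drop_var_id[OF f] drop_var_Var drop_var_diffop_power)
  then show "\<exists>g\<in>polys n. f - (diffop n a ^^ (p - 1)) g \<in> {0}"
    using drop_var_polys[OF s(1)] by auto
qed

text \<open>At n = (k+1)p - 1 the range of a is 1 to p - 1, so \<open>exact_top\<close> applies.
  Going down from n + 1 to n requires the twists a and a + 1 there, and both are in range because
  the upper bound n - kp grows with n.\<close>

lemma exact_interior:
  assumes char: "CHAR('k::field) = p" "p > 0"
    and n: "k * p \<le> n" "n < (k + 1) * p" and a: "1 \<le> a" "a \<le> int n - int (k * p)"
  shows "exact_modulo p (diffop n a :: 'k mpoly \<Rightarrow> _) (polys n) {0}"
proof -
  have "exact_modulo p (diffop n a :: 'k mpoly \<Rightarrow> _) (polys n) {0}"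
    if "n + i + 1 = (k + 1) * p" "k * p \<le> n" "1 \<le> a" "a \<le> int n - int (k * p)" for i
    using that
  proof (induction i arbitrary: n a)
    case 0
    have "int n - int (k * p) < int p" using 0(1) by (simp add: algebra_simps flip: of_nat_mult)
    then have "a < int p" using 0(4) by linarith
    then have "\<not> int p dvd a" using 0(3) by (auto dest: zdvd_imp_le)
    moreover have "Suc n = (k + 1) * p" using 0(1) by simp
    ultimately show ?case by (intro exact_top[OF char]) (metis dvd_triv_right)
  next
    case (Suc i)
    have "exact_modulo p (diffop (Suc n) b :: 'k mpoly \<Rightarrow> _) (polys (Suc n)) {0}"
      if "b \<in> {a, a + 1}" for b
    proof (rule Suc.IH)
      show "Suc n + i + 1 = (k + 1) * p" "k * p \<le> Suc n" using Suc.prems(1,2) by simp_all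
      show "1 \<le> b" "b \<le> int (Suc n) - int (k * p)" using that Suc.prems(3,4) by auto
    qed
    from exact_restriction[OF char this this, of a] show ?case by simp
  qed
  from this[of "(k + 1) * p - 1 - n"] show ?thesis using n a by simp
qed

text \<open>If \<open>n + 1 = 0\<close> in the field, then the differential preserves the exponent of \<open>e\<^sub>n\<^sub>+\<^sub>1\<close>, so that
  \<open>S\<^sub>n\<^sub>+\<^sub>1(a)\<close> is the direct sum of the \<open>e\<^sub>n\<^sub>+\<^sub>1 ^ s S\<^sub>n(a+s)\<close>.\<close>

lemma diffop_Suc:
  fixes f :: "'k::field mpoly"
  assumes n: "(of_nat (Suc n) :: 'k) = 0" and f: "f \<in> polys n"
  shows "diffop (Suc n) a f = diffop n a f"
proof -
  have "n > 0" using n by (cases n) auto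
  have n': "(of_nat (Suc n) :: 'k mpoly) = 0" using n unfolding single_of_nat[symmetric] by simp
  have "dY (Suc n) j = (dY n j :: 'k mpoly)" if "j \<in> {1..n}" for j
    using that n' \<open>n > 0\<close> by (cases "j = n") (simp_all add: dY_def Y_def del: of_nat_Suc)
  with f have "der (dY (Suc n)) f = der (dY n) f"
    by (induction f rule: polys_induct) (simp_all add: der_add der_mult)
  then show ?thesis using \<open>n > 0\<close> by (simp add: diffop_def Y_def)
qed

lemma supported_sum_decomp:
  fixes f0 f1 :: "'k::field mpoly"
  assumes "f0 \<in> polys n" "f0 + Var (Suc n) * f1 \<in> supported W"
  shows "f0 \<in> supported {m \<in> W. Poly_Mapping.lookup m (Suc n) = 0}"
    and "f1 \<in> supported {m. Poly_Mapping.single (Suc n) 1 + m \<in> W}"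
proof -
  have "f0 = drop_var (Suc n) (f0 + Var (Suc n) * f1)"
    by (simp add: drop_var_simps drop_var_Var drop_var_id[OF assms(1)])
  then have keys: "Poly_Mapping.keys f0 = {m \<in> Poly_Mapping.keys (f0 + Var (Suc n) * f1). Poly_Mapping.lookup m (Suc n) = 0}"
    using keys_drop_var by metis
  then show f0: "f0 \<in> supported {m \<in> W. Poly_Mapping.lookup m (Suc n) = 0}"
    using assms(2) by (auto simp: supported_def)
  then have "f0 \<in> supported W" by (auto simp: supported_def)
  with assms(2) have "(f0 + Var (Suc n) * f1) - f0 \<in> supported W" by (rule supported_diff)
  then have "Var (Suc n) * f1 \<in> supported W" by simp
  then show "f1 \<in> supported {m. Poly_Mapping.single (Suc n) 1 + m \<in> W}"
    by (subst (asm) Var_mult_supported_iff[of "Suc n" W "{m. Poly_Mapping.single (Suc n) 1 + m \<in> W}"]) auto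
qed

text \<open>Induction on a bound for the exponent of e_(n+1): the part free of it is treated in
  S_n(a), and the rest is e_(n+1) times an element of S_(n+1)(a+1) with a smaller bound. Since the
  twist changes, V and W are families indexed by a.\<close>

lemma exact_direct_sum:
  assumes n: "(of_nat (Suc n) :: 'k::field) = 0"
    and exact: "\<And>a. exact_modulo p (diffop n a :: 'k mpoly \<Rightarrow> _) (polys n) (supported (V a))"
    and V: "\<And>a m. m \<in> W a \<and> Poly_Mapping.lookup m (Suc n) = 0 \<longleftrightarrow> m \<in> V a"
    and shift: "\<And>a m. Poly_Mapping.single (Suc n) 1 + m \<in> W a \<longleftrightarrow> m \<in> W (a + 1)"
  shows "exact_modulo p (diffop (Suc n) a :: 'k mpoly \<Rightarrow> _) (polys (Suc n)) (supported (W a))"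
  unfolding exact_modulo_def
proof (intro ballI impI)
  fix f :: "'k mpoly"
  assume f: "f \<in> polys (Suc n)" "diffop (Suc n) a f \<in> supported (W a)"
  have bounded: "\<exists>g\<in>polys (Suc n). f - (diffop (Suc n) a ^^ (p - 1)) g \<in> supported (W a)"
    if "f \<in> polys (Suc n)" "diffop (Suc n) a f \<in> supported (W a)"
      "\<forall>m\<in>Poly_Mapping.keys f. Poly_Mapping.lookup m (Suc n) < s" for s a and f :: "'k mpoly"
    using that
  proof (induction s arbitrary: a f)
    case 0
    then have "Poly_Mapping.keys f \<subseteq> {}" by auto
    then have "f \<in> supported {}" by (simp add: supported_def)
    then have "f = 0" by (simp add: supported_empty)
    then show ?case by (intro bexI[of _ 0]) simp_all
  next
    case (Suc s)
    obtain f0 f1 where F: "f0 \<in> polys n" "f1 \<in> polys (Suc n)" "f = f0 + Var (Suc n) * f1"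
      using polys_decompE[OF Suc.prems(1)] by metis
    have D: "diffop (Suc n) a f = diffop n a f0 + Var (Suc n) * diffop (Suc n) (a + 1) f1"
      by (simp add: F(3) diffop_add diffop_Var_mult diffop_Suc[OF n F(1)])
    note D' = supported_sum_decomp[OF diffop_polys[OF F(1)] Suc.prems(2)[unfolded D]]
    have "diffop n a f0 \<in> supported (V a)" using D'(1) V[of _ a] by (simp add: supported_def subset_iff)
    then obtain g0 where g0: "g0 \<in> polys n" "f0 - (diffop n a ^^ (p - 1)) g0 \<in> supported (V a)"
      using exact_moduloE[OF exact F(1)] by blast
    have f1_bound: "Poly_Mapping.lookup m (Suc n) < s" if "m \<in> Poly_Mapping.keys f1" for m
    proof -
      have "Poly_Mapping.single (Suc n) 1 + m \<in> Poly_Mapping.keys (Var (Suc n) * f1)"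
        unfolding Var_def keys_monomial_mult using that by simp
      moreover have "Poly_Mapping.single (Suc n) 1 + m \<notin> Poly_Mapping.keys f0"
      proof
        assume "Poly_Mapping.single (Suc n) 1 + m \<in> Poly_Mapping.keys f0"
        then have "Poly_Mapping.keys (Poly_Mapping.single (Suc n) 1 + m) \<subseteq> {1..n}"
          using F(1) unfolding supported_def exponents_def by blast
        moreover have "Suc n \<in> Poly_Mapping.keys (Poly_Mapping.single (Suc n) 1 + m)"
          by (simp add: in_keys_iff lookup_add)
        ultimately show False by auto
      qed
      ultimately have "Poly_Mapping.single (Suc n) 1 + m \<in> Poly_Mapping.keys f"
        by (simp add: F(3) in_keys_iff lookup_add)
      then have "Poly_Mapping.lookup (Poly_Mapping.single (Suc n) 1 + m) (Suc n) < Suc s"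
        using Suc.prems(3) by blast
      then show ?thesis by (simp add: lookup_add)
    qed
    have "diffop (Suc n) (a + 1) f1 \<in> supported (W (a + 1))"
      using D'(2) shift[of _ a] by (simp add: supported_def)
    then obtain g1 where g1: "g1 \<in> polys (Suc n)"
      "f1 - (diffop (Suc n) (a + 1) ^^ (p - 1)) g1 \<in> supported (W (a + 1))"
      using Suc.IH[OF F(2)] f1_bound by blast
    let ?g = "g0 + Var (Suc n) * g1"
    have pow: "(diffop (Suc n) a ^^ m) g0 = (diffop n a ^^ m) g0" for m
      by (induction m) (simp_all add: diffop_Suc[OF n] diffop.pow_in[OF g0(1)])
    have "f - (diffop (Suc n) a ^^ (p - 1)) ?g = (f0 - (diffop n a ^^ (p - 1)) g0)
        + Var (Suc n) * (f1 - (diffop (Suc n) (a + 1) ^^ (p - 1)) g1)"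
      unfolding F(3) diffop.pow_add diffop_power_Var_mult[OF zero_less_Suc] pow by (simp add: right_diff_distrib)
    also have "\<dots> \<in> supported (W a)"
    proof (rule supported_add)
      show "f0 - (diffop n a ^^ (p - 1)) g0 \<in> supported (W a)"
        using g0(2) V[of _ a] by (auto simp: supported_def)
      show "Var (Suc n) * (f1 - (diffop (Suc n) (a + 1) ^^ (p - 1)) g1) \<in> supported (W a)"
        using g1(2) by (simp only: Var_mult_supported_iff[OF shift])
    qed
    finally show ?case
      using g0(1) g1(1) polys_mono[of n, where 'a = 'k]
      by (intro bexI[of _ ?g]) (auto intro!: supported_add polys_mult polys_Var)
  qed
  show "\<exists>g\<in>polys (Suc n). f - (diffop (Suc n) a ^^ (p - 1)) g \<in> supported (W a)"
  proof (rule bounded[OF f, of "Suc (\<Sum>m\<in>Poly_Mapping.keys f. Poly_Mapping.lookup m (Suc n))"])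
    show "\<forall>m\<in>Poly_Mapping.keys f. Poly_Mapping.lookup m (Suc n)
        < Suc (\<Sum>m\<in>Poly_Mapping.keys f. Poly_Mapping.lookup m (Suc n))"
      using member_le_sum[of _ "Poly_Mapping.keys f" "\<lambda>m. Poly_Mapping.lookup m (Suc n)"]
      by (simp add: less_Suc_eq_le)
  qed
qed

section \<open>Exactness modulo the cohomology\<close>

text \<open>The exponents of the monomials in \<open>e\<^sub>p ^ p, \<dots>, e\<^sub>k\<^sub>p ^ p\<close>.\<close>

definition power_exponents :: "nat \<Rightarrow> nat \<Rightarrow> (nat \<Rightarrow>\<^sub>0 nat) set" where
  "power_exponents p k = {q. Poly_Mapping.keys q \<subseteq> {j * p | j. j \<in> {1..k}} \<and> (\<forall>j. p dvd Poly_Mapping.lookup q j)}"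

text \<open>The exponents of the monomials of degree \<open>d\<close> in \<open>e\<^sub>k\<^sub>p, \<dots>, e\<^sub>n\<close>; for \<open>k = 0\<close> the factor \<open>e\<^sub>0 = 1\<close> is
  invisible, hence the inequality.\<close>

definition bracket_exponents :: "nat \<Rightarrow> nat \<Rightarrow> nat \<Rightarrow> nat \<Rightarrow> (nat \<Rightarrow>\<^sub>0 nat) set" where
  "bracket_exponents p n k d = {r. Poly_Mapping.keys r \<subseteq> {j \<in> {1..n}. k * p \<le> j} \<and>
     (if k = 0 then monom_degree r \<le> d else monom_degree r = d)}"

text \<open>With d = p - a these are the exponents of the space W of (iii); for d = 0 the bracket is
  trivial and W is the algebra of (i).\<close>

definition cohomology_exponents :: "nat \<Rightarrow> nat \<Rightarrow> nat \<Rightarrow> nat \<Rightarrow> (nat \<Rightarrow>\<^sub>0 nat) set" where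
  "cohomology_exponents p n k d = {q + r | q r. q \<in> power_exponents p k \<and> r \<in> bracket_exponents p n k d}"

section \<open>Stability and combinatorics of the proposed cohomology\<close>

lemma monom_degree_eq_0_iff: "monom_degree m = 0 \<longleftrightarrow> m = 0"
proof
  assume "monom_degree m = 0"
  then have "Poly_Mapping.lookup m i = 0" for i
    by (cases "i \<in> Poly_Mapping.keys m") (simp_all add: monom_degree_def in_keys_iff)
  then show "m = 0" by (intro poly_mapping_eqI) simp
qed (simp add: monom_degree_def)

lemma power_exponents_0: "0 \<in> power_exponents p k"
  by (simp add: power_exponents_def)

lemma power_exponents_add: "q \<in> power_exponents p k \<Longrightarrow> q' \<in> power_exponents p k \<Longrightarrow> q + q' \<in> power_exponents p k"
  using Poly_Mapping.keys_add[of q q'] by (auto simp: power_exponents_def lookup_add)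

lemma lookup_power_exponents:
  assumes "q \<in> power_exponents p k" "k * p < i"
  shows "Poly_Mapping.lookup q i = 0"
proof (rule ccontr)
  assume "Poly_Mapping.lookup q i \<noteq> 0"
  then have "i \<in> Poly_Mapping.keys q" by (simp add: in_keys_iff)
  then obtain j where "i = j * p" "j \<le> k" using assms(1) unfolding power_exponents_def by fastforce
  with assms(2) show False by (auto simp: not_less[symmetric])
qed

lemma power_exponents_exponents:
  assumes "p > 0" "k * p \<le> n"
  shows "power_exponents p k \<subseteq> exponents n"
proof
  fix q assume q: "q \<in> power_exponents p k"
  have "j * p \<in> {1..n}" if "j \<in> {1..k}" for j
    using that assms(1) le_trans[OF mult_le_mono1 assms(2), of j] by simp
  with q show "q \<in> exponents n" unfolding power_exponents_def exponents_def by blast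
qed

lemma bracket_exponents_exponents: "bracket_exponents p n k d \<subseteq> exponents n"
  by (auto simp: bracket_exponents_def exponents_def)

lemma cohomology_exponents_exponents:
  assumes "p > 0" "k * p \<le> n"
  shows "cohomology_exponents p n k d \<subseteq> exponents n"
  using power_exponents_exponents[OF assms] bracket_exponents_exponents[of p n k d]
  by (auto simp: cohomology_exponents_def intro!: exponents_add)

lemma bracket_exponents_0: "bracket_exponents p n k 0 = {0}"
  by (auto simp: bracket_exponents_def monom_degree_eq_0_iff)

lemma supported_const_mult: "f \<in> supported S \<Longrightarrow> Poly_Mapping.single 0 c * f \<in> supported S"
  by (rule supported_mult[of "{0}" S]) (auto simp: supported_single)

text \<open>The index d rises by one uniformly: for j > n the product is zero, and e_0 = 1, which
  can occur only for k = 0, is accounted for by the inequality in that case.\<close>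

lemma Y_mult_bracket:
  fixes f :: "'k::field mpoly"
  assumes p: "p > 0" and j: "k * p \<le> j" and f: "f \<in> supported (bracket_exponents p n k d)"
  shows "Y n j * f \<in> supported (bracket_exponents p n k (Suc d))"
proof -
  consider "j = 0" | "n < j" | "j \<in> {1..n}" by fastforce
  then show ?thesis
  proof cases
    case 1
    then have "bracket_exponents p n k d \<subseteq> bracket_exponents p n k (Suc d)"
      using j p by (auto simp: bracket_exponents_def)
    then show ?thesis using f 1 by (auto simp: Y_def supported_def)
  next
    case 2
    then show ?thesis by (simp add: Y_def)
  next
    case 3
    have "Poly_Mapping.single j 1 + r \<in> bracket_exponents p n k (Suc d)"
      if "r \<in> bracket_exponents p n k d" for r
      using that 3 j Poly_Mapping.keys_add[of "Poly_Mapping.single j 1" r]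
      by (auto simp: bracket_exponents_def monom_degree_add subset_iff split: if_splits)
    moreover have "Y n j = (Var j :: 'k mpoly)" using 3 by (simp add: Y_def)
    ultimately show ?thesis
      using supported_mult[of "{Poly_Mapping.single j 1}" "bracket_exponents p n k d"
          "bracket_exponents p n k (Suc d)" "Var j" f] f
      by (simp add: Var_def supported_single)
  qed
qed

lemma der_dY_Y: "der (dY n) (Y n j) = dY n j"
  by (auto simp: Y_def dY_def)

text \<open>On products of \<open>d\<close> factors \<open>e\<^sub>j\<close> with \<open>j \<ge> kp\<close>, the twist by \<open>-d\<close> cancels the terms \<open>e\<^sub>1 e\<^sub>j\<close>, so
  that only the shifts \<open>e\<^sub>j \<mapsto> e\<^sub>j\<^sub>+\<^sub>1\<close> remain.\<close>

lemma diffop_bracket: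
  assumes p: "p > 0" and r: "r \<in> bracket_exponents p n k d"
  shows "diffop n (- int d) (Poly_Mapping.single r 1 :: 'k::field mpoly) \<in> supported (bracket_exponents p n k d)"
  using r
proof (induction d arbitrary: r)
  case 0
  then show ?case by (simp add: bracket_exponents_0 diffop_def)
next
  case (Suc d)
  \<comment> \<open>One factor e_j is split off. If k = 0 and the degree is still at most d, this
    factor is e_0 = 1.\<close>
  obtain j r' where j: "k * p \<le> j" and r': "r' \<in> bracket_exponents p n k d"
    and eq: "Poly_Mapping.single r 1 = Y n j * (Poly_Mapping.single r' 1 :: 'k mpoly)"
  proof (cases "k = 0 \<and> monom_degree r \<le> d")
    case True
    then show ?thesis using that[of 0 r] Suc.prems by (simp add: bracket_exponents_def Y_def)
  next
    case False
    then have deg: "monom_degree r = Suc d" using Suc.prems by (auto simp: bracket_exponents_def split: if_splits)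
    then obtain j where j: "j \<in> Poly_Mapping.keys r" by (metis monom_degree_def sum.empty ex_in_conv nat.distinct(1))
    then have j': "j \<in> {1..n}" "k * p \<le> j" using Suc.prems by (auto simp: bracket_exponents_def)
    let ?r = "r - Poly_Mapping.single j 1"
    have r: "r = Poly_Mapping.single j 1 + ?r" using j by (intro single_le_decomp) (simp add: in_keys_iff)
    then have "monom_degree r = 1 + monom_degree ?r" by (metis monom_degree_add monom_degree_single)
    then have "monom_degree ?r = d" using deg by simp
    moreover have "Poly_Mapping.keys ?r \<subseteq> Poly_Mapping.keys r"
      by (auto simp: in_keys_iff lookup_minus)
    ultimately have "?r \<in> bracket_exponents p n k d" using Suc.prems by (auto simp: bracket_exponents_def)
    moreover have "Poly_Mapping.single r 1 = Y n j * (Poly_Mapping.single ?r 1 :: 'k mpoly)"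
      using j'(1) by (subst r) (simp add: Y_def Var_def mult_single)
    ultimately show ?thesis using that j'(2) by blast
  qed
  let ?G = "Poly_Mapping.single r' 1 :: 'k mpoly"
  have "diffop n (- int (Suc d)) (Y n j * ?G)
      = Y n j * diffop n (- int d) ?G - of_nat (Suc j) * (Y n (Suc j) * ?G)"
    by (simp add: diffop_def der_mult der_dY_Y dY_def algebra_simps)
  moreover have "Y n j * diffop n (- int d) ?G \<in> supported (bracket_exponents p n k (Suc d))"
    by (rule Y_mult_bracket[OF p j Suc.IH[OF r']])
  moreover have "of_nat (Suc j) * (Y n (Suc j) * ?G) \<in> supported (bracket_exponents p n k (Suc d))"
    unfolding single_of_nat[symmetric]
    using j r' by (intro supported_const_mult Y_mult_bracket[OF p]) (simp_all add: supported_single)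
  ultimately show ?case unfolding eq by (simp only: supported_diff)
qed

text \<open>Each coefficient that the derivation produces contains an exponent divisible by p, so
  the p-th powers are constants.\<close>

lemma der_power_exponents:
  fixes c :: "'k::field"
  assumes "CHAR('k) = p" "q \<in> power_exponents p k"
  shows "der g (Poly_Mapping.single q c) = 0"
proof -
  have "(of_nat (Poly_Mapping.lookup q i) :: 'k) = 0" for i
    using assms by (simp add: of_nat_eq_0_iff_char_dvd power_exponents_def)
  then show ?thesis by (simp add: der_single[OF finite_keys subset_refl])
qed

text \<open>By \<open>der_power_exponents\<close> the differential is linear over the monomials in
  the p-th powers, so stability reduces to the bracket.\<close>

lemma diffop_cohomology:
  fixes f :: "'k::field mpoly"
  assumes char: "CHAR('k) = p" "p > 0" and f: "f \<in> supported (cohomology_exponents p n k d)"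
  shows "diffop n (- int d) f \<in> supported (cohomology_exponents p n k d)"
  using f
proof (induction f rule: supported_induct)
  case (single m c)
  then obtain q r where m: "m = q + r" "q \<in> power_exponents p k" "r \<in> bracket_exponents p n k d"
    by (auto simp: cohomology_exponents_def)
  have "diffop n (- int d) (Poly_Mapping.single m c)
      = Poly_Mapping.single q c * diffop n (- int d) (Poly_Mapping.single r 1)"
    using der_power_exponents[OF char(1) m(2), of "dY n" c]
    by (simp add: m(1) mult_single[of q c r 1, simplified, symmetric] diffop_def der_mult algebra_simps)
  also have "\<dots> \<in> supported (cohomology_exponents p n k d)"
    by (rule supported_mult[OF _ supported_single[OF m(2)] diffop_bracket[OF char(2) m(3)]])
      (auto simp: cohomology_exponents_def)
  finally show ?case .
next
  case (add f g)
  then show ?case unfolding diffop_add by (rule supported_add)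
qed (simp add: diffop_def)

lemma cohomology_exponents_drop:
  assumes "m \<in> cohomology_exponents p (Suc n) k d" "Poly_Mapping.lookup m (Suc n) = 0"
  shows "m \<in> cohomology_exponents p n k d"
proof -
  obtain q r where m: "m = q + r" "q \<in> power_exponents p k" "r \<in> bracket_exponents p (Suc n) k d"
    using assms(1) by (auto simp: cohomology_exponents_def)
  then have "Suc n \<notin> Poly_Mapping.keys r" using assms(2) by (simp add: in_keys_iff lookup_add)
  then have "j \<in> {1..n}" if "j \<in> Poly_Mapping.keys r" for j
    using m(3) that by (cases "j = Suc n") (auto simp: bracket_exponents_def subset_iff)
  then have "r \<in> bracket_exponents p n k d"
    using m(3) by (auto simp: bracket_exponents_def)
  with m show ?thesis by (auto simp: cohomology_exponents_def)
qed

lemma cohomology_exponents_mono: "cohomology_exponents p n k d \<subseteq> cohomology_exponents p (Suc n) k d"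
proof -
  have "bracket_exponents p n k d \<subseteq> bracket_exponents p (Suc n) k d"
    by (auto simp: bracket_exponents_def)
  then show ?thesis by (auto simp: cohomology_exponents_def)
qed

text \<open>As kp is at most n, the p-th powers do not involve e_(n+1). A factor e_(n+1) therefore
  comes from the bracket and costs one degree, and for d = 0 there is none. Together with
  \<open>cohomology_exponents_drop\<close> this describes the sequence restricted to W.\<close>

lemma cohomology_exponents_shift:
  assumes kn: "k * p \<le> n"
  shows "Poly_Mapping.single (Suc n) 1 + m \<in> cohomology_exponents p (Suc n) k d
    \<longleftrightarrow> m \<in> (case d of 0 \<Rightarrow> {} | Suc d' \<Rightarrow> cohomology_exponents p (Suc n) k d')"
proof
  assume "Poly_Mapping.single (Suc n) 1 + m \<in> cohomology_exponents p (Suc n) k d"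
  then obtain q r where qr: "Poly_Mapping.single (Suc n) 1 + m = q + r" "q \<in> power_exponents p k"
    "r \<in> bracket_exponents p (Suc n) k d"
    by (auto simp: cohomology_exponents_def)
  have "Poly_Mapping.lookup q (Suc n) = 0" using qr(2) kn by (intro lookup_power_exponents) auto
  moreover have "Poly_Mapping.lookup (Poly_Mapping.single (Suc n) 1 + m) (Suc n) \<noteq> 0" by (simp add: lookup_add)
  ultimately have "Poly_Mapping.lookup r (Suc n) \<noteq> 0" unfolding qr(1) by (simp add: lookup_add)
  then have r: "r = Poly_Mapping.single (Suc n) 1 + (r - Poly_Mapping.single (Suc n) 1)"
    by (rule single_le_decomp)
  let ?r = "r - Poly_Mapping.single (Suc n) 1"
  have "Poly_Mapping.single (Suc n) 1 + m = Poly_Mapping.single (Suc n) 1 + (q + ?r)"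
    using qr(1) r by (metis add.left_commute)
  then have m: "m = q + ?r" by simp
  have deg: "monom_degree r = 1 + monom_degree ?r" using r by (metis monom_degree_add monom_degree_single)
  have keys: "Poly_Mapping.keys ?r \<subseteq> Poly_Mapping.keys r" by (auto simp: in_keys_iff lookup_minus)
  show "m \<in> (case d of 0 \<Rightarrow> {} | Suc d' \<Rightarrow> cohomology_exponents p (Suc n) k d')"
  proof (cases d)
    case 0
    then show ?thesis using deg qr(3) by (auto simp: bracket_exponents_def split: if_splits)
  next
    case (Suc d')
    then have "?r \<in> bracket_exponents p (Suc n) k d'"
      using deg keys qr(3) by (auto simp: bracket_exponents_def split: if_splits)
    then show ?thesis using m qr(2) Suc by (auto simp: cohomology_exponents_def)
  qed
next
  assume "m \<in> (case d of 0 \<Rightarrow> {} | Suc d' \<Rightarrow> cohomology_exponents p (Suc n) k d')"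
  then obtain d' q r where d: "d = Suc d'" and m: "m = q + r" "q \<in> power_exponents p k"
    "r \<in> bracket_exponents p (Suc n) k d'"
    by (cases d) (auto simp: cohomology_exponents_def)
  have "Poly_Mapping.single (Suc n) 1 + r \<in> bracket_exponents p (Suc n) k d"
    using m(3) kn d Poly_Mapping.keys_add[of "Poly_Mapping.single (Suc n) 1" r]
    by (auto simp: bracket_exponents_def monom_degree_add subset_iff split: if_splits)
  moreover have "Poly_Mapping.single (Suc n) 1 + m = q + (Poly_Mapping.single (Suc n) 1 + r)"
    by (simp add: m(1) add.left_commute)
  ultimately show "Poly_Mapping.single (Suc n) 1 + m \<in> cohomology_exponents p (Suc n) k d"
    using m(2) by (auto simp: cohomology_exponents_def)
qed

text \<open>The bracket now consists of e_(n+1)^d alone, and e_(n+1)^p is among the p-th powers, so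
  the exponents of e_(n+1) are those congruent to d modulo p; as d < p, none of these is below d.
  What remains is the algebra for k.\<close>

lemma cohomology_exponents_multiple:
  assumes n: "Suc n = Suc k * p" and d: "d < p"
  shows "cohomology_exponents p (Suc n) (Suc k) d
    = {q + Poly_Mapping.single (Suc n) t | q t. q \<in> power_exponents p k \<and> int p dvd int t - int d}"
proof (intro equalityI subsetI)
  fix m assume "m \<in> cohomology_exponents p (Suc n) (Suc k) d"
  then obtain q r where m: "m = q + r" "q \<in> power_exponents p (Suc k)" "r \<in> bracket_exponents p (Suc n) (Suc k) d"
    by (auto simp: cohomology_exponents_def)
  have r: "Poly_Mapping.keys r \<subseteq> {Suc n}" "monom_degree r = d"
    using m(3) n by (auto simp: bracket_exponents_def)
  then have "monom_degree r = Poly_Mapping.lookup r (Suc n)" by (simp add: monom_degree_superset[of "{Suc n}"])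
  then have "r = Poly_Mapping.single (Suc n) d"
    using r by (intro poly_mapping_eqI) (auto simp: lookup_single when_def in_keys_iff subset_iff)
  moreover define q' where "q' = q - Poly_Mapping.single (Suc n) (Poly_Mapping.lookup q (Suc n))"
  ultimately have "m = q' + Poly_Mapping.single (Suc n) (Poly_Mapping.lookup q (Suc n) + d)"
    by (intro poly_mapping_eqI) (auto simp: m(1) lookup_add lookup_minus lookup_single when_def)
  moreover have "q' \<in> power_exponents p k"
  proof -
    have lookup_q': "Poly_Mapping.lookup q' i = (if i = Suc n then 0 else Poly_Mapping.lookup q i)" for i
      by (simp add: q'_def lookup_minus lookup_single when_def)
    have "j \<in> {i * p | i. i \<in> {1..k}}" if "j \<in> Poly_Mapping.keys q'" for j
    proof -
      have j: "j \<in> Poly_Mapping.keys q" "j \<noteq> Suc n"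
        using that by (auto simp: in_keys_iff lookup_q' split: if_splits)
      then obtain i where "j = i * p" "i \<in> {1..Suc k}" using m(2) unfolding power_exponents_def by blast
      with j(2) n show ?thesis by (cases "i = Suc k") auto
    qed
    then show ?thesis using m(2) by (auto simp: power_exponents_def lookup_q')
  qed
  moreover have "int p dvd int (Poly_Mapping.lookup q (Suc n) + d) - int d"
    using m(2) by (simp add: power_exponents_def)
  ultimately show "m \<in> {q + Poly_Mapping.single (Suc n) t | q t. q \<in> power_exponents p k \<and> int p dvd int t - int d}"
    by blast
next
  fix m assume "m \<in> {q + Poly_Mapping.single (Suc n) t | q t. q \<in> power_exponents p k \<and> int p dvd int t - int d}"
  then obtain q t where m: "m = q + Poly_Mapping.single (Suc n) t" "q \<in> power_exponents p k" "int p dvd int t - int d"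
    by blast
  have "d \<le> t"
  proof (rule ccontr)
    assume "\<not> d \<le> t"
    then have "int p \<le> int d - int t" using m(3) by (intro zdvd_imp_le) (auto simp: dvd_diff_commute)
    with d show False by simp
  qed
  then have dvd: "p dvd t - d" using m(3) by (metis int_dvd_int_iff of_nat_diff)
  have "{j * p | j. j \<in> {1..k}} \<subseteq> {j * p | j. j \<in> {1..Suc k}}" by fastforce
  then have "q \<in> power_exponents p (Suc k)" using m(2) unfolding power_exponents_def by blast
  moreover have "Poly_Mapping.single (Suc n) (t - d) \<in> power_exponents p (Suc k)"
  proof -
    have "Suc n \<in> {j * p | j. j \<in> {1..Suc k}}" unfolding n by fastforce
    with dvd show ?thesis by (auto simp: power_exponents_def lookup_single when_def)
  qed
  ultimately have "q + Poly_Mapping.single (Suc n) (t - d) \<in> power_exponents p (Suc k)"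
    by (rule power_exponents_add)
  moreover have "Poly_Mapping.single (Suc n) d \<in> bracket_exponents p (Suc n) (Suc k) d"
    using n by (simp add: bracket_exponents_def)
  moreover have "m = q + Poly_Mapping.single (Suc n) (t - d) + Poly_Mapping.single (Suc n) d"
    using \<open>d \<le> t\<close> by (simp add: m(1) add.assoc single_add[symmetric])
  ultimately show "m \<in> cohomology_exponents p (Suc n) (Suc k) d"
    unfolding cohomology_exponents_def by blast
qed

text \<open>The last inequality says a > n - kp for a = p - d. The induction keeps k and d general
  because at n = kp it drops to n - 1, the top of the previous block, where all twists b occur at
  once: S_(n-1)(b) is acyclic by \<open>exact_interior\<close> unless p divides b, and then the
  hypothesis for d = 0 applies.\<close>

theorem exact_cohomology:
  assumes char: "CHAR('k::field) = p" "p > 0"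
    and n: "k * p \<le> n" "n < Suc k * p" and d: "d + n < Suc k * p"
  shows "exact_modulo p (diffop n (- int d) :: 'k mpoly \<Rightarrow> _) (polys n) (supported (cohomology_exponents p n k d))"
  using n d
proof (induction n arbitrary: k d)
  case 0
  then have k: "k = 0" using char(2) by simp
  \<comment> \<open>In zero variables everything is constant and already lies in the
    cohomology.\<close>
  have "0 \<in> cohomology_exponents p 0 k d"
    using power_exponents_0[of p k] by (force simp: cohomology_exponents_def bracket_exponents_def k monom_degree_def)
  then have "f \<in> supported (cohomology_exponents p 0 k d)" if "f \<in> polys 0" for f :: "'k mpoly"
    using that by (elim polys_0E) (simp add: supported_single)
  then show ?case unfolding exact_modulo_def by (intro ballI impI bexI[of _ 0]) simp_all
next
  case (Suc n)
  show ?case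
  proof (cases "k * p \<le> n")
    case True
    let ?W = "\<lambda>d. case d of 0 \<Rightarrow> {} | Suc d' \<Rightarrow> cohomology_exponents p (Suc n) k d'"
    have step: "exact_modulo p (diffop (Suc n) (- int d) :: 'k mpoly \<Rightarrow> _) (polys (Suc n))
        (supported (cohomology_exponents p (Suc n) k d))"
      if d: "d + Suc n < Suc k * p"
        and exact: "exact_modulo p (diffop (Suc n) (- int d + 1) :: 'k mpoly \<Rightarrow> _) (polys (Suc n)) (supported (?W d))"
      for d
    proof (rule exact_extension[OF char exact])
      show "exact_modulo p (diffop n (- int d) :: 'k mpoly \<Rightarrow> _) (polys n) (supported (cohomology_exponents p n k d))"
        using d by (intro Suc.IH True) simp_all
      show "cohomology_exponents p n k d \<subseteq> cohomology_exponents p (Suc n) k d"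
        by (rule cohomology_exponents_mono)
      show "cohomology_exponents p n k d \<subseteq> exponents n"
        by (rule cohomology_exponents_exponents[OF char(2) True])
      show "diffop (Suc n) (- int d) w \<in> supported (cohomology_exponents p (Suc n) k d)"
        if "w \<in> supported (cohomology_exponents p n k d)" for w :: "'k mpoly"
        using that supported_mono[OF cohomology_exponents_mono] by (intro diffop_cohomology[OF char]) blast
      show "m \<in> cohomology_exponents p n k d"
        if "m \<in> cohomology_exponents p (Suc n) k d" "Poly_Mapping.lookup m (Suc n) = 0" for m
        using that by (rule cohomology_exponents_drop)
      show "Poly_Mapping.single (Suc n) 1 + m \<in> cohomology_exponents p (Suc n) k d \<longleftrightarrow> m \<in> ?W d" for m
        by (rule cohomology_exponents_shift[OF True])
    qed
    show ?thesis using Suc.prems(3)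
    proof (induction d)
      case 0
      \<comment> \<open>For d = 0 the submodule e_(n+1) S_(n+1)(1) meets W trivially and is acyclic
        by (ii).\<close>
      have "exact_modulo p (diffop (Suc n) 1 :: 'k mpoly \<Rightarrow> _) (polys (Suc n)) {0}"
      proof (rule exact_interior[OF char])
        show "k * p \<le> Suc n" "Suc n < (k + 1) * p" using Suc.prems(1,2) by simp_all
        show "1 \<le> int (Suc n) - int (k * p)" using True by linarith
      qed simp
      then show ?case using 0 by (intro step) (simp_all add: supported_empty)
    next
      case (Suc d)
      then show ?case by (intro step) simp_all
    qed
  next
    case False
    then have kp: "Suc n = k * p" using Suc.prems(1) by simp
    then obtain k' where k: "k = Suc k'" by (cases k) auto
    have kp': "Suc n = Suc k' * p" using kp k by simp
    then have kn: "k' * p \<le> n" "n < Suc k' * p" "0 + n < Suc k' * p" "n - k' * p = p - 1"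
      using char(2) by simp_all
    have d: "d < p" using Suc.prems(3) kp by simp
    \<comment> \<open>\<open>V a\<close> is the cohomology of S_n(a) at the top of the previous
      block. The set \<open>W a\<close> collects e_(n+1)^t times that of S_n(a+t), which is nonzero
      only for t congruent to -a modulo p.\<close>
    define V where "V a = (if int p dvd a then power_exponents p k' else {})" for a
    define W where "W a = {q + Poly_Mapping.single (Suc n) t | q t. q \<in> power_exponents p k' \<and> int p dvd int t + a}" for a
    have q_top: "Poly_Mapping.lookup q (Suc n) = 0" if "q \<in> power_exponents p k'" for q
      using that kn(1) by (intro lookup_power_exponents) auto
    have "exact_modulo p (diffop (Suc n) (- int d) :: 'k mpoly \<Rightarrow> _) (polys (Suc n)) (supported (W (- int d)))"
    proof (rule exact_direct_sum[where V = V])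
      show "(of_nat (Suc n) :: 'k) = 0"
        unfolding of_nat_eq_0_iff_char_dvd char(1) kp' by (rule dvd_triv_right)
    next
      fix a
      show "exact_modulo p (diffop n a :: 'k mpoly \<Rightarrow> _) (polys n) (supported (V a))"
      proof (cases "int p dvd a")
        case True
        then have "(of_int a :: 'k) = of_int (- int 0)"
          using of_int_CHAR_mod[OF char(1), of a] by (simp add: dvd_imp_mod_0)
        then have "(diffop n a :: 'k mpoly \<Rightarrow> _) = diffop n (- int 0)" by (rule diffop_cong)
        moreover have "V a = cohomology_exponents p n k' 0"
          using True by (simp add: V_def cohomology_exponents_def bracket_exponents_0)
        ultimately show ?thesis using Suc.IH[OF kn(1-3)] by simp
      next
        case False
        let ?a = "a mod int p"
        have "?a \<noteq> 0" "0 \<le> ?a" "?a < int p" using False char(2) by (auto simp: dvd_eq_mod_eq_0)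
        then have a: "1 \<le> ?a" "?a \<le> int p - 1" by linarith+
        have "int n - int (k' * p) = int p - 1" using kn(1,4) char(2) by linarith
        with a have "?a \<le> int n - int (k' * p)" by linarith
        then have "exact_modulo p (diffop n ?a :: 'k mpoly \<Rightarrow> _) (polys n) {0}"
          using kn by (intro exact_interior[OF char _ _ a(1)]) simp_all
        moreover have "(diffop n a :: 'k mpoly \<Rightarrow> _) = diffop n ?a"
          using of_int_CHAR_mod[OF char(1), of a] by (intro diffop_cong) simp
        ultimately show ?thesis using False by (simp add: V_def supported_empty)
      qed
    next
      fix a m
      show "m \<in> W a \<and> Poly_Mapping.lookup m (Suc n) = 0 \<longleftrightarrow> m \<in> V a"
      proof
        assume m: "m \<in> W a \<and> Poly_Mapping.lookup m (Suc n) = 0"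
        then obtain q t where qt: "m = q + Poly_Mapping.single (Suc n) t" "q \<in> power_exponents p k'" "int p dvd int t + a"
          by (auto simp: W_def)
        then have "t = 0" using m by (simp add: lookup_add)
        with qt show "m \<in> V a" by (simp add: V_def)
      next
        assume "m \<in> V a"
        then have m: "m \<in> power_exponents p k'" "int p dvd a" by (auto simp: V_def split: if_splits)
        then have "m \<in> W a" unfolding W_def by (intro CollectI exI[of _ m] exI[of _ 0]) simp
        with q_top[OF m(1)] show "m \<in> W a \<and> Poly_Mapping.lookup m (Suc n) = 0" by simp
      qed
      show "Poly_Mapping.single (Suc n) 1 + m \<in> W a \<longleftrightarrow> m \<in> W (a + 1)"
      proof
        assume "Poly_Mapping.single (Suc n) 1 + m \<in> W a"
        then obtain q t where qt: "Poly_Mapping.single (Suc n) 1 + m = q + Poly_Mapping.single (Suc n) t"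
          "q \<in> power_exponents p k'" "int p dvd int t + a"
          by (auto simp: W_def)
        have "Poly_Mapping.lookup (Poly_Mapping.single (Suc n) 1 + m) (Suc n) \<noteq> 0" by (simp add: lookup_add)
        then have "t \<noteq> 0" unfolding qt(1) using q_top[OF qt(2)] by (simp add: lookup_add)
        then obtain t' where t: "t = 1 + t'" by (cases t) auto
        have "Poly_Mapping.single (Suc n) 1 + m = Poly_Mapping.single (Suc n) 1 + (q + Poly_Mapping.single (Suc n) t')"
          unfolding qt(1) t single_add by (simp only: add.left_commute)
        then have "m = q + Poly_Mapping.single (Suc n) t'" by simp
        moreover have "int p dvd int t' + (a + 1)" using qt(3) t by (simp add: algebra_simps)
        ultimately show "m \<in> W (a + 1)" using qt(2) unfolding W_def by blast
      next
        assume "m \<in> W (a + 1)"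
        then obtain q t where qt: "m = q + Poly_Mapping.single (Suc n) t" "q \<in> power_exponents p k'" "int p dvd int t + (a + 1)"
          by (auto simp: W_def)
        have "Poly_Mapping.single (Suc n) 1 + m = q + Poly_Mapping.single (Suc n) (1 + t)"
          unfolding qt(1) single_add by (simp only: add.left_commute)
        moreover have "int p dvd int (1 + t) + a" using qt(3) by (simp add: algebra_simps)
        ultimately show "Poly_Mapping.single (Suc n) 1 + m \<in> W a" using qt(2) unfolding W_def by blast
      qed
    qed
    moreover have "W (- int d) = cohomology_exponents p (Suc n) k d"
      unfolding k cohomology_exponents_multiple[OF kp' d] W_def by simp
    ultimately show ?thesis by simp
  qed
qed

section \<open>Splitting off an acyclic complement\<close>

locale graded_operator = vector_space s
  for s :: "'k::field \<Rightarrow> 'v::ab_group_add \<Rightarrow> 'v" +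
  fixes G :: "int \<Rightarrow> 'v set" and D :: "'v \<Rightarrow> 'v" and p :: nat
  assumes p: "p > 0"
    and G_subspace: "subspace (G i)"
    and G_independent: "finite I \<Longrightarrow> \<forall>i\<in>I. f i \<in> G i \<Longrightarrow> (\<Sum>i\<in>I. f i) = 0 \<Longrightarrow> \<forall>i\<in>I. f i = 0"
    and D_add: "D (x + y) = D x + D y" and D_scale: "D (s c x) = s c (D x)"
    and D_G: "x \<in> G i \<Longrightarrow> D x \<in> G (i + 2)"
    and D_p: "x \<in> span (\<Union>i. G i) \<Longrightarrow> (D ^^ p) x = 0"
begin

abbreviation "C \<equiv> span (\<Union>i. G i)"

lemma D_C: "x \<in> C \<Longrightarrow> D x \<in> C"
proof (induction rule: span_induct_alt)
  case base
  have "D 0 = 0" using D_add[of 0 0] by simp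
  then show ?case by (simp add: span_zero)
next
  case (step c x y)
  then have "D x \<in> C" using D_G by (blast intro: span_base)
  with step show ?case by (simp add: D_add D_scale span_add span_scale)
qed

sublocale additive_operator D C
  by unfold_locales (simp_all add: D_add D_C span_zero span_diff)

lemma pow_scale: "(D ^^ m) (s c x) = s c ((D ^^ m) x)"
  by (induction m) (simp_all add: D_scale)

lemma pow_G: "x \<in> G i \<Longrightarrow> (D ^^ m) x \<in> G (i + 2 * int m)"
proof (induction m)
  case (Suc m)
  then have "(D ^^ Suc m) x \<in> G (i + 2 * int m + 2)" by (simp add: D_G)
  then show ?case by (simp add: algebra_simps)
qed simp

lemma pow_ge_p: "x \<in> C \<Longrightarrow> p \<le> m \<Longrightarrow> (D ^^ m) x = 0"
  using D_p[of "(D ^^ (m - p)) x"] pow_in[of x "m - p"]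
  by (metis comp_apply funpow_add le_add_diff_inverse)

text \<open>A family over all integers that vanishes off a finite set lets two decompositions be
  compared on a common index set, as \<open>proj_G\<close> does.\<close>

lemma span_subspaces_decomp:
  assumes "\<And>i. subspace (A i)" "x \<in> span (\<Union>i. A i)"
  obtains I :: "int set" and f where "finite I" "\<And>i. f i \<in> A i" "\<And>i. i \<notin> I \<Longrightarrow> f i = 0" "x = (\<Sum>i\<in>I. f i)"
proof -
  have "\<exists>(I :: int set) f. finite I \<and> (\<forall>i. f i \<in> A i) \<and> (\<forall>i. i \<notin> I \<longrightarrow> f i = 0) \<and> x = (\<Sum>i\<in>I. f i)"
    using assms(2)
  proof (induction rule: span_induct_alt)
    case base
    show ?case using subspace_0[OF assms(1)] by (intro exI[of _ "{}"] exI[of _ "\<lambda>_. 0"]) simp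
  next
    case (step c a y)
    then obtain j where j: "a \<in> A j" by blast
    obtain I f where f: "finite I" "\<forall>i. f i \<in> A i" "\<forall>i. i \<notin> I \<longrightarrow> f i = 0" "y = (\<Sum>i\<in>I. f i)"
      using step by blast
    let ?g = "\<lambda>i. (if i = j then s c a else 0) + f i"
    have "y = (\<Sum>i\<in>insert j I. f i)"
      unfolding f(4) using f(1,3) by (intro sum.mono_neutral_left) auto
    then have "s c a + y = (\<Sum>i\<in>insert j I. ?g i)"
      using f(1) by (simp only: sum.distrib) simp
    moreover have "?g i \<in> A i" for i
      using f(2) j assms(1) by (auto intro: subspace_add subspace_scale)
    moreover have "?g i = 0" if "i \<notin> insert j I" for i using that f(3) by simp
    ultimately show ?case using f(1) by (intro exI[of _ "insert j I"] exI[of _ ?g]) simp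
  qed
  with that show ?thesis by blast
qed

end

text \<open>W is graded and D-stable, and \<open>exact\<close> makes the quotient by W acyclic. The
  locale serves to build a graded D-stable complement K of W with a basis of full D-orbits.\<close>

locale exact_pair = graded_operator s G D p
  for s :: "'k::field \<Rightarrow> 'v::ab_group_add \<Rightarrow> 'v" and G D p +
  fixes W :: "'v set"
  assumes W_homogeneous: "W = span (\<Union>i. G i \<inter> W)"
    and D_W: "x \<in> W \<Longrightarrow> D x \<in> W"
    and exact: "exact_modulo p D C W"
begin

lemma W_subspace: "subspace W"
  by (subst W_homogeneous) simp

lemma W_C: "W \<subseteq> C"
  by (subst W_homogeneous) (auto intro!: span_mono)

lemma pow_W: "x \<in> W \<Longrightarrow> (D ^^ m) x \<in> W"
  by (induction m) (simp_all add: D_W)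

text \<open>\<open>\<partial>\<^sup>p\<^sup>-\<^sup>1 B\<close> is a basis of the image of \<open>\<partial>\<^sup>p\<^sup>-\<^sup>1\<close> modulo \<open>W\<close>.\<close>

lemma top_basis:
  obtains B where "B \<subseteq> (\<Union>i. G i)"
    "\<And>F u. finite F \<Longrightarrow> F \<subseteq> B \<Longrightarrow> (\<Sum>b\<in>F. s (u b) ((D ^^ (p - 1)) b)) \<in> W \<Longrightarrow> \<forall>b\<in>F. u b = 0"
    "\<And>x. x \<in> C \<Longrightarrow> \<exists>w\<in>W. (D ^^ (p - 1)) x - w \<in> span ((D ^^ (p - 1)) ` B)"
proof -
  let ?d = "D ^^ (p - 1)"
  \<comment> \<open>A basis of W is extended, by vectors D^(p-1) g with g homogeneous, to a basis of
    the joint span; choosing such a g for each added vector yields B.\<close>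
  obtain W0 where W0: "W0 \<subseteq> W" "independent W0" "W \<subseteq> span W0"
    by (rule maximal_independent_subset)
  let ?S = "?d ` (\<Union>i. G i)"
  obtain Z where Z: "W0 \<subseteq> Z" "Z \<subseteq> W0 \<union> ?S" "independent Z" "W0 \<union> ?S \<subseteq> span Z"
    by (rule maximal_independent_subset_extend[of W0 "W0 \<union> ?S"]) (use W0(2) in auto)
  define \<beta> where "\<beta> c = (SOME b. b \<in> (\<Union>i. G i) \<and> ?d b = c)" for c
  have \<beta>: "\<beta> c \<in> (\<Union>i. G i) \<and> ?d (\<beta> c) = c" if "c \<in> Z - W0" for c
  proof -
    have "\<exists>b. b \<in> (\<Union>i. G i) \<and> ?d b = c" using that Z(2) by blast
    then show ?thesis unfolding \<beta>_def by (rule someI_ex)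
  qed
  define B where "B = \<beta> ` (Z - W0)"
  have image: "?d ` B = Z - W0"
    unfolding B_def image_image using \<beta> by simp
  have inj: "inj_on ?d B"
    unfolding B_def inj_on_def using \<beta> by auto
  show ?thesis
  proof
    show "B \<subseteq> (\<Union>i. G i)" unfolding B_def using \<beta> by blast
    show "\<forall>b\<in>F. u b = 0" if F: "finite F" "F \<subseteq> B" and sum: "(\<Sum>b\<in>F. s (u b) (?d b)) \<in> W" for F u
    proof (rule ccontr)
      assume "\<not> (\<forall>b\<in>F. u b = 0)"
      then obtain b where b: "b \<in> F" "u b \<noteq> 0" by blast
      have dZ: "?d b' \<in> Z - W0" if "b' \<in> F" for b' using that F(2) image by blast
      have rest: "s (u b') (?d b') \<in> span (Z - {?d b})" if "b' \<in> F - {b}" for b'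
      proof (intro span_scale span_base)
        have "?d b' \<noteq> ?d b" using inj F(2) b(1) that unfolding inj_on_def by blast
        then show "?d b' \<in> Z - {?d b}" using dZ[of b'] that by simp
      qed
      have all: "(\<Sum>b\<in>F. s (u b) (?d b)) \<in> span (Z - {?d b})"
      proof -
        have "W0 \<subseteq> Z - {?d b}" using Z(1) dZ[OF b(1)] by blast
        then show ?thesis using sum W0(3) span_mono by blast
      qed
      have others: "(\<Sum>b\<in>F - {b}. s (u b) (?d b)) \<in> span (Z - {?d b})"
        using rest by (rule span_sum)
      have "(\<Sum>b\<in>F. s (u b) (?d b)) = s (u b) (?d b) + (\<Sum>b\<in>F - {b}. s (u b) (?d b))"
        using F(1) b(1) by (rule sum.remove)
      with span_diff[OF all others] have "s (u b) (?d b) \<in> span (Z - {?d b})" by simp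
      then have "s (inverse (u b)) (s (u b) (?d b)) \<in> span (Z - {?d b})" by (rule span_scale)
      then have "?d b \<in> span (Z - {?d b})" using b(2) by simp
      then have "dependent Z" unfolding dependent_def using dZ[OF b(1)] by blast
      with Z(3) show False by blast
    qed
    show "\<exists>w\<in>W. ?d x - w \<in> span (?d ` B)" if "x \<in> C" for x
    proof -
      have "?d x \<in> span ?S"
        using that
      proof (induction rule: span_induct_alt)
        case (step c x y)
        then show ?case by (simp add: pow_add pow_scale span_add span_scale span_base)
      qed (simp add: span_zero)
      also have "span ?S \<subseteq> span Z" using Z(4) by (intro span_minimal) auto
      also have "Z = W0 \<union> (Z - W0)" using Z(1) by blast
      finally obtain w y where wy: "w \<in> span W0" "y \<in> span (Z - W0)" "?d x = w + y"
        unfolding span_Un by blast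
      have "span W0 \<subseteq> W" using W0(1) W_subspace by (rule span_minimal)
      with wy image show ?thesis by (intro bexI[of _ w]) auto
    qed
  qed
qed

section \<open>The orbit basis and the complement K\<close>

definition "complement_basis = (SOME B. B \<subseteq> (\<Union>i. G i) \<and>
    (\<forall>F u. finite F \<longrightarrow> F \<subseteq> B \<longrightarrow> (\<Sum>b\<in>F. s (u b) ((D ^^ (p - 1)) b)) \<in> W \<longrightarrow> (\<forall>b\<in>F. u b = 0)) \<and>
    (\<forall>x\<in>C. \<exists>w\<in>W. (D ^^ (p - 1)) x - w \<in> span ((D ^^ (p - 1)) ` B)))"

lemma complement_basis:
  shows complement_basis_homogeneous: "complement_basis \<subseteq> (\<Union>i. G i)"
    and complement_basis_independent: "finite F \<Longrightarrow> F \<subseteq> complement_basis \<Longrightarrow>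
      (\<Sum>b\<in>F. s (u b) ((D ^^ (p - 1)) b)) \<in> W \<Longrightarrow> b \<in> F \<Longrightarrow> u b = 0"
    and complement_basis_spans: "x \<in> C \<Longrightarrow>
      \<exists>w\<in>W. (D ^^ (p - 1)) x - w \<in> span ((D ^^ (p - 1)) ` complement_basis)"
proof -
  let ?P = "\<lambda>B. B \<subseteq> (\<Union>i. G i) \<and>
    (\<forall>F u. finite F \<longrightarrow> F \<subseteq> B \<longrightarrow> (\<Sum>b\<in>F. s (u b) ((D ^^ (p - 1)) b)) \<in> W \<longrightarrow> (\<forall>b\<in>F. u b = 0)) \<and>
    (\<forall>x\<in>C. \<exists>w\<in>W. (D ^^ (p - 1)) x - w \<in> span ((D ^^ (p - 1)) ` B))"
  have "\<exists>B. ?P B"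
  proof (rule top_basis)
    fix B
    assume B: "B \<subseteq> (\<Union>i. G i)"
      "\<And>F u. finite F \<Longrightarrow> F \<subseteq> B \<Longrightarrow> (\<Sum>b\<in>F. s (u b) ((D ^^ (p - 1)) b)) \<in> W \<Longrightarrow> \<forall>b\<in>F. u b = 0"
      "\<And>x. x \<in> C \<Longrightarrow> \<exists>w\<in>W. (D ^^ (p - 1)) x - w \<in> span ((D ^^ (p - 1)) ` B)"
    show "\<exists>B. ?P B"
      by (rule exI[of _ B], intro conjI B(1) allI impI ballI) (fact B(2)[rule_format], fact B(3))
  qed
  then have P: "?P complement_basis" unfolding complement_basis_def by (rule someI_ex)
  show "complement_basis \<subseteq> (\<Union>i. G i)" using P by blast
  show "finite F \<Longrightarrow> F \<subseteq> complement_basis \<Longrightarrow>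
      (\<Sum>b\<in>F. s (u b) ((D ^^ (p - 1)) b)) \<in> W \<Longrightarrow> b \<in> F \<Longrightarrow> u b = 0"
    using P by blast
  show "x \<in> C \<Longrightarrow> \<exists>w\<in>W. (D ^^ (p - 1)) x - w \<in> span ((D ^^ (p - 1)) ` complement_basis)"
    using P by blast
qed

abbreviation "indices \<equiv> complement_basis \<times> {..<p}"
abbreviation "orbit \<equiv> \<lambda>(b, i). (D ^^ i) b"
abbreviation "K \<equiv> span (orbit ` indices)"

lemma basis_C: "b \<in> complement_basis \<Longrightarrow> b \<in> C"
  using complement_basis_homogeneous span_superset by blast

lemma orbit_C: "orbit ` indices \<subseteq> C"
  using pow_in basis_C by auto

lemma K_C: "K \<subseteq> C"
  using orbit_C by (intro span_minimal) auto

text \<open>Apply a suitable power of \<open>\<partial>\<close> to turn the terms with the lowest power of \<open>\<partial>\<close> into terms with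
  \<open>\<partial>\<^sup>p\<^sup>-\<^sup>1\<close> and to kill all others.\<close>

lemma orbit_independent_modulo:
  assumes F: "finite F" "F \<subseteq> indices" and sum: "(\<Sum>x\<in>F. s (u x) (orbit x)) \<in> W" and x: "x \<in> F"
  shows "u x = 0"
proof (rule ccontr)
  assume "u x \<noteq> 0"
  let ?I = "snd ` {y \<in> F. u y \<noteq> 0}"
  have "snd x \<in> ?I" using x \<open>u x \<noteq> 0\<close> by blast
  then have I: "finite ?I" "?I \<noteq> {}" using F(1) by (simp, blast)
  define i0 where "i0 = Min ?I"
  have "i0 \<in> ?I" unfolding i0_def using I by (rule Min_in)
  then obtain b0 where b0: "(b0, i0) \<in> F" "u (b0, i0) \<noteq> 0" by auto
  then have i0: "i0 < p" using F(2) by auto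
  have min: "u y = 0" if "y \<in> F" "snd y < i0" for y
  proof (rule ccontr)
    assume "u y \<noteq> 0"
    then have "i0 \<le> snd y" unfolding i0_def using that(1) I(1) by (intro Min_le) auto
    with that(2) show False by simp
  qed
  let ?F0 = "{y \<in> F. snd y = i0}"
  have summand: "(D ^^ (p - 1 - i0)) (s (u y) (orbit y)) = (if snd y = i0 then s (u y) ((D ^^ (p - 1)) (fst y)) else 0)"
    if yF: "y \<in> F" for y
  proof -
    obtain b i where y: "y = (b, i)" "b \<in> complement_basis" using yF F(2) by (cases y) auto
    have "(D ^^ (p - 1 - i0)) (orbit y) = (D ^^ (p - 1 - i0 + i)) b" by (simp add: y(1) funpow_add)
    moreover have "(D ^^ (p - 1 - i0 + i)) b = 0" if "i0 < i"
      using that i0 basis_C[OF y(2)] by (intro pow_ge_p) auto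
    ultimately show ?thesis using min[OF yF] y(1) i0
      by (cases i i0 rule: linorder_cases) (auto simp: pow_scale)
  qed
  have "(D ^^ (p - 1 - i0)) (\<Sum>y\<in>F. s (u y) (orbit y))
      = (\<Sum>y\<in>F. if snd y = i0 then s (u y) ((D ^^ (p - 1)) (fst y)) else 0)"
    unfolding pow_sum by (rule sum.cong[OF refl summand])
  also have "\<dots> = (\<Sum>y\<in>?F0. s (u y) ((D ^^ (p - 1)) (fst y)))"
    by (rule sum.inter_filter[OF F(1), symmetric])
  also have "\<dots> = (\<Sum>b\<in>fst ` ?F0. s (u (b, i0)) ((D ^^ (p - 1)) b))"
    by (subst sum.reindex) (auto simp: inj_on_def intro!: sum.cong)
  finally have "(\<Sum>b\<in>fst ` ?F0. s (u (b, i0)) ((D ^^ (p - 1)) b)) \<in> W"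
    using pow_W[OF sum, of "p - 1 - i0"] by simp
  moreover have "finite (fst ` ?F0)" "fst ` ?F0 \<subseteq> complement_basis" "b0 \<in> fst ` ?F0"
    using F b0(1) by force+
  ultimately have "u (b0, i0) = 0" using complement_basis_independent[of "fst ` ?F0" "\<lambda>b. u (b, i0)" b0] by blast
  with b0(2) show False by blast
qed

lemma orbit_inj: "inj_on orbit indices"
proof (rule inj_onI, rule ccontr)
  fix x y assume xy: "x \<in> indices" "y \<in> indices" "orbit x = orbit y" "x \<noteq> y"
  \<comment> \<open>Coinciding orbit vectors would yield a relation with coefficients 1 and
    -1.\<close>
  let ?u = "\<lambda>z. if z = x then 1 else - 1 :: 'k"
  have "(\<Sum>z\<in>{x, y}. s (?u z) (orbit z)) = 0" using xy(3,4) by simp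
  then have "(\<Sum>z\<in>{x, y}. s (?u z) (orbit z)) \<in> W" using subspace_0[OF W_subspace] by simp
  from orbit_independent_modulo[OF _ _ this, of x] xy(1,2) show False by simp
qed

lemma orbit_sum_W:
  assumes "finite T" "T \<subseteq> orbit ` indices" "(\<Sum>v\<in>T. s (r v) v) \<in> W" "v \<in> T"
  shows "r v = 0"
proof -
  obtain F where F: "F \<subseteq> indices" "inj_on orbit F" "T = orbit ` F"
    using assms(2) unfolding subset_image_inj by blast
  then have "finite F" using assms(1) by (simp add: finite_image_iff)
  moreover have "(\<Sum>x\<in>F. s (r (orbit x)) (orbit x)) \<in> W"
    using assms(3) unfolding F(3) sum.reindex[OF F(2)] by (simp add: comp_def)
  ultimately show ?thesis
    using orbit_independent_modulo[of F "\<lambda>x. r (orbit x)"] F(1,3) assms(4) by auto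
qed

lemma orbit_independent: "independent (orbit ` indices)"
  unfolding independent_explicit_module
proof (intro allI impI)
  fix T r v
  assume T: "finite T" "T \<subseteq> orbit ` indices" "(\<Sum>v\<in>T. s (r v) v) = 0" "v \<in> T"
  then have "(\<Sum>v\<in>T. s (r v) v) \<in> W" using subspace_0[OF W_subspace] by simp
  with T(1,2) show "r v = 0" using T(4) by (rule orbit_sum_W)
qed

lemma K_W:
  assumes "x \<in> K" "x \<in> W"
  shows "x = 0"
proof -
  obtain T r where T: "finite T" "T \<subseteq> orbit ` indices" "x = (\<Sum>v\<in>T. s (r v) v)"
    using assms(1) unfolding span_explicit by blast
  then have "r v = 0" if "v \<in> T" for v using orbit_sum_W[of T r v] assms(2) that by blast
  then show ?thesis unfolding T(3) by simp
qed

text \<open>Descent on m with D^m x in W, starting from m = p, where D^p x = 0. If D^(m+1) x is in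
  W, exactness gives D^m x = D^(p-1) z modulo W, and modulo W this is a combination of the vectors
  D^(p-1) b = D^m (D^(p-1-m) b). The D^(p-1-m) b lie in K, and their combination is subtracted from
  x.\<close>

lemma decomposition:
  assumes "x \<in> C"
  shows "\<exists>w\<in>W. x - w \<in> K"
proof -
  have "\<exists>w\<in>W. x - w \<in> K" if "m \<le> p" "x \<in> C" "(D ^^ m) x \<in> W" for m x
    using that
  proof (induction m arbitrary: x)
    case 0
    then show ?case by (intro bexI[of _ x]) (simp_all add: span_zero)
  next
    case (Suc m)
    have "(D ^^ m) x \<in> C" "D ((D ^^ m) x) \<in> W" using Suc.prems by (simp_all add: pow_in)
    then obtain z where z: "z \<in> C" "(D ^^ m) x - (D ^^ (p - 1)) z \<in> W"
      by (rule exact_moduloE[OF exact])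
    obtain w where w: "w \<in> W" "(D ^^ (p - 1)) z - w \<in> span ((D ^^ (p - 1)) ` complement_basis)"
      using complement_basis_spans[OF z(1)] by blast
    have split: "p - 1 = m + (p - 1 - m)" using Suc.prems(1) by simp
    have "\<exists>y\<in>K. v = (D ^^ m) y" if "v \<in> span ((D ^^ (p - 1)) ` complement_basis)" for v
      using that
    proof (induction rule: span_induct_alt)
      case base
      show ?case by (intro bexI[of _ 0]) (simp_all add: span_zero)
    next
      case (step c v v')
      then obtain b y where b: "b \<in> complement_basis" "v = (D ^^ (p - 1)) b" and y: "y \<in> K" "v' = (D ^^ m) y"
        by blast
      have "(D ^^ (p - 1 - m)) b \<in> orbit ` indices"
        using b(1) p by (intro image_eqI[of _ _ "(b, p - 1 - m)"]) auto
      then have "s c ((D ^^ (p - 1 - m)) b) + y \<in> K"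
        by (rule span_add[OF span_scale[OF span_base] y(1)])
      moreover have "s c v + v' = (D ^^ m) (s c ((D ^^ (p - 1 - m)) b) + y)"
        unfolding pow_add pow_scale b(2) y(2) by (subst split) (simp only: funpow_add comp_def)
      ultimately show ?case by blast
    qed
    then obtain y where y: "y \<in> K" "(D ^^ (p - 1)) z - w = (D ^^ m) y" using w(2) by blast
    have "(D ^^ m) (x - y) = ((D ^^ m) x - (D ^^ (p - 1)) z) + w"
      unfolding pow_diff y(2)[symmetric] by simp
    also have "\<dots> \<in> W" using z(2) w(1) by (rule subspace_add[OF W_subspace])
    finally have "(D ^^ m) (x - y) \<in> W" .
    moreover have "x - y \<in> C" using Suc.prems(2) y(1) K_C by (auto intro: span_diff)
    ultimately obtain w' where "w' \<in> W" "x - y - w' \<in> K" using Suc.IH Suc.prems(1) by (meson Suc_leD)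
    moreover from this(2) y(1) have "x - y - w' + y \<in> K" by (rule span_add)
    ultimately show ?case by (intro bexI[of _ w']) (simp_all add: algebra_simps)
  qed
  from this[of p x] show ?thesis using assms D_p subspace_0[OF W_subspace] by simp
qed

lemma D_K: "x \<in> K \<Longrightarrow> D x \<in> K"
proof (induction rule: span_induct_alt)
  case (step c x y)
  then obtain b i where x: "x = (D ^^ i) b" "b \<in> complement_basis" "i < p" by auto
  have "D x \<in> K"
  proof (cases "Suc i = p")
    case True
    then have "D x = (D ^^ p) b" unfolding x(1) by auto
    then show ?thesis using D_p[OF basis_C[OF x(2)]] by (simp add: span_zero)
  next
    case False
    then show ?thesis using x by (intro span_base image_eqI[of _ _ "(b, Suc i)"]) auto
  qed
  with step show ?case by (simp add: D_add D_scale span_add span_scale)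
qed (simp add: span_zero)

lemma orbit_homogeneous: "orbit ` indices \<subseteq> (\<Union>i. G i \<inter> K)"
proof
  fix x assume x: "x \<in> orbit ` indices"
  then obtain b i where b: "b \<in> complement_basis" "x = (D ^^ i) b" by auto
  then obtain j where "b \<in> G j" using complement_basis_homogeneous by blast
  then have "x \<in> G (j + 2 * int i)" unfolding b(2) by (rule pow_G)
  with x show "x \<in> (\<Union>i. G i \<inter> K)" by (blast intro: span_base)
qed

lemma K_homogeneous: "K = span (\<Union>i. G i \<inter> K)"
proof
  show "K \<subseteq> span (\<Union>i. G i \<inter> K)" using orbit_homogeneous by (rule span_mono)
  show "span (\<Union>i. G i \<inter> K) \<subseteq> K" by (rule span_minimal) auto
qed

section \<open>The projection to W along K\<close>

definition proj :: "'v \<Rightarrow> 'v" where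
  "proj x = (THE w. w \<in> W \<and> x - w \<in> K)"

lemma proj_eqI:
  assumes "w \<in> W" "x - w \<in> K"
  shows "proj x = w"
  unfolding proj_def
proof (rule the_equality)
  fix w' assume "w' \<in> W \<and> x - w' \<in> K"
  then have "w - w' \<in> W" "(x - w') - (x - w) \<in> K"
    using assms subspace_diff[OF W_subspace] span_diff by blast+
  then have "w - w' = 0" by (intro K_W) simp_all
  then show "w' = w" by simp
qed (use assms in simp)

lemma proj:
  assumes "x \<in> C"
  shows "proj x \<in> W" "x - proj x \<in> K"
proof -
  obtain w where w: "w \<in> W" "x - w \<in> K" using decomposition[OF assms] by blast
  then have "proj x = w" by (rule proj_eqI)
  with w show "proj x \<in> W" "x - proj x \<in> K" by simp_all
qed

lemma proj_W: "x \<in> W \<Longrightarrow> proj x = x"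
  by (rule proj_eqI) (simp_all add: span_zero)

lemma proj_add:
  assumes "x \<in> C" "y \<in> C"
  shows "proj (x + y) = proj x + proj y"
proof (rule proj_eqI)
  show "proj x + proj y \<in> W" using proj(1) assms subspace_add[OF W_subspace] by blast
  have "(x - proj x) + (y - proj y) \<in> K" using proj(2) assms span_add by blast
  then show "x + y - (proj x + proj y) \<in> K" by (simp add: algebra_simps)
qed

lemma proj_scale:
  assumes "x \<in> C"
  shows "proj (s c x) = s c (proj x)"
proof (rule proj_eqI)
  show "s c (proj x) \<in> W" using proj(1) assms subspace_scale[OF W_subspace] by blast
  have "s c (x - proj x) \<in> K" using proj(2) assms span_scale by blast
  then show "s c x - s c (proj x) \<in> K" by (simp add: scale_right_diff_distrib)
qed

lemma proj_D:
  assumes "x \<in> C"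
  shows "proj (D x) = D (proj x)"
proof (rule proj_eqI)
  show "D (proj x) \<in> W" using proj(1) assms D_W by blast
  have "D (x - proj x) \<in> K" using proj(2) assms D_K by blast
  then show "D x - D (proj x) \<in> K" by (simp add: D_diff)
qed

text \<open>Both W and K are graded, so x is the sum of the degree i components of
  \<open>proj x\<close> and \<open>x - proj x\<close>. These lie in W and K, and uniqueness of the
  splitting identifies the first with \<open>proj x\<close>.\<close>

lemma proj_G:
  assumes "x \<in> G i"
  shows "proj x \<in> G i"
proof -
  have x: "x \<in> C" using assms by (blast intro: span_base)
  have W_G: "subspace (G j \<inter> W)" and K_G: "subspace (G j \<inter> K)" for j
    using G_subspace W_subspace by (simp_all add: subspace_inter)
  have "proj x \<in> span (\<Union>i. G i \<inter> W)" using proj(1)[OF x] W_homogeneous by blast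
  then obtain I f where f: "finite I" "\<And>j. f j \<in> G j \<inter> W" "\<And>j. j \<notin> I \<Longrightarrow> f j = 0" "proj x = (\<Sum>j\<in>I. f j)"
    using span_subspaces_decomp[of "\<lambda>j. G j \<inter> W"] W_G by metis
  have "x - proj x \<in> span (\<Union>i. G i \<inter> K)" using proj(2)[OF x] K_homogeneous by blast
  then obtain J g where g: "finite J" "\<And>j. g j \<in> G j \<inter> K" "\<And>j. j \<notin> J \<Longrightarrow> g j = 0" "x - proj x = (\<Sum>j\<in>J. g j)"
    using span_subspaces_decomp[of "\<lambda>j. G j \<inter> K"] K_G by metis
  let ?L = "insert i (I \<union> J)" and ?h = "\<lambda>j. f j + g j - (if j = i then x else 0)"
  have f_sum: "proj x = (\<Sum>j\<in>?L. f j)" unfolding f(4) using f(1,3) g(1) by (intro sum.mono_neutral_left) auto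
  have g_sum: "x - proj x = (\<Sum>j\<in>?L. g j)" unfolding g(4) using f(1) g(1,3) by (intro sum.mono_neutral_left) auto
  have "(\<Sum>j\<in>?L. if j = i then x else 0) = x" using f(1) g(1) by (subst sum.delta) auto
  then have "(\<Sum>j\<in>?L. ?h j) = 0"
    unfolding sum_subtractf sum.distrib f_sum[symmetric] g_sum[symmetric] by simp
  moreover have "\<forall>j\<in>?L. ?h j \<in> G j"
    using f(2) g(2) assms G_subspace subspace_0 by (auto intro!: subspace_diff subspace_add)
  ultimately have "\<forall>j\<in>?L. ?h j = 0" using f(1) g(1) by (intro G_independent) auto
  then have "x - f i = g i" by (auto simp: algebra_simps)
  then have "proj x = f i" using f(2) g(2) by (intro proj_eqI) auto
  with f(2)[of i] show ?thesis by simp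
qed

end

section \<open>Stable isomorphisms\<close>

text \<open>Agreement of \<open>diff M\<close> with D is asked on the span only, so that the algebra
  of (i) may carry the zero map, which coincides with D there.\<close>

lemma (in graded_operator) is_p_complexI:
  assumes M: "scale M = s" and A: "\<And>i. subspace (grade M i)" "\<And>i. grade M i \<subseteq> G i"
    "\<And>i x. x \<in> grade M i \<Longrightarrow> D x \<in> grade M (i + 2)"
    and diff: "\<And>x. x \<in> span (\<Union>i. grade M i) \<Longrightarrow> diff M x = D x"
  shows "is_p_complex p M" and "x \<in> carrier M \<Longrightarrow> (diff M ^^ m) x = (D ^^ m) x"
proof -
  let ?C = "span (\<Union>i. grade M i)"
  have C: "carrier M = ?C" by (simp add: carrier_def M)
  have D_C: "D x \<in> ?C" if "x \<in> ?C" for x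
    using that
  proof (induction rule: span_induct_alt)
    case (step c x y)
    then have "D x \<in> ?C" using A(3) by (blast intro: span_base)
    with step show ?case by (simp add: D_add D_scale span_add span_scale)
  qed (simp add: span_zero)
  have pow_C: "(D ^^ m) x \<in> ?C" if "x \<in> ?C" for x m
    using that by (induction m) (simp_all add: D_C)
  have pow: "(diff M ^^ m) x = (D ^^ m) x" if "x \<in> ?C" for x m
    by (induction m) (simp_all add: diff pow_C that)
  then show "x \<in> carrier M \<Longrightarrow> (diff M ^^ m) x = (D ^^ m) x" by (simp add: C)
  have "?C \<subseteq> span (\<Union>i. G i)" using A(2) by (intro span_mono) blast
  then have "(diff M ^^ p) x = 0" if "x \<in> ?C" for x using that pow D_p by auto
  moreover have "vector_space s" by unfold_locales
  moreover have "diff M ` grade M i \<subseteq> grade M (i + 2)" for i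
  proof (rule image_subsetI)
    fix x assume "x \<in> grade M i"
    moreover from this have "x \<in> ?C" by (blast intro: span_base)
    ultimately show "diff M x \<in> grade M (i + 2)" using A(3) diff by simp
  qed
  moreover have "\<forall>i\<in>I. f i = 0"
    if "finite I" "\<forall>i\<in>I. f i \<in> grade M i" "(\<Sum>i\<in>I. f i) = 0" for I f
    using that A(2) by (intro G_independent) auto
  moreover have "linear_on_carrier M M (diff M)"
    by (simp add: linear_on_carrier_def C M diff span_add span_scale D_add D_scale)
  ultimately show "is_p_complex p M"
    unfolding is_p_complex_def C M using A(1) by blast
qed

section \<open>Moving free complexes to the type fixed in \<open>stably_zero\<close>\<close>

lemma vector_space_mpoly_scale:
  "vector_space (\<lambda>c. Poly_Mapping.map ((*) c) :: ('x \<Rightarrow>\<^sub>0 'k::field) \<Rightarrow> _)"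
proof -
  have lookup: "Poly_Mapping.lookup (Poly_Mapping.map ((*) c) f) x = c * Poly_Mapping.lookup f x"
    for c and f :: "'x \<Rightarrow>\<^sub>0 'k" and x
    by (simp add: Poly_Mapping.map.rep_eq when_def)
  show ?thesis
    by unfold_locales (rule poly_mapping_eqI, simp add: lookup lookup_add algebra_simps)+
qed

text \<open>Coordinates with respect to a basis of the whole ambient space, stored at second index
  0. The target is the type that \<open>stably_zero\<close> prescribes for its intermediate
  object.\<close>

lemma linear_injection_exists:
  fixes s :: "'k::field \<Rightarrow> 'v::ab_group_add \<Rightarrow> 'v"
  assumes "vector_space s"
  obtains j :: "'v \<Rightarrow> ('v \<times> nat) \<Rightarrow>\<^sub>0 'k"
  where "Vector_Spaces.linear s (\<lambda>c. Poly_Mapping.map ((*) c)) j" "inj j"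
proof -
  interpret vector_space s by fact
  let ?B = "extend_basis {}"
  have B: "independent ?B" "span ?B = UNIV" using independent_empty
    by (simp_all add: independent_extend_basis)
  let ?r = "\<lambda>x (b, i). if i = (0::nat) then representation ?B x b else 0"
  define j where "j x = Abs_poly_mapping (?r x)" for x
  have lookup_j: "Poly_Mapping.lookup (j x) = ?r x" for x
  proof -
    have "{y. ?r x y \<noteq> 0} \<subseteq> {b. representation ?B x b \<noteq> 0} \<times> {0}" by (auto split: if_splits)
    then have "finite {y. ?r x y \<noteq> 0}"
      by (rule finite_subset) (simp add: finite_representation)
    then show ?thesis unfolding j_def by (rule lookup_Abs_poly_mapping)
  qed
  interpret V: vector_space "\<lambda>c. Poly_Mapping.map ((*) c) :: (('v \<times> nat) \<Rightarrow>\<^sub>0 'k) \<Rightarrow> _"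
    by (rule vector_space_mpoly_scale)
  have lookup_map: "Poly_Mapping.lookup (Poly_Mapping.map ((*) c) f) x = c * Poly_Mapping.lookup f x"
    for c and f :: "('v \<times> nat) \<Rightarrow>\<^sub>0 'k" and x
    by (simp add: Poly_Mapping.map.rep_eq when_def)
  have "Vector_Spaces.linear s (\<lambda>c. Poly_Mapping.map ((*) c)) j"
    by unfold_locales
      (rule poly_mapping_eqI, simp add: lookup_j lookup_add lookup_map B representation_add representation_scale
        split: prod.split)+
  moreover have "inj j"
  proof (rule injI)
    fix x y assume "j x = j y"
    then have "?r x (b, 0) = ?r y (b, 0)" for b by (metis lookup_j)
    then have eq: "representation ?B x = representation ?B y" by auto
    have sum: "(\<Sum>b | representation ?B z b \<noteq> 0. s (representation ?B z b) b) = z" for z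
      using B by (intro sum_nonzero_representation_eq) simp_all
    have "x = (\<Sum>b | representation ?B x b \<noteq> 0. s (representation ?B x b) b)" by (rule sum[symmetric])
    also have "\<dots> = y" unfolding eq by (rule sum)
    finally show "x = y" .
  qed
  ultimately show ?thesis by (rule that)
qed

text \<open>The differential is conjugated by \<open>j\<close>; \<open>inv j\<close> is meaningful
  on the range of \<open>j\<close>, which contains the new carrier. Injectivity sends orbit bases to
  orbit bases.\<close>

lemma transport:
  fixes N :: "('k::field, 'v::ab_group_add) p_complex" and j :: "'v \<Rightarrow> 'w::ab_group_add"
  assumes N: "is_p_complex p N" "graded_free p N" and j: "Vector_Spaces.linear (scale N) t j" "inj j"
  defines "P \<equiv> \<lparr>scale = t, grade = \<lambda>i. j ` grade N i, diff = \<lambda>y. j (diff N (inv j y))\<rparr>"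
  shows "is_p_complex p P" "graded_free p P" "carrier P = j ` carrier N"
proof -
  interpret j: Vector_Spaces.linear "scale N" t j by fact
  have inv [simp]: "inv j (j x) = x" for x using j(2) by (rule inv_f_f)
  have P [simp]: "scale P = t" "grade P i = j ` grade N i" "diff P (j x) = j (diff N x)" for i x
    by (simp_all add: P_def)
  have carrier: "carrier P = j ` carrier N"
    by (simp add: carrier_def j.span_image[symmetric] image_UN)
  have pow: "(diff P ^^ m) (j x) = j ((diff N ^^ m) x)" for m x
    by (induction m) simp_all
  have zero: "j x = 0 \<longleftrightarrow> x = 0" for x using j(2) j.zero by (metis injD)
  show "carrier P = j ` carrier N" by (rule carrier)
  show "is_p_complex p P"
    unfolding is_p_complex_def
  proof (intro conjI allI impI)
    show "vector_space (scale P)" using j.vs2.vector_space_axioms by simp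
    show "module.subspace (scale P) (grade P i)" for i
      using N(1) by (simp add: is_p_complex_def j.subspace_image)
    show "\<forall>i\<in>I. y i = 0" if "finite I" "\<forall>i\<in>I. y i \<in> grade P i" "(\<Sum>i\<in>I. y i) = 0" for I y
    proof -
      have "\<forall>i\<in>I. \<exists>x. x \<in> grade N i \<and> y i = j x" using that(2) by auto
      then obtain x where x: "\<forall>i\<in>I. x i \<in> grade N i \<and> y i = j (x i)" by metis
      then have "j (\<Sum>i\<in>I. x i) = 0" using that(3) by (simp add: j.sum)
      then have "(\<Sum>i\<in>I. x i) = 0" by (simp add: zero)
      then have "\<forall>i\<in>I. x i = 0" using N(1) that(1) x unfolding is_p_complex_def by blast
      then show ?thesis using x by (simp add: zero)
    qed
    show "linear_on_carrier P P (diff P)"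
      using N(1) by (simp add: is_p_complex_def linear_on_carrier_def carrier j.add[symmetric] j.scale[symmetric])
    show "diff P ` grade P i \<subseteq> grade P (i + 2)" for i
    proof -
      have "diff N ` grade N i \<subseteq> grade N (i + 2)" using N(1) by (simp add: is_p_complex_def)
      then show ?thesis by auto
    qed
    show "\<forall>x\<in>carrier P. (diff P ^^ p) x = 0"
      using N(1) by (simp add: is_p_complex_def carrier pow zero)
  qed
  obtain B where B: "B \<subseteq> (\<Union>i. grade N i)" "inj_on (\<lambda>(b, i). (diff N ^^ i) b) (B \<times> {..<p})"
    "\<not> module.dependent (scale N) ((\<lambda>(b, i). (diff N ^^ i) b) ` (B \<times> {..<p}))"
    "module.span (scale N) ((\<lambda>(b, i). (diff N ^^ i) b) ` (B \<times> {..<p})) = carrier N"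
    using N(2) unfolding graded_free_def Let_def by blast
  let ?E = "\<lambda>(b, i). (diff N ^^ i) b" and ?E' = "\<lambda>(b, i). (diff P ^^ i) b"
  have E': "?E' (map_prod j id x) = j (?E x)" for x by (cases x) (simp add: pow)
  have indices: "j ` B \<times> {..<p} = map_prod j id ` (B \<times> {..<p})"
    by force
  have image: "?E' ` (j ` B \<times> {..<p}) = j ` ?E ` (B \<times> {..<p})"
    unfolding indices image_image E' ..
  have "inj_on (\<lambda>x. ?E' (map_prod j id x)) (B \<times> {..<p})"
    unfolding E' using B(2) j(2) by (simp add: inj_on_def inj_def)
  then have "inj_on ?E' (j ` B \<times> {..<p})"
    unfolding indices by (auto simp: inj_on_def)
  moreover have "\<not> module.dependent t (j ` ?E ` (B \<times> {..<p}))"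
    using B(3) inj_on_subset[OF j(2) subset_UNIV] by (rule j.independent_injective_image)
  moreover have "module.span t (j ` ?E ` (B \<times> {..<p})) = carrier P"
    unfolding j.span_image B(4) carrier ..
  moreover have "j ` B \<subseteq> (\<Union>i. grade P i)"
    using image_mono[OF B(1), of j] by (simp add: image_UN)
  ultimately show "graded_free p P"
    unfolding graded_free_def Let_def image[symmetric] P(1) by blast
qed

text \<open>The intermediate free complex may live on the type of \<open>N\<close>:
  \<open>linear_injection_exists\<close> and \<open>transport\<close> carry it to the prescribed
  type, and the two maps are composed with \<open>j\<close> and its inverse.\<close>

lemma stably_zeroI:
  fixes N Q :: "('k::field, 'w::ab_group_add) p_complex"
  assumes Q: "is_p_complex p Q" "graded_free p Q"
    and u: "p_complex_hom M Q u" and w: "p_complex_hom Q N w" and f: "\<And>x. x \<in> carrier M \<Longrightarrow> f x = w (u x)"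
  shows "stably_zero p M N f"
proof -
  have "vector_space (scale Q)" using Q(1) by (simp add: is_p_complex_def)
  then obtain j :: "'w \<Rightarrow> ('w \<times> nat) \<Rightarrow>\<^sub>0 'k"
    where j: "Vector_Spaces.linear (scale Q) (\<lambda>c. Poly_Mapping.map ((*) c)) j" "inj j"
    by (rule linear_injection_exists)
  define P where "P = \<lparr>scale = \<lambda>c. Poly_Mapping.map ((*) c), grade = \<lambda>i. j ` grade Q i,
    diff = \<lambda>y. j (diff Q (inv j y))\<rparr>"
  note P_free = transport[OF Q j, folded P_def]
  interpret j: Vector_Spaces.linear "scale Q" "\<lambda>c. Poly_Mapping.map ((*) c)" j by fact
  have inv [simp]: "inv j (j x) = x" for x using j(2) by (rule inv_f_f)
  have P: "scale P = (\<lambda>c. Poly_Mapping.map ((*) c))" "grade P i = j ` grade Q i" "diff P (j x) = j (diff Q x)" for i x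
    by (simp_all add: P_def)
  have "p_complex_hom M P (\<lambda>x. j (u x))"
    using u by (simp add: p_complex_hom_def linear_on_carrier_def P j.add j.scale image_subset_iff)
  moreover have "p_complex_hom P N (\<lambda>y. w (inv j y))"
    using w by (simp add: p_complex_hom_def linear_on_carrier_def P P_free(3) image_subset_iff
        j.add[symmetric] j.scale[symmetric])
  moreover have "\<forall>x\<in>carrier M. f x = w (inv j (j (u x)))" using f by simp
  ultimately show ?thesis unfolding stably_zero_def using P_free(1,2) by blast
qed

section \<open>Inclusion of W and projection as stable inverses\<close>

context exact_pair
begin

text \<open>Stated for any complex that agrees with D on K, so that it serves both for the
  complement and, when W is zero and K is everything, for \<open>M\<close> itself. The free
  generators are \<open>complement_basis\<close>.\<close>

lemma complement_free:
  assumes Q: "scale Q = s" "\<And>i. grade Q i = G i \<inter> K" "\<And>x. x \<in> K \<Longrightarrow> diff Q x = D x"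
  shows "is_p_complex p Q" "graded_free p Q" "carrier Q = K"
proof -
  have K: "span (\<Union>i. grade Q i) = K" using K_homogeneous Q(2) by simp
  show carrier: "carrier Q = K" by (simp add: carrier_def Q(1) K)
  have sub: "subspace (grade Q i)" "grade Q i \<subseteq> G i" for i
    by (simp_all add: Q(2) G_subspace subspace_inter)
  have D: "D x \<in> grade Q (i + 2)" if "x \<in> grade Q i" for i x
    using that D_G D_K by (simp add: Q(2))
  have diff: "diff Q x = D x" if "x \<in> span (\<Union>i. grade Q i)" for x using that Q(3) K by simp
  show "is_p_complex p Q" by (rule is_p_complexI[OF Q(1) sub D diff])
  have pow: "(diff Q ^^ m) x = (D ^^ m) x" if "x \<in> K" for x m
    by (rule is_p_complexI(2)[OF Q(1) sub D diff]) (simp_all add: carrier that)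
  have B_K: "b \<in> K" if "b \<in> complement_basis" for b
    using that p by (intro span_base image_eqI[of _ _ "(b, 0)"]) auto
  let ?E = "\<lambda>(b, i). (diff Q ^^ i) b"
  have E: "?E x = orbit x" if "x \<in> indices" for x using that pow B_K by auto
  have image: "?E ` indices = orbit ` indices" using E by (rule image_cong[OF refl])
  show "graded_free p Q"
    unfolding graded_free_def Let_def
  proof (intro exI[of _ complement_basis] conjI)
    show "complement_basis \<subseteq> (\<Union>i. grade Q i)"
      unfolding Q(2) using complement_basis_homogeneous B_K by blast
    show "inj_on ?E indices" by (rule iffD2[OF inj_on_cong[OF E] orbit_inj])
    show "\<not> module.dependent (scale Q) (?E ` indices)"
      unfolding image Q(1) by (rule orbit_independent)
    show "module.span (scale Q) (?E ` indices) = carrier Q"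
      unfolding image Q(1) carrier ..
  qed
qed

context
  fixes M N :: "('k, 'v) p_complex"
  assumes M: "scale M = s" "grade M = G" "\<And>x. x \<in> C \<Longrightarrow> diff M x = D x"
    and N: "scale N = s" "\<And>i. grade N i = G i \<inter> W" "\<And>x. x \<in> W \<Longrightarrow> diff N x = D x"
begin

lemma carriers: "carrier M = C" "carrier N = W"
  using W_homogeneous by (simp_all add: carrier_def M N)

lemma p_complexes: "is_p_complex p M" "is_p_complex p N"
proof -
  show "is_p_complex p M"
    by (rule is_p_complexI) (simp_all add: M G_subspace D_G)
  have W: "span (\<Union>i. grade N i) = W" using W_homogeneous N(2) by simp
  show "is_p_complex p N"
  proof (rule is_p_complexI(1)[OF N(1)])
    show "diff N x = D x" if "x \<in> span (\<Union>i. grade N i)" for x using that N(3) W by simp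
  qed (simp_all add: N(2) G_subspace W_subspace subspace_inter D_G D_W)
qed

lemma inclusion_hom: "p_complex_hom N M (\<lambda>x. x)"
  using W_C by (auto simp: p_complex_hom_def linear_on_carrier_def carriers M N)

lemma proj_hom: "p_complex_hom M N proj"
  using proj_G proj(1)[OF span_base]
  by (auto simp: p_complex_hom_def linear_on_carrier_def carriers M N proj_add proj_scale proj_D proj(1))

text \<open>On W the projection is the identity, so one difference is zero and factors through the
  zero complex, free on no generators. The other, \<open>proj x - x\<close>, takes values in the
  free complement K and factors through it.\<close>

lemma stable_inverses: "stably_inverse p N M (\<lambda>x. x) proj" "stably_inverse p M N proj (\<lambda>x. x)"
proof -
  let ?Z = "\<lparr>scale = s, grade = \<lambda>_. {0}, diff = \<lambda>_. 0\<rparr> :: ('k, 'v) p_complex"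
  have Z_carrier: "carrier ?Z = {0}" by (simp add: carrier_def)
  have "is_p_complex p ?Z"
    by (rule is_p_complexI) (simp_all add: subspace_0[OF G_subspace])
  moreover have "graded_free p ?Z"
    unfolding graded_free_def Let_def by (intro exI[of _ "{}"]) (simp add: Z_carrier independent_empty)
  moreover have "p_complex_hom N ?Z (\<lambda>_. 0)"
    by (auto simp: p_complex_hom_def linear_on_carrier_def)
  moreover have "p_complex_hom ?Z N (\<lambda>x. x)"
    using subspace_0[OF G_subspace] subspace_0[OF W_subspace]
    by (simp add: p_complex_hom_def linear_on_carrier_def Z_carrier N)
  ultimately have N0: "stably_zero p N N (\<lambda>x. proj x - x)"
    by (rule stably_zeroI) (simp add: carriers proj_W)
  let ?Q = "\<lparr>scale = s, grade = \<lambda>i. G i \<inter> K, diff = D\<rparr> :: ('k, 'v) p_complex"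
  have Q: "is_p_complex p ?Q" "graded_free p ?Q" "carrier ?Q = K"
    by (rule complement_free; simp)+
  have proj_K: "proj x - x \<in> K" if "x \<in> C" for x
    using span_neg[OF proj(2)[OF that]] by simp
  have "p_complex_hom M ?Q (\<lambda>x. proj x - x)"
    unfolding p_complex_hom_def linear_on_carrier_def carriers
  proof (intro conjI ballI allI)
    show "(\<lambda>x. proj x - x) ` grade M i \<subseteq> grade ?Q i" for i
    proof (rule image_subsetI)
      fix x assume "x \<in> grade M i"
      then have x: "x \<in> G i" "x \<in> C" by (simp_all add: M(2), blast intro: span_base)
      then have "proj x - x \<in> G i" using proj_G by (intro subspace_diff[OF G_subspace]) simp_all
      with proj_K[OF x(2)] show "proj x - x \<in> grade ?Q i" by simp
    qed
  qed (simp_all add: M proj_add proj_scale proj_D D_diff scale_right_diff_distrib)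
  moreover have "p_complex_hom ?Q M (\<lambda>x. x)"
    using K_C by (auto simp: p_complex_hom_def linear_on_carrier_def Q(3) M)
  ultimately have M0: "stably_zero p M M (\<lambda>x. proj x - x)"
    by (rule stably_zeroI[OF Q(1,2)]) simp
  show "stably_inverse p N M (\<lambda>x. x) proj" "stably_inverse p M N proj (\<lambda>x. x)"
    using N0 M0 by (simp_all add: stably_inverse_def)
qed

theorem quasi_isos: "quasi_iso p N M (\<lambda>x. x)" "quasi_iso p M N proj"
  unfolding quasi_iso_def using p_complexes inclusion_hom proj_hom stable_inverses by blast+

theorem acyclic:
  assumes "W = {0}"
  shows "p_acyclic p M"
proof -
  have "x \<in> K" if "x \<in> C" for x using proj[OF that] assms by simp
  then have K: "K = C" using K_C by blast
  have GC: "G i \<subseteq> C" for i by (blast intro: span_base)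
  have "graded_free p M"
  proof (rule complement_free)
    show "scale M = s" by (rule M(1))
    show "grade M i = G i \<inter> K" for i using GC[of i] by (auto simp: M(2) K)
    show "diff M x = D x" if "x \<in> K" for x using that M(3) K by simp
  qed
  then show ?thesis unfolding p_acyclic_def using p_complexes(1) by blast
qed

end

end

section \<open>The complexes of symmetric polynomials\<close>

interpretation const_mult: vector_space "const_mult :: 'k::field \<Rightarrow> 'k mpoly \<Rightarrow> 'k mpoly"
  by unfold_locales
    (simp_all add: const_mult_def algebra_simps single_add mult_single mult.assoc[symmetric])

lemma const_mult_subst: "const_mult c (subst e F) = subst e (Poly_Mapping.single 0 c * F)"
  by (simp add: const_mult_def subst_mult)

text \<open>Zero lies in every degree, including the negative and odd ones, and is therefore listed
  separately.\<close>

lemma grade_Sym_iff: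
  "f \<in> grade (Sym n) d \<longleftrightarrow> f \<in> symmetric_polys n \<and> (f = 0 \<or> (\<exists>e. d = 2 * int e \<and> homogeneous e f))"
proof (cases "f = 0")
  case True
  then show ?thesis by (simp add: Sym_def)
next
  case False
  then obtain m where m: "m \<in> Poly_Mapping.keys f" by (metis poly_mapping_eqI lookup_zero in_keys_iff)
  have "(\<forall>m\<in>Poly_Mapping.keys f. 2 * int (monom_degree m) = d) \<longleftrightarrow> (\<exists>e. d = 2 * int e \<and> homogeneous e f)"
  proof
    assume degree: "\<forall>m\<in>Poly_Mapping.keys f. 2 * int (monom_degree m) = d"
    then have d: "2 * int (monom_degree m) = d" using m by blast
    have "monom_degree m' = monom_degree m" if "m' \<in> Poly_Mapping.keys f" for m'
    proof -
      have "2 * int (monom_degree m') = d" using degree that by blast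
      with d show ?thesis by linarith
    qed
    with d show "\<exists>e. d = 2 * int e \<and> homogeneous e f"
      unfolding homogeneous_def by (intro exI[of _ "monom_degree m"]) simp
  qed (auto simp: homogeneous_def)
  with False show ?thesis by (simp add: Sym_def)
qed

lemma grade_Sym_subspace: "const_mult.subspace (grade (Sym n) d)"
proof (rule const_mult.subspaceI)
  show "0 \<in> grade (Sym n) d" using symmetric_polys_const[of 0 n] by (simp add: grade_Sym_iff)
  show "f + g \<in> grade (Sym n) d" if "f \<in> grade (Sym n) d" "g \<in> grade (Sym n) d" for f g
    using that by (auto simp: grade_Sym_iff symmetric_polys_add homogeneous_add)
  show "const_mult c f \<in> grade (Sym n) d" if "f \<in> grade (Sym n) d" for c f
    using that homogeneous_mult[OF homogeneous_const[of c], of _ f]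
    by (auto simp: grade_Sym_iff const_mult_def symmetric_polys_mult symmetric_polys_const)
qed

text \<open>A monomial has one degree, so it occurs in at most one summand. The shift
  \<open>\<sigma>\<close> stands for the degree of the generator: 0 for \<open>Sym n\<close>, and
  n(1-n)/2 for the rank-one modules.\<close>

lemma grade_Sym_independent:
  fixes f :: "int \<Rightarrow> 'k::field mpoly"
  assumes I: "finite I" "\<forall>i\<in>I. f i \<in> grade (Sym n) (i - \<sigma>)" "(\<Sum>i\<in>I. f i) = 0"
  shows "\<forall>i\<in>I. f i = 0"
proof
  fix i assume i: "i \<in> I"
  show "f i = 0"
  proof (rule poly_mapping_eqI)
    fix m
    show "Poly_Mapping.lookup (f i) m = Poly_Mapping.lookup 0 m"
    proof (cases "m \<in> Poly_Mapping.keys (f i)")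
      case True
      have degree: "2 * int (monom_degree m) = j - \<sigma>" if "j \<in> I" "m \<in> Poly_Mapping.keys (f j)" for j
        using I(2) that by (auto simp: Sym_def)
      have others: "Poly_Mapping.lookup (f j) m = 0" if "j \<in> I - {i}" for j
        using degree[OF i True] degree[of j] that by (auto simp: in_keys_iff)
      have "Poly_Mapping.lookup (\<Sum>i\<in>I. f i) m = (\<Sum>i\<in>I. Poly_Mapping.lookup (f i) m)"
        by (rule lookup_sum)
      also have "\<dots> = Poly_Mapping.lookup (f i) m + (\<Sum>j\<in>I - {i}. Poly_Mapping.lookup (f j) m)"
        by (rule sum.remove[OF I(1) i])
      also have "(\<Sum>j\<in>I - {i}. Poly_Mapping.lookup (f j) m) = 0" by (rule sum.neutral) (use others in blast)
      finally show ?thesis using I(3) by simp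
    qed (simp add: in_keys_iff)
  qed
qed

lemma grade_Sym_subst:
  assumes "m \<in> exponents n"
  shows "subst (elem_sym n) (Poly_Mapping.single m c) \<in> grade (Sym n) (2 * int (weight m))"
  unfolding grade_Sym_iff using assms
  by (auto intro!: symmetric_polys_subst homogeneous_subst supported_single split: if_splits)

text \<open>Monomials in the e_j are homogeneous, so a subspace spanned by some of them is graded;
  this provides \<open>W_homogeneous\<close> of the locale \<open>exact_pair\<close>.\<close>

lemma span_grade_supported:
  assumes "T \<subseteq> exponents n"
  shows "(subst (elem_sym n) ` supported T :: 'k::field mpoly set)
    = const_mult.span (\<Union>i. grade (Sym n) (i - \<sigma>) \<inter> subst (elem_sym n) ` supported T)"
proof
  show "(subst (elem_sym n) ` supported T :: 'k mpoly set)
    \<subseteq> const_mult.span (\<Union>i. grade (Sym n) (i - \<sigma>) \<inter> subst (elem_sym n) ` supported T)"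
  proof (rule image_subsetI)
    fix F :: "'k mpoly" assume "F \<in> supported T"
    then show "subst (elem_sym n) F
      \<in> const_mult.span (\<Union>i. grade (Sym n) (i - \<sigma>) \<inter> subst (elem_sym n) ` supported T)"
    proof (induction F rule: supported_induct)
      case (single m c)
      then have "subst (elem_sym n) (Poly_Mapping.single m c)
          \<in> grade (Sym n) ((2 * int (weight m) + \<sigma>) - \<sigma>) \<inter> subst (elem_sym n) ` supported T"
        using assms grade_Sym_subst[of m n c] by (auto intro!: imageI supported_single)
      then show ?case by (intro const_mult.span_base UN_I[of "2 * int (weight m) + \<sigma>"]) simp_all
    qed (simp_all add: subst_add const_mult.span_add const_mult.span_zero)
  qed
  have "const_mult.subspace (subst (elem_sym n) ` supported T :: 'k mpoly set)"
  proof (rule const_mult.subspaceI)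
    show "(0 :: 'k mpoly) \<in> subst (elem_sym n) ` supported T" by (rule image_eqI[of _ _ 0]) simp_all
    show "f + g \<in> subst (elem_sym n) ` supported T"
      if "f \<in> subst (elem_sym n) ` supported T" "g \<in> subst (elem_sym n) ` supported T" for f g :: "'k mpoly"
      using that by (auto simp: subst_add[symmetric] intro!: imageI supported_add)
    show "const_mult c f \<in> subst (elem_sym n) ` supported T" if "f \<in> subst (elem_sym n) ` supported T"
      for c and f :: "'k mpoly"
      using that by (auto simp: const_mult_subst intro!: imageI supported_const_mult)
  qed
  then show "const_mult.span (\<Union>i. grade (Sym n) (i - \<sigma>) \<inter> subst (elem_sym n) ` supported T)
      \<subseteq> (subst (elem_sym n) ` supported T :: 'k mpoly set)"
    by (intro const_mult.span_minimal) auto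
qed

lemma span_grade_Sym:
  "const_mult.span (\<Union>i. grade (Sym n) (i - \<sigma>)) = (subst (elem_sym n) ` polys n :: 'k::field mpoly set)"
proof -
  have "grade (Sym n) i \<subseteq> (subst (elem_sym n) ` polys n :: 'k mpoly set)" for i
  proof
    fix f :: "'k mpoly" assume f: "f \<in> grade (Sym n) i"
    show "f \<in> subst (elem_sym n) ` polys n"
    proof (cases "f = 0")
      case True
      then show ?thesis by (intro image_eqI[of _ _ 0]) simp_all
    next
      case False
      then obtain e where e: "f \<in> symmetric_polys n" "homogeneous e f"
        using f unfolding grade_Sym_iff by blast
      from e obtain F where "F \<in> polys n" "subst (elem_sym n) F = f"
        by (rule symmetric_polys_generated)
      then show ?thesis by blast
    qed
  qed
  then have eq: "grade (Sym n) (i - \<sigma>) \<inter> subst (elem_sym n) ` polys n = (grade (Sym n) (i - \<sigma>) :: 'k mpoly set)" for i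
    by blast
  show ?thesis using span_grade_supported[OF order_refl, of n \<sigma>, where 'k = 'k] unfolding eq by (rule sym)
qed

lemma grade_Sym_mult:
  assumes "f \<in> grade (Sym n) i" "g \<in> grade (Sym n) j"
  shows "f * g \<in> grade (Sym n) (i + j)"
proof (cases "f = 0 \<or> g = 0")
  case True
  then show ?thesis using symmetric_polys_const[of 0 n] by (auto simp: grade_Sym_iff)
next
  case False
  then obtain d e where "i = 2 * int d" "homogeneous d f" "j = 2 * int e" "homogeneous e g"
    using assms unfolding grade_Sym_iff by blast
  moreover from this have "homogeneous (d + e) (f * g)" by (intro homogeneous_mult)
  moreover have "f * g \<in> symmetric_polys n"
    using assms by (intro symmetric_polys_mult) (simp_all add: grade_Sym_iff)
  ultimately show ?thesis unfolding grade_Sym_iff by (intro conjI disjI2 exI[of _ "d + e"]) simp_all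
qed

lemma grade_Sym_twisted_deriv:
  assumes "f \<in> grade (Sym n) i"
  shows "twisted_deriv n a f \<in> grade (Sym n) (i + 2)"
proof -
  have "deriv f \<in> grade (Sym n) (i + 2)"
  proof (cases "f = 0")
    case False
    then obtain e where "i = 2 * int e" "homogeneous e f" using assms unfolding grade_Sym_iff by blast
    then show ?thesis using assms unfolding grade_Sym_iff
      by (intro conjI disjI2 exI[of _ "Suc e"]) (simp_all add: symmetric_polys_deriv homogeneous_deriv)
  qed (use assms in \<open>simp add: grade_Sym_iff\<close>)
  moreover have "of_int a * f * elem_sym n 1 \<in> grade (Sym n) (i + 2)"
  proof -
    have "elem_sym n 1 \<in> grade (Sym n) 2"
      unfolding grade_Sym_iff using symmetric_polys_elem_sym homogeneous_elem_sym[of 1 n]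
      by (intro conjI disjI2 exI[of _ 1]) simp_all
    then have "const_mult (of_int a) (f * elem_sym n 1) \<in> grade (Sym n) (i + 2)"
      using grade_Sym_mult[OF assms] const_mult.subspace_scale[OF grade_Sym_subspace] by blast
    then show ?thesis by (simp add: const_mult_def mult.assoc)
  qed
  ultimately show ?thesis
    unfolding twisted_deriv_def by (rule const_mult.subspace_add[OF grade_Sym_subspace])
qed

text \<open>Evaluation at the e_j intertwines the differentials and is injective on
  \<open>polys n\<close>, so stability and exactness modulo \<open>supported T\<close> pass from the
  model to its image.\<close>

lemma exact_pair_Sym:
  fixes T :: "(nat \<Rightarrow>\<^sub>0 nat) set"
  assumes char: "CHAR('k::field) = p" "p > 0" and T: "T \<subseteq> exponents n"
    and stable: "\<And>F. F \<in> supported T \<Longrightarrow> diffop n a F \<in> (supported T :: 'k mpoly set)"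
    and exact: "exact_modulo p (diffop n a :: 'k mpoly \<Rightarrow> _) (polys n) (supported T)"
  shows "exact_pair (const_mult :: 'k \<Rightarrow> _) (\<lambda>i. grade (Sym n) (i - \<sigma>)) (twisted_deriv n a) p
    (subst (elem_sym n) ` supported T)"
proof unfold_locales
  let ?\<Phi> = "subst (elem_sym n) :: 'k mpoly \<Rightarrow> _"
  show "p > 0" by (rule char(2))
  show "const_mult.subspace (grade (Sym n) (i - \<sigma>) :: 'k mpoly set)" for i by (rule grade_Sym_subspace)
  show "\<forall>i\<in>I. f i = 0" if "finite I" "\<forall>i\<in>I. f i \<in> grade (Sym n) (i - \<sigma>)" "(\<Sum>i\<in>I. f i) = 0"
    for I and f :: "int \<Rightarrow> 'k mpoly"
    using that by (rule grade_Sym_independent)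
  show "twisted_deriv n a (f + g) = twisted_deriv n a f + twisted_deriv n a g" for f g :: "'k mpoly"
    by (simp add: twisted_deriv_def deriv_add algebra_simps)
  show "twisted_deriv n a (const_mult c f) = const_mult c (twisted_deriv n a f)" for c and f :: "'k mpoly"
    by (simp add: twisted_deriv_def deriv_const_mult) (simp add: const_mult_def algebra_simps)
  show "twisted_deriv n a f \<in> grade (Sym n) (i + 2 - \<sigma>)" if "f \<in> grade (Sym n) (i - \<sigma>)"
    for i and f :: "'k mpoly"
    using grade_Sym_twisted_deriv[OF that] by (simp add: algebra_simps)
  show "(twisted_deriv n a ^^ p) f = 0" for f :: "'k mpoly"
    by (rule twisted_deriv_power_char[OF char])
  show "?\<Phi> ` supported T = const_mult.span (\<Union>i. grade (Sym n) (i - \<sigma>) \<inter> ?\<Phi> ` supported T)"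
    by (rule span_grade_supported[OF T])
  show "twisted_deriv n a f \<in> ?\<Phi> ` supported T" if "f \<in> ?\<Phi> ` supported T" for f
    using that stable by (auto simp: subst_diffop[symmetric])
  show "exact_modulo p (twisted_deriv n a) (const_mult.span (\<Union>i. grade (Sym n) (i - \<sigma>))) (?\<Phi> ` supported T)"
    unfolding span_grade_Sym exact_modulo_def
  proof (intro ballI impI)
    fix f assume "f \<in> ?\<Phi> ` polys n" and "twisted_deriv n a f \<in> ?\<Phi> ` supported T"
    then obtain F H where F: "F \<in> polys n" "f = ?\<Phi> F" and H: "H \<in> supported T" "?\<Phi> (diffop n a F) = ?\<Phi> H"
      by (auto simp: subst_diffop)
    have "diffop n a F - H = 0"
    proof (rule elem_sym_algebraically_independent)
      show "diffop n a F - H \<in> polys n"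
        using F(1) H(1) supported_mono[OF T] by (blast intro: supported_diff diffop_polys)
      show "?\<Phi> (diffop n a F - H) = 0" using H(2) by (simp add: subst_diff)
    qed
    then have "diffop n a F \<in> supported T" using H(1) by simp
    with F(1) obtain G where G: "G \<in> polys n" "F - (diffop n a ^^ (p - 1)) G \<in> supported T"
      by (rule exact_moduloE[OF exact])
    have "f - (twisted_deriv n a ^^ (p - 1)) (?\<Phi> G) = ?\<Phi> (F - (diffop n a ^^ (p - 1)) G)"
      by (simp add: F(2) subst_diff subst_diffop_power)
    with G show "\<exists>g\<in>?\<Phi> ` polys n. f - (twisted_deriv n a ^^ (p - 1)) g \<in> ?\<Phi> ` supported T" by auto
  qed
qed

lemma Sym_simps: "scale (Sym n) = const_mult" "diff (Sym n) = twisted_deriv n 0"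
  by (auto simp: Sym_def twisted_deriv_def)

lemma rank_one_simps: "scale (rank_one n a) = const_mult"
  "grade (rank_one n a) = (\<lambda>d. grade (Sym n) (d - int n * (1 - int n) div 2))"
  "diff (rank_one n a) = twisted_deriv n a"
  by (auto simp: rank_one_def twisted_deriv_def)

section \<open>The spaces of the theorem in terms of exponents\<close>

lemma elem_power_algebra_eq:
  fixes p n k :: nat
  shows "elem_power_algebra p n k = subst (elem_sym n) ` (supported (power_exponents p k) :: 'k::field mpoly set)"
proof
  let ?\<Phi> = "subst (elem_sym n) :: 'k mpoly \<Rightarrow> _" and ?P = "supported (power_exponents p k) :: 'k mpoly set"
  let ?A = "elem_power_algebra p n k :: 'k mpoly set"
  show "?A \<subseteq> ?\<Phi> ` ?P"
  proof
    fix f assume "f \<in> ?A"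
    then show "f \<in> ?\<Phi> ` ?P"
      unfolding elem_power_algebra_def
    proof induction
      case (const c)
      show ?case
        by (rule image_eqI[of _ _ "Poly_Mapping.single 0 c"]) (simp_all add: supported_single power_exponents_0)
    next
      case (gen f)
      then obtain j where j: "j \<in> {1..k}" "f = elem_sym n (j * p) ^ p" by blast
      have "Poly_Mapping.single (j * p) p \<in> power_exponents p k"
        using j(1) by (auto simp: power_exponents_def lookup_single when_def)
      then have "Var (j * p) ^ p \<in> ?P" by (simp add: Var_power supported_single)
      moreover have "f = ?\<Phi> (Var (j * p) ^ p)" by (simp add: j(2) subst_power)
      ultimately show ?case by blast
    next
      case (add f g)
      then show ?case by (auto simp: subst_add[symmetric] intro!: imageI supported_add)
    next
      case (mult f g)
      then obtain F G where "F \<in> ?P" "G \<in> ?P" "f = ?\<Phi> F" "g = ?\<Phi> G" by blast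
      moreover from this have "F * G \<in> ?P" using supported_mult[OF power_exponents_add] by blast
      ultimately show ?case by (auto simp: subst_mult[symmetric])
    qed
  qed
  note closed = subalgebra_generated.intros
  have one: "1 \<in> ?A" unfolding elem_power_algebra_def using closed(1)[of 1] by simp
  have power: "f ^ m \<in> ?A" if "f \<in> ?A" for f m
    using that by (induction m) (simp_all add: one, simp add: elem_power_algebra_def closed)
  show "?\<Phi> ` ?P \<subseteq> ?A"
  proof (rule image_subsetI)
    fix F assume "F \<in> ?P"
    then show "?\<Phi> F \<in> ?A"
    proof (induction F rule: supported_induct)
      case zero
      show ?case unfolding elem_power_algebra_def using closed(1)[of 0] by simp
    next
      case (single q c)
      have "elem_sym n i ^ Poly_Mapping.lookup q i \<in> ?A" if i: "i \<in> Poly_Mapping.keys q" for i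
      proof -
        obtain j where "i = j * p" "j \<in> {1..k}" using single i unfolding power_exponents_def by blast
        then have "elem_sym n i ^ p \<in> ?A" unfolding elem_power_algebra_def by (intro closed(2)) blast
        moreover obtain e where "Poly_Mapping.lookup q i = p * e"
          using single unfolding power_exponents_def by blast
        ultimately show ?thesis using power[of "elem_sym n i ^ p" e] by (simp add: power_mult)
      qed
      then have "(\<Prod>i\<in>X. elem_sym n i ^ Poly_Mapping.lookup q i) \<in> ?A" if "X \<subseteq> Poly_Mapping.keys q" for X
        using that
      proof (induction X rule: infinite_finite_induct)
        case (insert i X)
        then show ?case by (simp add: elem_power_algebra_def closed)
      qed (simp_all add: one)
      then show ?case
        unfolding subst_single[OF finite_keys subset_refl, of _ q c]
        by (simp add: elem_power_algebra_def closed)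
    next
      case (add F G)
      then show ?case by (simp add: subst_add elem_power_algebra_def closed)
    qed
  qed
qed

lemma bracket_space_eq:
  fixes p n k d :: nat
  assumes p: "p > 0" and d: "int d = int p - a"
  shows "bracket_space p n k a = subst (elem_sym n) ` (supported (bracket_exponents p n k d) :: 'k::field mpoly set)"
proof
  let ?\<Phi> = "subst (elem_sym n) :: 'k mpoly \<Rightarrow> _" and ?R = "\<lambda>d. supported (bracket_exponents p n k d) :: 'k mpoly set"
  let ?gens = "{\<Prod>j=k*p..n. elem_sym n j ^ i j | i :: nat \<Rightarrow> nat. int (\<Sum>j=k*p..n. i j) = int p - a} :: 'k mpoly set"
  have subspace: "const_mult.subspace (?\<Phi> ` ?R d)"
    using span_grade_supported[OF bracket_exponents_exponents, of n p k d 0, where 'k = 'k]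
    by (metis const_mult.subspace_span)
  have power: "Y n j ^ e * f \<in> ?R (e + d')" if "k * p \<le> j" "f \<in> ?R d'" for j e d' f
    using that by (induction e) (simp_all add: Y_mult_bracket[OF p] mult.assoc)
  have product: "(\<Prod>j\<in>J. Y n j ^ i j) \<in> ?R (\<Sum>j\<in>J. i j)" if "finite J" "J \<subseteq> {k * p..}" for J i
    using that
  proof (induction J rule: finite_induct)
    case empty
    have "(1 :: 'k mpoly) = Poly_Mapping.single 0 1" by simp
    then show ?case by (simp add: bracket_exponents_0 supported_def)
  qed (simp add: power)
  have "?gens \<subseteq> ?\<Phi> ` ?R d"
  proof
    fix f assume "f \<in> ?gens"
    then obtain i where i: "f = (\<Prod>j=k*p..n. elem_sym n j ^ i j)" "int (\<Sum>j=k*p..n. i j) = int p - a" by blast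
    then have "(\<Sum>j=k*p..n. i j) = d" using d by linarith
    then have "(\<Prod>j=k*p..n. Y n j ^ i j) \<in> ?R d" using product[of "{k*p..n}" i] by auto
    moreover have "f = ?\<Phi> (\<Prod>j=k*p..n. Y n j ^ i j)" by (simp add: i(1) subst_prod subst_power subst_Y)
    ultimately show "f \<in> ?\<Phi> ` ?R d" by blast
  qed
  then show "bracket_space p n k a \<subseteq> ?\<Phi> ` ?R d"
    unfolding bracket_space_def using subspace by (rule const_mult.span_minimal)
  show "?\<Phi> ` ?R d \<subseteq> bracket_space p n k a"
  proof (rule image_subsetI)
    fix F assume "F \<in> ?R d"
    then show "?\<Phi> F \<in> bracket_space p n k a"
      unfolding bracket_space_def
    proof (induction F rule: supported_induct)
      case (single r c)
      \<comment> \<open>For k = 0 the exponent of e_0 = 1 fills up the degree to d; for k > 0 the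
        index 0 is outside the range.\<close>
      let ?i = "\<lambda>j. if j = 0 then d - monom_degree r else Poly_Mapping.lookup r j"
      have keys: "Poly_Mapping.keys r \<subseteq> {k*p..n}" "0 \<notin> Poly_Mapping.keys r"
        using single by (auto simp: bracket_exponents_def)
      have deg: "monom_degree r = (\<Sum>j=k*p..n. Poly_Mapping.lookup r j)"
        using keys(1) by (simp add: monom_degree_superset)
      have "(\<Sum>j=k*p..n. ?i j) = d"
      proof (cases "k = 0")
        case True
        have "(\<Sum>j=0..n. ?i j) = d - monom_degree r + (\<Sum>j=1..n. Poly_Mapping.lookup r j)"
          by (simp add: sum.atLeast_Suc_atMost)
        moreover have "(\<Sum>j=0..n. Poly_Mapping.lookup r j) = (\<Sum>j=1..n. Poly_Mapping.lookup r j)"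
          using keys(2) by (simp add: sum.atLeast_Suc_atMost in_keys_iff)
        ultimately show ?thesis using True single deg by (simp add: bracket_exponents_def)
      next
        case False
        then have "(\<Sum>j=k*p..n. ?i j) = (\<Sum>j=k*p..n. Poly_Mapping.lookup r j)"
          using p by (intro sum.cong) auto
        then show ?thesis using False single deg by (simp add: bracket_exponents_def)
      qed
      then have gen: "(\<Prod>j=k*p..n. elem_sym n j ^ ?i j) \<in> ?gens"
        using d by (intro CollectI exI[of _ ?i] conjI refl) simp
      have "(\<Prod>j=k*p..n. elem_sym n j ^ ?i j)
          = (\<Prod>j=k*p..n. elem_sym n j ^ Poly_Mapping.lookup r j :: 'k mpoly)"
        using keys(2) single p by (intro prod.cong) (auto simp: in_keys_iff)
      moreover have "?\<Phi> (Poly_Mapping.single r c)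
          = const_mult c (\<Prod>j=k*p..n. elem_sym n j ^ Poly_Mapping.lookup r j)"
        using keys(1) by (simp add: subst_single const_mult_def)
      ultimately have eq: "?\<Phi> (Poly_Mapping.single r c) = const_mult c (\<Prod>j=k*p..n. elem_sym n j ^ ?i j)"
        by (simp only:)
      show ?case unfolding eq by (rule const_mult.span_scale[OF const_mult.span_base[OF gen]])
    qed (simp_all add: subst_add const_mult.span_add const_mult.span_zero)
  qed
qed

lemma cohomology_space_eq:
  fixes p n k d :: nat
  assumes p: "p > 0" and n: "k * p \<le> n" and d: "int d = int p - a"
  shows "const_mult.span {f * g | f g. f \<in> elem_power_algebra p n k \<and> g \<in> bracket_space p n k a}
    = subst (elem_sym n) ` (supported (cohomology_exponents p n k d) :: 'k::field mpoly set)"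
    (is "const_mult.span ?S = ?\<Phi> ` ?W")
proof
  have "const_mult.subspace (?\<Phi> ` ?W)"
    using span_grade_supported[OF cohomology_exponents_exponents[OF p n], of d 0, where 'k = 'k]
    by (metis const_mult.subspace_span)
  moreover have "?S \<subseteq> ?\<Phi> ` ?W"
  proof
    fix h assume "h \<in> ?S"
    then obtain F G where "F \<in> supported (power_exponents p k)" "G \<in> supported (bracket_exponents p n k d)"
      "h = ?\<Phi> F * ?\<Phi> G"
      unfolding elem_power_algebra_eq bracket_space_eq[OF p d] by blast
    moreover from this(1,2) have "F * G \<in> ?W"
      by (rule supported_mult[rotated]) (auto simp: cohomology_exponents_def)
    ultimately show "h \<in> ?\<Phi> ` ?W" by (auto simp: subst_mult[symmetric])
  qed
  ultimately show "const_mult.span ?S \<subseteq> ?\<Phi> ` ?W" by (intro const_mult.span_minimal)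
  show "?\<Phi> ` ?W \<subseteq> const_mult.span ?S"
  proof (rule image_subsetI)
    fix F assume "F \<in> ?W"
    then show "?\<Phi> F \<in> const_mult.span ?S"
    proof (induction F rule: supported_induct)
      case (single m c)
      then obtain q r where m: "m = q + r" "q \<in> power_exponents p k" "r \<in> bracket_exponents p n k d"
        by (auto simp: cohomology_exponents_def)
      have "?\<Phi> (Poly_Mapping.single m c) = ?\<Phi> (Poly_Mapping.single q c) * ?\<Phi> (Poly_Mapping.single r 1)"
        by (simp add: m(1) subst_mult[symmetric] mult_single)
      moreover have "?\<Phi> (Poly_Mapping.single q c) \<in> elem_power_algebra p n k"
        unfolding elem_power_algebra_eq by (intro imageI supported_single m(2))
      moreover have "?\<Phi> (Poly_Mapping.single r 1) \<in> bracket_space p n k a"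
        unfolding bracket_space_eq[OF p d] by (intro imageI supported_single m(3))
      ultimately show ?case by (intro const_mult.span_base) blast
    qed (simp_all add: subst_add const_mult.span_add const_mult.span_zero)
  qed
qed

theorem proposition2p16:
  fixes p n k :: nat
  assumes "CHAR('k::field) = p" and "p > 0"
    and "k * p \<le> n" and "n \<le> (k + 1) * p - 1"
  shows "p_dg_algebra_quasi_iso p (elem_power_dga p n k :: ('k, 'k mpoly) p_complex) (Sym n) (\<lambda>f. f)
    \<and> (\<forall>a::int. 1 \<le> a \<and> a \<le> int n - int (k * p) \<longrightarrow>
          p_acyclic p (rank_one n a :: ('k, 'k mpoly) p_complex))
    \<and> (\<forall>a::int. int n - int (k * p) + 1 \<le> a \<and> a \<le> int p - 1 \<longrightarrow>
          stably_isomorphic p (rank_one n a :: ('k, 'k mpoly) p_complex) (cohomology_complex p n k a))"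
proof (intro conjI allI impI)
  note char = assms(1,2)
  let ?\<Phi> = "subst (elem_sym n) :: 'k mpoly \<Rightarrow> _"
  have n: "k * p \<le> n" "n < Suc k * p" using assms by auto
  let ?\<sigma> = "int n * (1 - int n) div 2"

  show "p_acyclic p (rank_one n a :: ('k, 'k mpoly) p_complex)"
    if a: "1 \<le> a \<and> a \<le> int n - int (k * p)" for a
  proof -
    have "exact_modulo p (diffop n a :: 'k mpoly \<Rightarrow> _) (polys n) (supported {})"
      unfolding supported_empty using n(2) a by (intro exact_interior[OF char n(1)]) simp_all
    then interpret exact_pair "const_mult :: 'k \<Rightarrow> _" "\<lambda>i. grade (Sym n) (i - ?\<sigma>)" "twisted_deriv n a" p
      "?\<Phi> ` supported {}"
      by (intro exact_pair_Sym[OF char]) (simp_all add: supported_empty diffop_def)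
    \<comment> \<open>The empty set of exponents makes W zero, so the companion complex on W is the
      zero complex.\<close>
    show ?thesis
      by (rule acyclic[where N = "\<lparr>scale = const_mult, grade = \<lambda>i. grade (Sym n) (i - ?\<sigma>) \<inter> ?\<Phi> ` supported {},
            diff = twisted_deriv n a\<rparr>"])
        (simp_all add: rank_one_simps supported_empty)
  qed

  show "stably_isomorphic p (rank_one n a :: ('k, 'k mpoly) p_complex) (cohomology_complex p n k a)"
    if a: "int n - int (k * p) + 1 \<le> a \<and> a \<le> int p - 1" for a
  proof -
    \<comment> \<open>Nonnegative since a is at most p - 1; in the field a = -d.\<close>
    define d where "d = nat (int p - a)"
    have d: "int d = int p - a" using a by (simp add: d_def)
    have "int d + int n < int (k * p) + int p" using d a by linarith
    then have "int (d + n) < int (Suc k * p)" by simp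
    then have dn: "d + n < Suc k * p" by (simp only: of_nat_less_iff)
    let ?T = "cohomology_exponents p n k d"
    have "(of_int a :: 'k) = of_int (int p - int d)" using d by simp
    also have "\<dots> = of_int (- int d)" using of_nat_CHAR[where 'a = 'k] char(1) by simp
    finally have D: "(diffop n a :: 'k mpoly \<Rightarrow> _) = diffop n (- int d)" by (rule diffop_cong)
    interpret exact_pair "const_mult :: 'k \<Rightarrow> _" "\<lambda>i. grade (Sym n) (i - ?\<sigma>)" "twisted_deriv n a" p
      "?\<Phi> ` supported ?T"
      by (rule exact_pair_Sym[OF char cohomology_exponents_exponents[OF char(2) n(1)]])
        (simp_all only: D diffop_cohomology[OF char] exact_cohomology[OF char n dn])
    have W: "module.span const_mult {f * g | f g. f \<in> elem_power_algebra p n k \<and> g \<in> bracket_space p n k a}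
        = ?\<Phi> ` supported ?T"
      by (rule cohomology_space_eq[OF char(2) n(1) d])
    have "quasi_iso p (rank_one n a) (cohomology_complex p n k a) proj"
      by (rule quasi_isos) (simp_all add: cohomology_complex_def subcomplex_def W rank_one_simps)
    then show ?thesis unfolding stably_isomorphic_def by blast
  qed

  \<comment> \<open>Part (i) is the case d = 0: the twist 0 stands for a = p, and W is the algebra
    generated by the p-th powers, on which the differential vanishes.\<close>
  let ?T = "cohomology_exponents p n k 0"
  have T: "?T = power_exponents p k" by (simp add: cohomology_exponents_def bracket_exponents_0)
  have D0: "diffop n 0 F = 0" if "F \<in> supported ?T" for F :: "'k mpoly"
    using that unfolding T
  proof (induction F rule: supported_induct)
    case (single q c)
    then show ?case by (simp add: diffop_def der_power_exponents[OF char(1)])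
  next
    case (add F G)
    then show ?case by (simp add: diffop_add)
  qed (simp add: diffop_def)
  have "exact_modulo p (diffop n (- int 0) :: 'k mpoly \<Rightarrow> _) (polys n) (supported ?T)"
    using n by (intro exact_cohomology[OF char]) simp_all
  then interpret exact_pair "const_mult :: 'k \<Rightarrow> _" "\<lambda>i. grade (Sym n) (i - 0)" "twisted_deriv n 0" p
    "?\<Phi> ` supported ?T"
    by (intro exact_pair_Sym[OF char cohomology_exponents_exponents[OF char(2) n(1)]])
      (simp_all add: D0)
  let ?A = "elem_power_dga p n k :: ('k, 'k mpoly) p_complex"
  have A: "scale ?A = const_mult" "grade ?A i = grade (Sym n) i \<inter> elem_power_algebra p n k" "diff ?A f = 0" for i f
    by (simp_all add: elem_power_dga_def subcomplex_def Sym_simps)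
  have A_eq: "elem_power_algebra p n k = ?\<Phi> ` supported ?T" unfolding T by (rule elem_power_algebra_eq)
  have D_A: "twisted_deriv n 0 f = 0" if "f \<in> ?\<Phi> ` supported ?T" for f
    using that D0 by (auto simp: subst_diffop[symmetric])
  have M: "scale (Sym n) = const_mult" "grade (Sym n) = (\<lambda>i. grade (Sym n) (i - 0))"
    "\<And>f. diff (Sym n) f = twisted_deriv n 0 f"
    by (simp_all add: Sym_simps)
  have N: "grade ?A i = grade (Sym n) (i - 0) \<inter> ?\<Phi> ` supported ?T"
    "f \<in> ?\<Phi> ` supported ?T \<Longrightarrow> diff ?A f = twisted_deriv n 0 f" for i f
    by (simp_all add: A A_eq D_A)
  have quasi: "quasi_iso p ?A (Sym n) (\<lambda>f. f)"
    by (rule quasi_isos(1)[OF M A(1) N])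
  have complexes: "is_p_complex p (Sym n :: ('k, 'k mpoly) p_complex)" "is_p_complex p ?A"
    using quasi by (simp_all add: quasi_iso_def)
  have one: "1 \<in> grade (Sym n) 0"
    using symmetric_polys_const[of 1 n] homogeneous_const[of 1] by (auto simp: grade_Sym_iff)
  have "p_dg_algebra p (Sym n :: ('k, 'k mpoly) p_complex)"
    unfolding p_dg_algebra_def using complexes(1) one
    by (simp add: grade_Sym_mult Sym_simps twisted_deriv_def const_mult_def deriv_mult mult.assoc)
  moreover have "p_dg_algebra p ?A"
    unfolding p_dg_algebra_def using complexes(2) one
      subalgebra_generated.const[of 1] subalgebra_generated.mult
    by (auto simp: A grade_Sym_mult elem_power_algebra_def const_mult_def mult.assoc)
  moreover have "p_dg_algebra_hom ?A (Sym n) (\<lambda>f. f)"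
    using quasi by (simp add: p_dg_algebra_hom_def quasi_iso_def)
  ultimately show "p_dg_algebra_quasi_iso p ?A (Sym n) (\<lambda>f. f)"
    unfolding p_dg_algebra_quasi_iso_def using quasi by blast
qed

end
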